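(* Let $\mathfrak A=\mathfrak A_0\oplus\mathfrak A_1$ be a Leibniz superalgebra over a field $k$ with a (well-ordered) linear basis $A=A_0\cup A_1$, where $A_i$ is a linear basis of $\mathfrak A_i$ ($i=0,1$), and multiplication table $(aa')=\{a\cdot a'\}$, $a,a'\in A$. Let $\mathfrak B=\mathrm{Lb}_s(B\mid R)=\mathrm{Lb}_s(B)/\mathrm{Id}(R)$ be a Leibniz superalgebra generated by a well-ordered set $B=B_0\cup B_1$ with defining relations $R$, where $R$ is a reduced Gröbner–Shirshov basis in $\mathrm{Lb}_s(B)$ and the length of the leading monomial of each polynomial in $R$ is greater than $1$. Then a Leibniz superalgebra $\mathfrak E$ is an extension of $\mathfrak B$ by $\mathfrak A$ if and only if $$\mathfrak E\cong E_{(\mathfrak A,\mathfrak B,\lfloor\ \rfloor,\cdot)}=\mathrm{Lb}_s\left(A\cup B\ \left|\ \begin{array}{ll}(aa')-\{a\cdot a'\}, & a,a'\in A\\ (ab)-\{a\cdot b\},\ (\nu a)-\{\nu\cdot a\}, & a\in A,\ b\in B,\ \nu\in\mathrm{NF}(B)\\ f-\lfloor f\rfloor, & f\in R\end{array}\right.\right)$$ for some compatible $\mathrm{Lb}_s(B)$-supermodule structure on $\mathfrak A$ (with supermodule operation denoted $\cdot$) and some map $\lfloor\ \rfloor:R\to\mathfrak A$, $f\mapsto\lfloor f\rfloor$, satisfying $|f|=|\lfloor f\rfloor|$ (i.e. $\lfloor f\rfloor\in\mathfrak A_{|f|}$), such that (i) for all $a\in A$, $f\in R$: $a\cdot f=\{a\cdot\lfloor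 f\rfloor\}$ and $f\cdot a=\{\lfloor f\rfloor\cdot a\}$ in $\mathfrak A$; (ii) for all $\mu\in\mathrm{NF}(B)$, $f\in R$, writing (uniquely) $(\mu f)=\sum\alpha_ih_{i,s_i}$ as in the context, $\mu\cdot\lfloor f\rfloor=\sum\alpha_ih_{i,\lfloor s_i\rfloor}$ holds in $\mathfrak A$, where $h_{i,\lfloor s_i\rfloor}=\{\{\{\lfloor s_i\rfloor\cdot b_{i_1}\}\cdots\}\cdot b_{i_{n_i}}\}$ if $h_{i,s_i}=[s_ib_{i_1}\cdots b_{i_{n_i}}]_L$. If this is the case, then $\mathfrak E\cong E_{(\mathfrak A,\mathfrak B,\lfloor\ \rfloor,\cdot)}=\mathfrak A\oplus\mathfrak B$ as a vector space, where $\mathfrak B$ is identified with the vector space spanned by $\mathrm{Irr}(R)$, and the multiplication in $E_{(\mathfrak A,\mathfrak B,\lfloor\ \rfloor,\cdot)}$ is given, for all $a,a'\in A$ and $\nu,\nu'\in\mathrm{Irr}(R)$, by $$((a+\nu)(a'+\nu'))=\{a\cdot a'\}+\{a\cdot\nu'\}+\{\nu\cdot a'\}+\sum\beta_jh_{j,\lfloor g_j\rfloor}+\sum\delta_i\nu_i,$$ where $\delta_i,\beta_j\in k$, $\nu_i\in\mathrm{Irr}(R)$ and the normal $R$-polynomials $h_{j,g_j}$ ($g_j\in R$) are the unique ones such that $(\nu\nu')=\sum\delta_i\nu_i+\sum\beta_jh_{j,g_j}$ in $\mathrm{Lb}_s(B)$.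
   Context: Superalgebras. $k$ is a field. A superalgebra is a $k$-vector space $\mathcal A=\mathcal A_0\oplus\mathcal A_1$ with a bilinear product $(xy)$ such that $(\mathcal A_i\mathcal A_j)\subseteq\mathcal A_{i+j}$ (indices in $\mathbb Z_2$); elements of $\mathcal A_0\cup\mathcal A_1$ are homogeneous, with parity $|x|=i$ for $x\in\mathcal A_i$. It is a Leibniz superalgebra if $(x(yz))=((xy)z)-(-1)^{|z||y|}((xz)y)$ for all homogeneous $x,y,z$. Homomorphisms are parity-preserving linear multiplicative maps. $\mathfrak E$ is an extension of $\mathfrak B$ by $\mathfrak A$ if there is a short exact sequence $0\to\mathfrak A\to\mathfrak E\to\mathfrak B\to0$ of Leibniz superalgebras. Free Leibniz superalgebra. For a well-ordered set $X=X_0\cup X_1$ (disjoint; elements of $X_i$ have parity $i$), $\mathrm{Lb}_s(X)$ is the free Leibniz superalgebra over $k$ on $X$. $[f_1\cdots f_n]_L:=((\cdots((f_1f_2)f_3)\cdots)f_n)$. $\mathrm{NF}(X)=\{[a_1\cdots a_n]_L\mid a_i\in X, n\ge1\}$ is a linear basis of $\mathrm{Lb}_s(X)$; $\ell([a_1\cdots a_n]_L)=n$; parity is $\sum|a_i|$. For homogeneous $S$, $\mathrm{Id}(S)$ is the (graded, two-sided) ideal generated by $S$ and $\mathrm{Lb}_s(X\mid S)=\mathrm{Lb}_s(X)/\mathrm{Id}(S)$. Order. Every generator has degree $1$, so $\deg([a_1\cdots a_n]_L)=n$, and $\mathrm{NF}(X)$ is ordered by: $\mu<\nu$ iff $(\deg\mu,\ell(\mu),a_1,\dots,a_n)<(\deg\nu,\ell(\nu),b_1,\dots,b_m)$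 lexicographically, for $\mu=[a_1\cdots a_n]_L$, $\nu=[b_1\cdots b_m]_L$. $\overline f$ is the leading (largest) monomial of $f\ne0$; $f$ is monic if $\overline f$ has coefficient $1$; $\mathrm{supp}(f)$ is the set of monomials of $\mathrm{NF}(X)$ occurring in $f$; $f$ is homogeneous if all its monomials have the same parity. Gröbner–Shirshov bases. Let $S\subseteq\mathrm{Lb}_s(X)$ be a monic homogeneous set, $s\in S$, $a_1,\dots,a_m\in X$, $m\ge0$. Normal $S$-polynomials are (1) $[sa_1\cdots a_m]_L$, and (2) $[a_1\cdots a_tsa_{t+1}\cdots a_m]_L$ if $\ell(\overline s)=1$, $1\le t\le m$; notation $h_s$. $\mathrm{Irr}(S)=\{\mu\in\mathrm{NF}(X)\mid\mu\ne\overline{h_s}$ for every normal $S$-polynomial $h_s\}$. An element is trivial modulo $(S,\mu)$ (resp. $(S,n)$) if it is a linear combination of normal $S$-polynomials with leading monomials $<\mu$ (resp. of degree $\le n$). $S$ is a Gröbner–Shirshov basis if: for all $f\neq g$ in $S$ with $\overline f=\overline{h_g}$, $f-h_g$ is trivial modulo $(S,\overline f)$; and for all $f\in S$ with $\ell(\overline f)>1$ and $\mu\in\mathrm{NF}(X)$ with $(\mu f)\neq0$, $(\mu f)$ is trivial modulo $(S,\deg\mu+\deg\overline f)$. It is reduced if $\mathrm{supp}(s)\subseteq\mathrm{Irr}(S\setminus\{s\})$ for all $s\in S$. Unique expressions. With $R$ as in the claim, every normal $R$-polynomial has the form $h_s=[sc_1\cdots c_n]_L$ ($s\in R$, $c_i\in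 B$, $n\ge0$), and every nonzero $h\in\mathrm{Id}(R)\subseteq \mathrm{Lb}_s(B)$ has a unique expression $h=\sum_{i=1}^t\alpha_ih_{i,s_i}$ with $0\ne\alpha_i\in k$ and normal $R$-polynomials $h_{i,s_i}$ such that $\overline{h_{t,s_t}}<\cdots<\overline{h_{1,s_1}}=\overline h$ (for $h=0$ the sum is empty). This is the expression used for $(\mu f)$ in (ii). Supermodules. A supermodule over a Leibniz superalgebra $\mathfrak C$ is a vector space $\mathfrak A=\mathfrak A_0\oplus\mathfrak A_1$ with bilinear maps $\mathfrak C\times\mathfrak A\to\mathfrak A$, $(x,f)\mapsto x\cdot f$ and $\mathfrak A\times\mathfrak C\to\mathfrak A$, $(f,x)\mapsto f\cdot x$ with $\mathfrak A_i\cdot\mathfrak C_j,\ \mathfrak C_i\cdot\mathfrak A_j\subseteq\mathfrak A_{i+j}$ and, for homogeneous $f\in\mathfrak A$, $x,y\in\mathfrak C$: $f\cdot(xy)=(f\cdot x)\cdot y-(-1)^{|x||y|}(f\cdot y)\cdot x$; $x\cdot(y\cdot f)=(xy)\cdot f-(-1)^{|f||y|}(x\cdot f)\cdot y$; $x\cdot(f\cdot y)=(x\cdot f)\cdot y-(-1)^{|f||y|}(xy)\cdot f$. If $\mathfrak A$ is also a Leibniz superalgebra, the supermodule is compatible if, writing $f\cdot f'$ for the product $(ff')$ of $\mathfrak A$, for homogeneous $f,f'\in\mathfrak A$, $x\in\mathfrak C$: $x\cdot(ff')=(x\cdot f)\cdot f'-(-1)^{|f||f'|}(x\cdot f')\cdot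 f$; $f\cdot(f'\cdot x)=(ff')\cdot x-(-1)^{|x||f'|}(f\cdot x)\cdot f'$; $f\cdot(x\cdot f')=(f\cdot x)\cdot f'-(-1)^{|x||f'|}(ff')\cdot x$. Notation. $A$ and $B$ are disjoint, and $A\cup B$ is well-ordered with $a<b$ for $a\in A$, $b\in B$. For $x,y$ each in $\mathfrak A$ or $\mathrm{Lb}_s(B)$, at least one in $\mathfrak A$, $\{x\cdot y\}$ denotes the element $x\cdot y\in\mathfrak A$ (product of $\mathfrak A$ or supermodule operation) written as a linear combination of elements of $A$, hence regarded as an element of $\mathrm{Lb}_s(A\cup B)$; similarly $\lfloor f\rfloor\in\mathfrak A$ is regarded as a linear combination of elements of $A$. *)

theory Defs
  imports Complex_Main "HOL-Algebra.QuotRing" "HOL-Algebra.Module" "HOL-Library.Poly_Mapping" "HOL-Library.Z2"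
begin

abbreviation lookup :: "('w \<Rightarrow>\<^sub>0 'k::zero) \<Rightarrow> 'w \<Rightarrow> 'k"
  where "lookup \<equiv> Poly_Mapping.lookup"

abbreviation keys :: "('w \<Rightarrow>\<^sub>0 'k::zero) \<Rightarrow> 'w set"
  where "keys \<equiv> Poly_Mapping.keys"

section \<open>Superalgebras\<close>

text \<open>
  The scalars form a type \<open>'k :: field\<close>; indices in $\mathbb{Z}_2$ have type \<^typ>\<open>bit\<close>.
  A superalgebra is a record with an explicit carrier, so that quotients are again of this kind.
  The unit slot \<^const>\<open>one\<close>, inherited from the ring records, is never used.
\<close>

record ('k, 'a) superalgebra = "('k, 'a) module" +
  part :: "bit \<Rightarrow> 'a set"

definition ksign :: "bit \<Rightarrow> 'k::ring_1"
  where "ksign i = (if i = 0 then 1 else - 1)"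

locale superalgebra = abelian_group A for A :: "('k::field, 'a, 'm) superalgebra_scheme" (structure) +
  assumes smult_closed: "x \<in> carrier A \<Longrightarrow> c \<odot> x \<in> carrier A"
    and smult_l_distr: "x \<in> carrier A \<Longrightarrow> (c + d) \<odot> x = c \<odot> x \<oplus> d \<odot> x"
    and smult_r_distr: "x \<in> carrier A \<Longrightarrow> y \<in> carrier A \<Longrightarrow> c \<odot> (x \<oplus> y) = c \<odot> x \<oplus> c \<odot> y"
    and smult_assoc: "x \<in> carrier A \<Longrightarrow> (c * d) \<odot> x = c \<odot> (d \<odot> x)"
    and smult_one: "x \<in> carrier A \<Longrightarrow> 1 \<odot> x = x"
    and mult_closed: "x \<in> carrier A \<Longrightarrow> y \<in> carrier A \<Longrightarrow> x \<otimes> y \<in> carrier A"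
    and mult_add_left: "x \<in> carrier A \<Longrightarrow> y \<in> carrier A \<Longrightarrow> z \<in> carrier A \<Longrightarrow>
          (x \<oplus> y) \<otimes> z = x \<otimes> z \<oplus> y \<otimes> z"
    and mult_add_right: "x \<in> carrier A \<Longrightarrow> y \<in> carrier A \<Longrightarrow> z \<in> carrier A \<Longrightarrow>
          z \<otimes> (x \<oplus> y) = z \<otimes> x \<oplus> z \<otimes> y"
    and mult_smult_left: "x \<in> carrier A \<Longrightarrow> y \<in> carrier A \<Longrightarrow> (c \<odot> x) \<otimes> y = c \<odot> (x \<otimes> y)"
    and mult_smult_right: "x \<in> carrier A \<Longrightarrow> y \<in> carrier A \<Longrightarrow> x \<otimes> (c \<odot> y) = c \<odot> (x \<otimes> y)"
    and part_carrier: "part A i \<subseteq> carrier A"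
    and part_zero: "\<zero> \<in> part A i"
    and part_add: "x \<in> part A i \<Longrightarrow> y \<in> part A i \<Longrightarrow> x \<oplus> y \<in> part A i"
    and part_smult: "x \<in> part A i \<Longrightarrow> c \<odot> x \<in> part A i"
    and part_direct_sum: "x \<in> carrier A \<Longrightarrow> \<exists>!p. p \<in> part A 0 \<times> part A 1 \<and> x = fst p \<oplus> snd p"
    and part_mult: "x \<in> part A i \<Longrightarrow> y \<in> part A j \<Longrightarrow> x \<otimes> y \<in> part A (i + j)"

locale leibniz_superalgebra = superalgebra A
  for A :: "('k::field, 'a, 'm) superalgebra_scheme" (structure) +
  assumes leibniz: "x \<in> part A i \<Longrightarrow> y \<in> part A j \<Longrightarrow> z \<in> part A l \<Longrightarrow>
    x \<otimes> (y \<otimes> z) = ((x \<otimes> y) \<otimes> z) \<ominus> ksign (l * j) \<odot> ((x \<otimes> z) \<otimes> y)"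

definition linear_map ::
  "('k, 'a, 'm) module_scheme \<Rightarrow> ('k, 'b, 'n) module_scheme \<Rightarrow> ('a \<Rightarrow> 'b) \<Rightarrow> bool"
  where "linear_map M N h \<longleftrightarrow>
    h \<in> carrier M \<rightarrow> carrier N \<and>
    (\<forall>x\<in>carrier M. \<forall>y\<in>carrier M. h (x \<oplus>\<^bsub>M\<^esub> y) = h x \<oplus>\<^bsub>N\<^esub> h y) \<and>
    (\<forall>c. \<forall>x\<in>carrier M. h (c \<odot>\<^bsub>M\<^esub> x) = c \<odot>\<^bsub>N\<^esub> h x)"

definition linear_iso ::
  "('k, 'a, 'm) module_scheme \<Rightarrow> ('k, 'b, 'n) module_scheme \<Rightarrow> ('a \<Rightarrow> 'b) \<Rightarrow> bool"
  where "linear_iso M N h \<longleftrightarrow> linear_map M N h \<and> bij_betw h (carrier M) (carrier N)"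

definition superalgebra_hom ::
  "('k, 'a, 'm) superalgebra_scheme \<Rightarrow> ('k, 'b, 'n) superalgebra_scheme \<Rightarrow> ('a \<Rightarrow> 'b) \<Rightarrow> bool"
  where "superalgebra_hom L M h \<longleftrightarrow>
    linear_map L M h \<and>
    (\<forall>x\<in>carrier L. \<forall>y\<in>carrier L. h (x \<otimes>\<^bsub>L\<^esub> y) = h x \<otimes>\<^bsub>M\<^esub> h y) \<and>
    (\<forall>i. h ` part L i \<subseteq> part M i)"

definition superalgebra_isomorphic ::
  "('k, 'a, 'm) superalgebra_scheme \<Rightarrow> ('k, 'b, 'n) superalgebra_scheme \<Rightarrow> bool"
  where "superalgebra_isomorphic L M \<longleftrightarrow>
    (\<exists>h. superalgebra_hom L M h \<and> bij_betw h (carrier L) (carrier M))"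

text \<open>\<open>is_extension E B A\<close>: there is a short exact sequence \<open>0 \<rightarrow> A \<rightarrow> E \<rightarrow> B \<rightarrow> 0\<close>.\<close>

definition is_extension ::
  "('k::field, 'e, 'l) superalgebra_scheme \<Rightarrow> ('k, 'b, 'm) superalgebra_scheme \<Rightarrow>
   ('k, 'a, 'n) superalgebra_scheme \<Rightarrow> bool"
  where "is_extension E B A \<longleftrightarrow>
    leibniz_superalgebra A \<and> leibniz_superalgebra E \<and> leibniz_superalgebra B \<and>
    (\<exists>\<iota> \<pi>. superalgebra_hom A E \<iota> \<and> superalgebra_hom E B \<pi> \<and>
      inj_on \<iota> (carrier A) \<and> \<pi> ` carrier E = carrier B \<and>
      \<iota> ` carrier A = {x \<in> carrier E. \<pi> x = \<zero>\<^bsub>B\<^esub>})"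

text \<open>Graded two-sided ideals, the ideal generated by a set, and quotients.\<close>

definition super_ideal :: "('k, 'a, 'm) superalgebra_scheme \<Rightarrow> 'a set \<Rightarrow> bool"
  where "super_ideal L I \<longleftrightarrow>
    I \<subseteq> carrier L \<and> \<zero>\<^bsub>L\<^esub> \<in> I \<and>
    (\<forall>x\<in>I. \<forall>y\<in>I. x \<oplus>\<^bsub>L\<^esub> y \<in> I) \<and> (\<forall>c. \<forall>x\<in>I. c \<odot>\<^bsub>L\<^esub> x \<in> I) \<and>
    (\<forall>x\<in>I. \<forall>y\<in>carrier L. x \<otimes>\<^bsub>L\<^esub> y \<in> I \<and> y \<otimes>\<^bsub>L\<^esub> x \<in> I) \<and>
    (\<forall>x\<in>part L 0. \<forall>y\<in>part L 1. x \<oplus>\<^bsub>L\<^esub> y \<in> I \<longrightarrow> x \<in> I \<and> y \<in> I)"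

definition super_Id :: "('k, 'a, 'm) superalgebra_scheme \<Rightarrow> 'a set \<Rightarrow> 'a set"
  where "super_Id L S = \<Inter> {I. super_ideal L I \<and> S \<subseteq> I}"

definition super_quot ::
  "('k, 'a, 'm) superalgebra_scheme \<Rightarrow> 'a set \<Rightarrow> ('k, 'a set) superalgebra"
  where "super_quot L I =
    \<lparr>carrier = a_rcosets\<^bsub>L\<^esub> I, mult = rcoset_mult L I, one = I +>\<^bsub>L\<^esub> \<one>\<^bsub>L\<^esub>, zero = I,
     add = set_add L, smult = (\<lambda>c C. \<Union>x\<in>C. I +>\<^bsub>L\<^esub> (c \<odot>\<^bsub>L\<^esub> x)),
     part = (\<lambda>i. (\<lambda>x. I +>\<^bsub>L\<^esub> x) ` part L i)\<rparr>"

text \<open>External direct sum; it is only used as a vector space.\<close>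

definition direct_sum ::
  "('k, 'a, 'm) module_scheme \<Rightarrow> ('k, 'b, 'n) module_scheme \<Rightarrow> ('k, 'a \<times> 'b) module"
  where "direct_sum M N =
    \<lparr>carrier = carrier M \<times> carrier N,
     mult = (\<lambda>(x, y) (x', y'). (x \<otimes>\<^bsub>M\<^esub> x', y \<otimes>\<^bsub>N\<^esub> y')), one = (\<one>\<^bsub>M\<^esub>, \<one>\<^bsub>N\<^esub>),
     zero = (\<zero>\<^bsub>M\<^esub>, \<zero>\<^bsub>N\<^esub>), add = (\<lambda>(x, y) (x', y'). (x \<oplus>\<^bsub>M\<^esub> x', y \<oplus>\<^bsub>N\<^esub> y')),
     smult = (\<lambda>c (x, y). (c \<odot>\<^bsub>M\<^esub> x, c \<odot>\<^bsub>N\<^esub> y))\<rparr>"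

subsection \<open>Linear bases\<close>

definition lin_comb :: "('k::field, 'a, 'm) module_scheme \<Rightarrow> ('a \<Rightarrow>\<^sub>0 'k) \<Rightarrow> 'a"
  where "lin_comb M c = finsum M (\<lambda>a. lookup c a \<odot>\<^bsub>M\<^esub> a) (keys c)"

definition linear_basis :: "('k::field, 'a, 'm) module_scheme \<Rightarrow> 'a set \<Rightarrow> 'a set \<Rightarrow> bool"
  where "linear_basis M W S \<longleftrightarrow> S \<subseteq> W \<and> (\<forall>v\<in>W. \<exists>!c. keys c \<subseteq> S \<and> v = lin_comb M c)"

definition coordinates :: "('k::field, 'a, 'm) module_scheme \<Rightarrow> 'a set \<Rightarrow> 'a \<Rightarrow> ('a \<Rightarrow>\<^sub>0 'k)"
  where "coordinates M S v = (THE c. keys c \<subseteq> S \<and> v = lin_comb M c)"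

subsection \<open>Supermodules\<close>

text \<open>\<open>lact x f\<close> stands for \<open>x \<cdot> f\<close> and \<open>ract f x\<close> for \<open>f \<cdot> x\<close>, where \<open>x \<in> C\<close> and \<open>f \<in> A\<close>.\<close>

definition supermodule ::
  "('k::field, 'c, 'm) superalgebra_scheme \<Rightarrow> ('k, 'a, 'n) superalgebra_scheme \<Rightarrow>
   ('c \<Rightarrow> 'a \<Rightarrow> 'a) \<Rightarrow> ('a \<Rightarrow> 'c \<Rightarrow> 'a) \<Rightarrow> bool"
  where "supermodule C A lact ract \<longleftrightarrow>
    (\<forall>x\<in>carrier C. linear_map A A (lact x)) \<and>
    (\<forall>f\<in>carrier A. linear_map C A (\<lambda>x. lact x f)) \<and>
    (\<forall>x\<in>carrier C. linear_map A A (\<lambda>f. ract f x)) \<and>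
    (\<forall>f\<in>carrier A. linear_map C A (ract f)) \<and>
    (\<forall>i j. \<forall>f\<in>part A i. \<forall>x\<in>part C j. ract f x \<in> part A (i + j) \<and> lact x f \<in> part A (j + i)) \<and>
    (\<forall>l i j. \<forall>f\<in>part A l. \<forall>x\<in>part C i. \<forall>y\<in>part C j.
      ract f (x \<otimes>\<^bsub>C\<^esub> y) = ract (ract f x) y \<ominus>\<^bsub>A\<^esub> ksign (i * j) \<odot>\<^bsub>A\<^esub> ract (ract f y) x \<and>
      lact x (lact y f) = lact (x \<otimes>\<^bsub>C\<^esub> y) f \<ominus>\<^bsub>A\<^esub> ksign (l * j) \<odot>\<^bsub>A\<^esub> ract (lact x f) y \<and>
      lact x (ract f y) = ract (lact x f) y \<ominus>\<^bsub>A\<^esub> ksign (l * j) \<odot>\<^bsub>A\<^esub> lact (x \<otimes>\<^bsub>C\<^esub> y) f)"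

definition compatible_supermodule ::
  "('k::field, 'c, 'm) superalgebra_scheme \<Rightarrow> ('k, 'a, 'n) superalgebra_scheme \<Rightarrow>
   ('c \<Rightarrow> 'a \<Rightarrow> 'a) \<Rightarrow> ('a \<Rightarrow> 'c \<Rightarrow> 'a) \<Rightarrow> bool"
  where "compatible_supermodule C A lact ract \<longleftrightarrow>
    supermodule C A lact ract \<and>
    (\<forall>l m i. \<forall>f\<in>part A l. \<forall>f'\<in>part A m. \<forall>x\<in>part C i.
      lact x (f \<otimes>\<^bsub>A\<^esub> f') = lact x f \<otimes>\<^bsub>A\<^esub> f' \<ominus>\<^bsub>A\<^esub> ksign (l * m) \<odot>\<^bsub>A\<^esub> (lact x f' \<otimes>\<^bsub>A\<^esub> f) \<and>
      f \<otimes>\<^bsub>A\<^esub> ract f' x = ract (f \<otimes>\<^bsub>A\<^esub> f') x \<ominus>\<^bsub>A\<^esub> ksign (i * m) \<odot>\<^bsub>A\<^esub> (ract f x \<otimes>\<^bsub>A\<^esub> f') \<and>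
      f \<otimes>\<^bsub>A\<^esub> lact x f' = ract f x \<otimes>\<^bsub>A\<^esub> f' \<ominus>\<^bsub>A\<^esub> ksign (i * m) \<odot>\<^bsub>A\<^esub> ract (f \<otimes>\<^bsub>A\<^esub> f') x)"

section \<open>The free Leibniz superalgebra\<close>

text \<open>
  A graded set \<open>X = X\<^sub>0 \<union> X\<^sub>1\<close> is a family \<open>X :: bit \<Rightarrow> 'x set\<close>. The monomial
  $[a_1\cdots a_n]_L$ is encoded by the nonempty list \<open>[a\<^sub>1, \<dots>, a\<^sub>n]\<close>, and an element of the
  free Leibniz superalgebra by its (finitely supported) coefficients with respect to the
  basis \<open>NF X\<close>. The product of two monomials is computed from
  $x(yb) = (xy)b - (-1)^{|y||b|}(xb)y$ for a letter $b$. That this is the free Leibniz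
  superalgebra on \<open>X\<close> is proved below (\<open>leibniz_superalgebra_Lbs\<close>, \<open>Lbs_universal\<close>).
\<close>

definition gset :: "(bit \<Rightarrow> 'x set) \<Rightarrow> 'x set"
  where "gset X = X 0 \<union> X 1"

definition letter_parity :: "(bit \<Rightarrow> 'x set) \<Rightarrow> 'x \<Rightarrow> bit"
  where "letter_parity X a = (if a \<in> X 1 then 1 else 0)"

definition parity :: "(bit \<Rightarrow> 'x set) \<Rightarrow> 'x list \<Rightarrow> bit"
  where "parity X w = (\<Sum>a\<leftarrow>w. letter_parity X a)"

definition NF :: "(bit \<Rightarrow> 'x set) \<Rightarrow> 'x list set"
  where "NF X = {w. w \<noteq> [] \<and> set w \<subseteq> gset X}"

definition pscale :: "'k::field \<Rightarrow> ('w \<Rightarrow>\<^sub>0 'k) \<Rightarrow> ('w \<Rightarrow>\<^sub>0 'k)"  (infixr \<open>*p\<close> 75)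
  where "c *p f = Poly_Mapping.map ((*) c) f"

lemma lookup_pscale [simp]: "lookup (c *p f) w = c * lookup f w"
  by (simp add: pscale_def Poly_Mapping.map.rep_eq when_def)

interpretation lb: vector_space "pscale :: 'k::field \<Rightarrow> ('w \<Rightarrow>\<^sub>0 'k) \<Rightarrow> _"
  by unfold_locales (auto intro!: poly_mapping_eqI simp: lookup_add algebra_simps)

abbreviation nfmon :: "'x list \<Rightarrow> ('x list \<Rightarrow>\<^sub>0 'k::field)"
  where "nfmon w \<equiv> Poly_Mapping.single w 1"

abbreviation gen :: "'x \<Rightarrow> ('x list \<Rightarrow>\<^sub>0 'k::field)"
  where "gen a \<equiv> nfmon [a]"

definition lin_ext :: "('v \<Rightarrow> ('w \<Rightarrow>\<^sub>0 'k)) \<Rightarrow> ('v \<Rightarrow>\<^sub>0 'k::field) \<Rightarrow> ('w \<Rightarrow>\<^sub>0 'k)"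
  where "lin_ext F f = (\<Sum>w\<in>keys f. lookup f w *p F w)"

text \<open>The second monomial is passed in reverse, so that its last letter comes first.\<close>

fun mono_mult_rev :: "(bit \<Rightarrow> 'x set) \<Rightarrow> 'x list \<Rightarrow> 'x list \<Rightarrow> ('x list \<Rightarrow>\<^sub>0 'k::field)"
  where
    "mono_mult_rev X u [] = 0"
  | "mono_mult_rev X u [b] = nfmon (u @ [b])"
  | "mono_mult_rev X u (b # c # v) =
      lin_ext (\<lambda>w. nfmon (w @ [b])) (mono_mult_rev X u (c # v)) -
      ksign (parity X (c # v) * letter_parity X b) *p mono_mult_rev X (u @ [b]) (c # v)"

definition lb_mult :: "(bit \<Rightarrow> 'x set) \<Rightarrow> ('x list \<Rightarrow>\<^sub>0 'k::field) \<Rightarrow> ('x list \<Rightarrow>\<^sub>0 'k) \<Rightarrow> ('x list \<Rightarrow>\<^sub>0 'k)"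
  where "lb_mult X f g = lin_ext (\<lambda>u. lin_ext (\<lambda>v. mono_mult_rev X u (rev v)) g) f"

definition Lbs :: "(bit \<Rightarrow> 'x set) \<Rightarrow> ('k::field, 'x list \<Rightarrow>\<^sub>0 'k) superalgebra"
  where "Lbs X =
    \<lparr>carrier = {f. keys f \<subseteq> NF X}, mult = lb_mult X, one = 0, zero = 0, add = (+),
     smult = pscale, part = (\<lambda>i. {f. keys f \<subseteq> {w \<in> NF X. parity X w = i}})\<rparr>"

definition Lbs_rel :: "(bit \<Rightarrow> 'x set) \<Rightarrow> ('x list \<Rightarrow>\<^sub>0 'k) set \<Rightarrow>
    ('k::field, ('x list \<Rightarrow>\<^sub>0 'k) set) superalgebra"
  where "Lbs_rel X S = super_quot (Lbs X) (super_Id (Lbs X) S)"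

definition Lbs_class :: "(bit \<Rightarrow> 'x set) \<Rightarrow> ('x list \<Rightarrow>\<^sub>0 'k) set \<Rightarrow> ('x list \<Rightarrow>\<^sub>0 'k::field) \<Rightarrow>
    ('x list \<Rightarrow>\<^sub>0 'k) set"
  where "Lbs_class X S f = super_Id (Lbs X) S +>\<^bsub>Lbs X\<^esub> f"

subsection \<open>Freeness\<close>

lemma keys_pscale: "keys (c *p f) \<subseteq> keys f"
  by (auto simp: in_keys_iff)

lemma lin_ext_superset:
  assumes "finite W" "keys f \<subseteq> W"
  shows "lin_ext F f = (\<Sum>w\<in>W. lookup f w *p F w)"
  unfolding lin_ext_def using assms by (intro sum.mono_neutral_left) (auto simp: in_keys_iff)

lemma lin_ext_single [simp]: "lin_ext F (Poly_Mapping.single w c) = c *p F w"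
  by (cases "c = 0") (auto simp: lin_ext_def)

lemma lin_ext_zero [simp]: "lin_ext F 0 = 0"
  by (simp add: lin_ext_def)

lemma lin_ext_add: "lin_ext F (f + g) = lin_ext F f + lin_ext F g"
proof -
  let ?W = "keys f \<union> keys g"
  have "lin_ext F (f + g) = (\<Sum>w\<in>?W. lookup (f + g) w *p F w)"
    by (intro lin_ext_superset Poly_Mapping.keys_add) auto
  also have "\<dots> = lin_ext F f + lin_ext F g"
    by (simp add: lookup_add lb.scale_left_distrib sum.distrib lin_ext_superset[of ?W])
  finally show ?thesis .
qed

lemma lin_ext_pscale: "lin_ext F (c *p f) = c *p lin_ext F f"
  by (subst lin_ext_superset[OF _ keys_pscale]) (auto simp: lin_ext_def lb.scale_sum_right)

lemma lin_ext_uminus: "lin_ext F (- f) = - lin_ext F f"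
  using lin_ext_pscale[of F "-1" f] by simp

lemma lin_ext_diff: "lin_ext F (f - g) = lin_ext F f - lin_ext F g"
  using lin_ext_add[of F f "- g"] by (simp add: lin_ext_uminus)

lemma lin_ext_sum: "lin_ext F (\<Sum>i\<in>I. f i) = (\<Sum>i\<in>I. lin_ext F (f i))"
  by (induction I rule: infinite_finite_induct) (auto simp: lin_ext_add)

lemma lin_ext_fun_add: "lin_ext (\<lambda>w. F w + G w) f = lin_ext F f + lin_ext G f"
  by (simp add: lin_ext_def lb.scale_right_distrib sum.distrib)

lemma lin_ext_fun_pscale: "lin_ext (\<lambda>w. c *p F w) f = c *p lin_ext F f"
  by (simp add: lin_ext_def lb.scale_sum_right mult.commute)

lemma sum_nfmon: "(\<Sum>w\<in>keys f. lookup f w *p nfmon w) = f"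
proof (rule poly_mapping_eqI)
  fix v
  show "lookup (\<Sum>w\<in>keys f. lookup f w *p nfmon w) v = lookup f v"
    by (simp add: lookup_sum lookup_single when_def in_keys_iff if_distrib cong: if_cong)
qed

lemma nfmon_induct [consumes 1, case_names zero nfmon add]:
  assumes "keys f \<subseteq> W" "P 0" "\<And>w c. w \<in> W \<Longrightarrow> P (c *p nfmon w)"
    "\<And>f g. P f \<Longrightarrow> P g \<Longrightarrow> keys f \<subseteq> W \<Longrightarrow> keys g \<subseteq> W \<Longrightarrow> P (f + g)"
  shows "P f"
proof -
  have "P (\<Sum>w\<in>V. lookup f w *p nfmon w) \<and> keys (\<Sum>w\<in>V. lookup f w *p nfmon w) \<subseteq> W"
    if "finite V" "V \<subseteq> W" for V
    using that
  proof (induction V rule: finite_induct)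
    case (insert w V)
    have "keys (lookup f w *p nfmon w) \<subseteq> W"
      using insert.prems keys_pscale[of "lookup f w" "nfmon w"] by auto
    moreover have "keys (lookup f w *p nfmon w + (\<Sum>w\<in>V. lookup f w *p nfmon w)) \<subseteq>
        keys (lookup f w *p nfmon w) \<union> keys (\<Sum>w\<in>V. lookup f w *p nfmon w)"
      by (rule Poly_Mapping.keys_add)
    ultimately show ?case
      using insert assms(3)[of w "lookup f w"] assms(4) by auto
  qed (use assms in auto)
  from this[of "keys f"] show ?thesis
    using assms(1) by (simp add: sum_nfmon)
qed

lemma lb_mult_nfmon: "lb_mult X (nfmon u) (nfmon v) = mono_mult_rev X u (rev v)"
  by (simp add: lb_mult_def)

lemma lb_mult_add_left: "lb_mult X (f + f') g = lb_mult X f g + lb_mult X f' g"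
  by (simp add: lb_mult_def lin_ext_add)

lemma lb_mult_add_right: "lb_mult X f (g + g') = lb_mult X f g + lb_mult X f g'"
  by (simp add: lb_mult_def lin_ext_add lin_ext_fun_add)

lemma lb_mult_pscale_left: "lb_mult X (c *p f) g = c *p lb_mult X f g"
  by (simp add: lb_mult_def lin_ext_pscale)

lemma lb_mult_pscale_right: "lb_mult X f (c *p g) = c *p lb_mult X f g"
  by (simp add: lb_mult_def lin_ext_pscale lin_ext_fun_pscale)

lemma lb_mult_zero_left [simp]: "lb_mult X 0 g = 0"
  by (simp add: lb_mult_def)

lemma lb_mult_zero_right [simp]: "lb_mult X f 0 = 0"
  using lb_mult_pscale_right[of X f 0 0] by simp

lemma lb_mult_diff_left: "lb_mult X (f - f') g = lb_mult X f g - lb_mult X f' g"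
  by (metis add_diff_cancel diff_add_cancel lb_mult_add_left)

lemma lb_mult_diff_right: "lb_mult X f (g - g') = lb_mult X f g - lb_mult X f g'"
  by (metis add_diff_cancel diff_add_cancel lb_mult_add_right)

lemmas lb_mult_linear = lb_mult_add_left lb_mult_add_right lb_mult_pscale_left
  lb_mult_pscale_right lb_mult_diff_left lb_mult_diff_right

lemma lb_mult_gen: "lb_mult X f (gen b) = lin_ext (\<lambda>w. nfmon (w @ [b])) f"
  by (simp add: lb_mult_def)

lemma lb_mult_nfmon_gen: "lb_mult X (nfmon u) (gen b) = nfmon (u @ [b])"
  by (simp add: lb_mult_nfmon)

lemma parity_append [simp]: "parity X (u @ v) = parity X u + parity X v"
  by (simp add: parity_def)

lemma parity_single [simp]: "parity X [b] = letter_parity X b"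
  by (simp add: parity_def)

lemma parity_rev [simp]: "parity X (rev v) = parity X v"
  by (simp add: parity_def sum_list_rev flip: rev_map)

lemma lb_mult_nfmon_snoc:
  assumes "v \<noteq> []"
  shows "lb_mult X (nfmon u) (nfmon (v @ [b])) =
    lb_mult X (lb_mult X (nfmon u) (nfmon v)) (gen b) -
    ksign (letter_parity X b * parity X v) *p lb_mult X (lb_mult X (nfmon u) (gen b)) (nfmon v)"
proof -
  obtain c v' where v: "rev v = c # v'"
    using assms by (cases "rev v") auto
  have "parity X (c # v') = parity X v"
    by (simp flip: v)
  then show ?thesis
    by (simp add: lb_mult_nfmon lb_mult_gen v mult.commute)
qed

lemma keys_lin_ext: "keys (lin_ext F f) \<subseteq> (\<Union>w\<in>keys f. keys (F w))"
  unfolding lin_ext_def using keys_sum keys_pscale by fastforce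

lemma keys_minus_subset: "keys (f - g) \<subseteq> keys f \<union> keys g" for f :: "'w \<Rightarrow>\<^sub>0 'k::field"
  by (auto simp: in_keys_iff lookup_minus)

lemma keys_mono_mult_rev:
  "keys (mono_mult_rev X u v :: _ \<Rightarrow>\<^sub>0 'k::field) \<subseteq>
    {w. w \<noteq> [] \<and> set w = set u \<union> set v \<and> parity X w = parity X u + parity X v}"
proof (induction X u v rule: mono_mult_rev.induct)
  case (3 X u b c v)
  let ?p = "mono_mult_rev X u (c # v) :: _ \<Rightarrow>\<^sub>0 'k"
  let ?q = "mono_mult_rev X (u @ [b]) (c # v) :: _ \<Rightarrow>\<^sub>0 'k"
  have par: "parity X (b # c # v) = parity X (c # v) + letter_parity X b"
    by (simp only: parity_def list.map sum_list.Cons add.commute)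
  have "keys (lin_ext (\<lambda>w. nfmon (w @ [b]) :: _ \<Rightarrow>\<^sub>0 'k) ?p) \<subseteq> (\<lambda>w. w @ [b]) ` keys ?p"
    using keys_lin_ext[of "\<lambda>w. nfmon (w @ [b]) :: _ \<Rightarrow>\<^sub>0 'k" ?p] by auto
  also have "\<dots> \<subseteq> {w. w \<noteq> [] \<and> set w = set u \<union> set (b # c # v) \<and>
      parity X w = parity X u + parity X (b # c # v)}"
    using "3.IH"(1) unfolding par by (auto simp: add.assoc)
  finally have 1: "keys (lin_ext (\<lambda>w. nfmon (w @ [b]) :: _ \<Rightarrow>\<^sub>0 'k) ?p) \<subseteq> \<dots>" .
  have "keys (ksign (parity X (c # v) * letter_parity X b) *p ?q) \<subseteq> keys ?q"
    by (rule keys_pscale)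
  also have "\<dots> \<subseteq> {w. w \<noteq> [] \<and> set w = set u \<union> set (b # c # v) \<and>
      parity X w = parity X u + parity X (b # c # v)}"
    using "3.IH"(2) unfolding par by (auto simp: ac_simps)
  finally show ?case
    using 1 unfolding mono_mult_rev.simps by (intro subset_trans[OF keys_minus_subset] Un_least)
qed auto

lemma keys_lb_mult:
  fixes f g :: "'x list \<Rightarrow>\<^sub>0 'k::field"
  assumes "keys f \<subseteq> {w \<in> NF X. parity X w \<in> I}" "keys g \<subseteq> {w \<in> NF X. parity X w \<in> J}"
  shows "keys (lb_mult X f g) \<subseteq> {w \<in> NF X. \<exists>i\<in>I. \<exists>j\<in>J. parity X w = i + j}"
proof
  fix w assume "w \<in> keys (lb_mult X f g)"
  then obtain u where u: "u \<in> keys f" "w \<in> keys (lin_ext (\<lambda>v. mono_mult_rev X u (rev v)) g)"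
    unfolding lb_mult_def using keys_lin_ext by fast
  then obtain v where v: "v \<in> keys g" "w \<in> keys (mono_mult_rev X u (rev v) :: _ \<Rightarrow>\<^sub>0 'k)"
    using keys_lin_ext by fast
  from keys_mono_mult_rev v(2) have "w \<noteq> []" "set w = set u \<union> set v"
    "parity X w = parity X u + parity X v"
    by fastforce+
  then show "w \<in> {w \<in> NF X. \<exists>i\<in>I. \<exists>j\<in>J. parity X w = i + j}"
    using u(1) v(1) assms by (fastforce simp: NF_def)
qed

lemma ksign_add: "ksign (i + j) = (ksign i * ksign j :: 'k::ring_1)"
  by (cases i; cases j) (auto simp: ksign_def)

lemma ksign_mult_self: "ksign i * ksign i = (1 :: 'k::ring_1)"
  by (cases i) (auto simp: ksign_def)

text \<open>The identity for a last letter extends from monomials to elements.\<close>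

lemma lb_leibniz_letter:
  fixes x y :: "'x list \<Rightarrow>\<^sub>0 'k::field"
  assumes "keys y \<subseteq> {w. w \<noteq> [] \<and> parity X w = j}"
  shows "lb_mult X x (lb_mult X y (gen b)) = lb_mult X (lb_mult X x y) (gen b) -
    ksign (letter_parity X b * j) *p lb_mult X (lb_mult X x (gen b)) y"
proof -
  define e :: 'k where "e = ksign (letter_parity X b * j)"
  have "keys x \<subseteq> UNIV" by simp
  then show ?thesis unfolding e_def[symmetric]
  proof (induction x rule: nfmon_induct)
    case (nfmon u c)
    from assms show ?case
    proof (induction y rule: nfmon_induct)
      case (nfmon v d)
      then have v: "v \<noteq> []" "ksign (letter_parity X b * parity X v) = e"
        by (auto simp: e_def)
      show ?case
        unfolding lb_mult_linear lb_mult_nfmon_gen[of X v] lb_mult_nfmon_snoc[OF v(1)] v(2)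
        by (simp add: lb.scale_right_diff_distrib mult_ac)
    next
      case (add f g)
      then show ?case by (simp add: lb_mult_linear lb.scale_right_distrib algebra_simps)
    qed auto
  next
    case (add f g)
    then show ?case by (simp add: lb_mult_linear lb.scale_right_distrib algebra_simps)
  qed auto
qed

lemma lb_leibniz_nfmon:
  fixes x :: "'x list \<Rightarrow>\<^sub>0 'k::field"
  assumes "z \<noteq> []" "y \<noteq> []"
  shows "lb_mult X x (lb_mult X (nfmon y) (nfmon z)) =
    lb_mult X (lb_mult X x (nfmon y)) (nfmon z) -
    ksign (parity X z * parity X y) *p lb_mult X (lb_mult X x (nfmon z)) (nfmon y)"
  using assms
proof (induction z arbitrary: x y rule: rev_nonempty_induct)
  case (single b)
  then show ?case
    using lb_leibniz_letter[of "nfmon y" X "parity X y" x b] by simp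
next
  case (snoc b z)
  define Y Z b' where "Y = (nfmon y :: _ \<Rightarrow>\<^sub>0 'k)" and "Z = (nfmon z :: _ \<Rightarrow>\<^sub>0 'k)"
    and "b' = (gen b :: _ \<Rightarrow>\<^sub>0 'k)"
  define \<epsilon> \<zeta> \<eta> :: 'k where "\<epsilon> = ksign (parity X z * parity X y)"
    and "\<zeta> = ksign (letter_parity X b * parity X y)"
    and "\<eta> = ksign (letter_parity X b * parity X z)"
  have sq: "\<epsilon> * \<epsilon> = 1" "\<zeta> * \<zeta> = 1" "\<eta> * \<eta> = 1"
    "\<epsilon> * (\<epsilon> * t) = t" "\<zeta> * (\<zeta> * t) = t" "\<eta> * (\<eta> * t) = t" for t
    by (simp_all add: \<epsilon>_def \<zeta>_def \<eta>_def ksign_mult_self flip: mult.assoc)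
  let ?m = "lb_mult X"
  have IH: "?m x' (?m Y Z) = ?m (?m x' Y) Z - \<epsilon> *p ?m (?m x' Z) Y" for x'
    using snoc.IH[OF snoc.prems, of x'] unfolding Y_def Z_def \<epsilon>_def .
  have Yb: "?m Y b' = nfmon (y @ [b])"
    by (simp add: Y_def b'_def lb_mult_nfmon_gen)
  have IHb: "?m x (?m (?m Y b') Z) = ?m (?m x (?m Y b')) Z - (\<epsilon> * \<eta>) *p ?m (?m x Z) (?m Y b')"
  proof -
    have "ksign (parity X z * parity X (y @ [b])) = \<epsilon> * \<eta>"
      unfolding \<epsilon>_def \<eta>_def ksign_add[symmetric]
      by (simp only: parity_append parity_single distrib_left mult.commute)
    with snoc.IH[of "y @ [b]" x] show ?thesis
      unfolding Yb Z_def by simp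
  qed
  have letY: "?m x' (?m Y b') = ?m (?m x' Y) b' - \<zeta> *p ?m (?m x' b') Y" for x'
    unfolding b'_def \<zeta>_def by (rule lb_leibniz_letter) (auto simp: Y_def snoc.prems)
  have letZ: "?m x' (?m Z b') = ?m (?m x' Z) b' - \<eta> *p ?m (?m x' b') Z" for x'
    unfolding b'_def \<eta>_def by (rule lb_leibniz_letter) (auto simp: Z_def snoc.hyps)
  have letYZ: "?m x (?m (?m Y Z) b') = ?m (?m x (?m Y Z)) b' - (\<zeta> * \<eta>) *p ?m (?m x b') (?m Y Z)"
  proof -
    have "keys (?m Y Z) \<subseteq> {w. w \<noteq> [] \<and> parity X w = parity X y + parity X z}"
      unfolding Y_def Z_def lb_mult_nfmon using keys_mono_mult_rev[of X y "rev z"] by auto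
    from lb_leibniz_letter[OF this, of x b] show ?thesis
      unfolding b'_def[symmetric] \<zeta>_def \<eta>_def ksign_add[symmetric] distrib_left[symmetric] .
  qed
  have zb: "nfmon (z @ [b]) = ?m Z b'"
    by (simp add: Z_def b'_def lb_mult_nfmon_gen)
  have e: "ksign (parity X (z @ [b]) * parity X y) = \<epsilon> * \<zeta>"
    unfolding \<epsilon>_def \<zeta>_def ksign_add[symmetric]
    by (simp only: parity_append parity_single distrib_right)
  show ?case
    unfolding zb e Y_def[symmetric]
    unfolding letZ[of Y] letZ[of "?m x Y"] letZ[of x] lb_mult_diff_right lb_mult_pscale_right
      letYZ IHb IH letY
    by (simp add: lb_mult_linear lb.scale_right_diff_distrib sq mult_ac)
qed

lemma lb_leibniz:
  fixes x y z :: "'x list \<Rightarrow>\<^sub>0 'k::field"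
  assumes "keys y \<subseteq> {w. w \<noteq> [] \<and> parity X w = j}" "keys z \<subseteq> {w. w \<noteq> [] \<and> parity X w = l}"
  shows "lb_mult X x (lb_mult X y z) =
    lb_mult X (lb_mult X x y) z - ksign (l * j) *p lb_mult X (lb_mult X x z) y"
proof -
  define e :: 'k where "e = ksign (l * j)"
  show ?thesis
    using assms(1) unfolding e_def[symmetric]
  proof (induction y rule: nfmon_induct)
    case (nfmon v d)
    from assms(2) show ?case
    proof (induction z rule: nfmon_induct)
      case (nfmon w c)
      with \<open>v \<in> _\<close> have vw: "v \<noteq> []" "w \<noteq> []" "ksign (parity X w * parity X v) = e"
        by (auto simp: e_def)
      show ?case
        unfolding lb_mult_linear lb_leibniz_nfmon[OF vw(2,1)] vw(3)
        by (simp add: lb.scale_right_diff_distrib mult_ac)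
    next
      case (add f g)
      then show ?case by (simp add: lb_mult_linear lb.scale_right_distrib algebra_simps)
    qed auto
  next
    case (add f g)
    then show ?case by (simp add: lb_mult_linear lb.scale_right_distrib algebra_simps)
  qed auto
qed

lemma Lbs_simps [simp]:
  "carrier (Lbs X) = {f. keys f \<subseteq> NF X}" "mult (Lbs X) = lb_mult X" "zero (Lbs X) = 0"
  "add (Lbs X) = (+)" "smult (Lbs X) = pscale"
  "part (Lbs X) i = {f. keys f \<subseteq> {w \<in> NF X. parity X w = i}}"
  by (simp_all add: Lbs_def)

lemma keys_add_subset: "keys f \<subseteq> W \<Longrightarrow> keys g \<subseteq> W \<Longrightarrow> keys (f + g) \<subseteq> W"
  using Poly_Mapping.keys_add[of f g] by blast

lemma keys_pscale_subset: "keys f \<subseteq> W \<Longrightarrow> keys (c *p f) \<subseteq> W"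
  using keys_pscale[of c f] by blast

lemma abelian_group_Lbs: "abelian_group (Lbs X)"
proof (rule abelian_groupI)
  fix x :: "_ \<Rightarrow>\<^sub>0 'b" assume "x \<in> carrier (Lbs X)"
  then show "\<exists>y\<in>carrier (Lbs X). y \<oplus>\<^bsub>Lbs X\<^esub> x = \<zero>\<^bsub>Lbs X\<^esub>"
    by (intro bexI[of _ "- x"]) auto
qed (auto simp: add.assoc add.commute keys_add_subset)

lemma a_minus_Lbs:
  assumes "f \<in> carrier (Lbs X)" "g \<in> carrier (Lbs X)"
  shows "f \<ominus>\<^bsub>Lbs X\<^esub> g = f - g"
proof -
  interpret abelian_group "Lbs X" by (rule abelian_group_Lbs)
  have "\<ominus>\<^bsub>Lbs X\<^esub> g = - g"
    by (rule minus_equality) (use assms in auto)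
  then show ?thesis by (simp add: a_minus_def)
qed

lemma Lbs_direct_sum:
  assumes "keys f \<subseteq> NF X"
  shows "\<exists>!p. p \<in> part (Lbs X) 0 \<times> part (Lbs X) 1 \<and> f = fst p + snd p"
proof -
  define c where "c i = (\<Sum>w | w \<in> keys f \<and> parity X w = i. lookup f w *p nfmon w)" for i
  have c: "keys (c i) \<subseteq> {w \<in> NF X. parity X w = i}" for i
  proof -
    have "keys (c i) \<subseteq> (\<Union>w\<in>{w \<in> keys f. parity X w = i}. keys (lookup f w *p nfmon w))"
      unfolding c_def by (rule keys_sum)
    also have "\<dots> \<subseteq> {w \<in> keys f. parity X w = i}"
      using keys_pscale by fastforce
    finally show ?thesis using assms by auto
  qed
  have "c 0 + c 1 = (\<Sum>w\<in>keys f. lookup f w *p nfmon w)"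
    unfolding c_def by (subst sum.union_disjoint[symmetric]) (auto intro!: sum.cong)
  then have "f = c 0 + c 1" by (simp add: sum_nfmon)
  moreover have "p = (c 0, c 1)"
    if "p \<in> part (Lbs X) 0 \<times> part (Lbs X) 1" "f = fst p + snd p" for p
  proof -
    have eq: "lookup (fst p) w + lookup (snd p) w = lookup (c 0) w + lookup (c 1) w" for w
      using that(2) \<open>f = c 0 + c 1\<close> by (metis lookup_add)
    have z: "lookup g w = 0" if "keys g \<subseteq> {w \<in> NF X. parity X w = i}" "parity X w \<noteq> i" for g w i
      using that by (auto simp: in_keys_iff subset_iff)
    have "lookup (fst p) w = lookup (c 0) w" "lookup (snd p) w = lookup (c 1) w" for w
      using eq[of w] z[OF c, of w 0] z[OF c, of w 1] z[of "fst p" 0 w] z[of "snd p" 1 w] that(1)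
      by (cases "parity X w"; force)+
    then show ?thesis
      by (metis poly_mapping_eqI prod.collapse)
  qed
  ultimately show ?thesis
    using c by (intro ex1I[of _ "(c 0, c 1)"]) auto
qed

theorem leibniz_superalgebra_Lbs: "leibniz_superalgebra (Lbs X)"
proof -
  interpret abelian_group "Lbs X" by (rule abelian_group_Lbs)
  have mult_part: "lb_mult X f g \<in> part (Lbs X) (i + j)"
    if "f \<in> part (Lbs X) i" "g \<in> part (Lbs X) j" for f g :: "_ \<Rightarrow>\<^sub>0 'b" and i j
    using keys_lb_mult[of f X "{i}" g "{j}"] that by auto
  have mult_carrier: "lb_mult X f g \<in> carrier (Lbs X)"
    if "f \<in> carrier (Lbs X)" "g \<in> carrier (Lbs X)" for f g :: "_ \<Rightarrow>\<^sub>0 'b"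
    using keys_lb_mult[of f X UNIV g UNIV] that by auto
  show ?thesis
  proof
    fix x y z :: "_ \<Rightarrow>\<^sub>0 'b" and i j l
    assume xyz: "x \<in> part (Lbs X) i" "y \<in> part (Lbs X) j" "z \<in> part (Lbs X) l"
    have carr: "f \<in> carrier (Lbs X)" if "f \<in> part (Lbs X) i" for f :: "_ \<Rightarrow>\<^sub>0 'b" and i
      using that by auto
    have "lb_mult X x (lb_mult X y z) =
      lb_mult X (lb_mult X x y) z - ksign (l * j) *p lb_mult X (lb_mult X x z) y"
      by (rule lb_leibniz) (use xyz in \<open>auto simp: NF_def\<close>)
    also have "\<dots> = lb_mult X (lb_mult X x y) z \<ominus>\<^bsub>Lbs X\<^esub>
        ksign (l * j) *p lb_mult X (lb_mult X x z) y"
    proof (rule a_minus_Lbs[symmetric])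
      show "lb_mult X (lb_mult X x y) z \<in> carrier (Lbs X)"
        by (rule mult_carrier[OF mult_carrier[OF carr[OF xyz(1)] carr[OF xyz(2)]] carr[OF xyz(3)]])
      have "lb_mult X (lb_mult X x z) y \<in> carrier (Lbs X)"
        by (rule mult_carrier[OF mult_carrier[OF carr[OF xyz(1)] carr[OF xyz(3)]] carr[OF xyz(2)]])
      then show "ksign (l * j) *p lb_mult X (lb_mult X x z) y \<in> carrier (Lbs X)"
        by (simp add: keys_pscale_subset)
    qed
    finally show "x \<otimes>\<^bsub>Lbs X\<^esub> (y \<otimes>\<^bsub>Lbs X\<^esub> z) = x \<otimes>\<^bsub>Lbs X\<^esub> y \<otimes>\<^bsub>Lbs X\<^esub> z \<ominus>\<^bsub>Lbs X\<^esub>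
        ksign (l * j) \<odot>\<^bsub>Lbs X\<^esub> (x \<otimes>\<^bsub>Lbs X\<^esub> z \<otimes>\<^bsub>Lbs X\<^esub> y)"
      by simp
  next
    fix x y :: "_ \<Rightarrow>\<^sub>0 'b" assume "x \<in> carrier (Lbs X)" "y \<in> carrier (Lbs X)"
    then show "x \<otimes>\<^bsub>Lbs X\<^esub> y \<in> carrier (Lbs X)"
      using mult_carrier by simp
  next
    fix x y :: "_ \<Rightarrow>\<^sub>0 'b" and i j assume "x \<in> part (Lbs X) i" "y \<in> part (Lbs X) j"
    then show "x \<otimes>\<^bsub>Lbs X\<^esub> y \<in> part (Lbs X) (i + j)"
      using mult_part by simp
  next
    fix x :: "_ \<Rightarrow>\<^sub>0 'b" assume "x \<in> carrier (Lbs X)"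
    then show "\<exists>!p. p \<in> part (Lbs X) 0 \<times> part (Lbs X) 1 \<and> x = fst p \<oplus>\<^bsub>Lbs X\<^esub> snd p"
      using Lbs_direct_sum[of x X] by simp
  qed (auto simp: lb_mult_linear lb.scale_left_distrib lb.scale_right_distrib
        keys_add_subset keys_pscale_subset)
qed

context leibniz_superalgebra
begin

lemma zero_smult: "x \<in> carrier A \<Longrightarrow> 0 \<odot> x = \<zero>"
  using smult_l_distr[of x 0 0] smult_closed[of x 0] by (simp add: add.l_cancel_one')

lemma smult_zero: "c \<odot> \<zero> = \<zero>"
  using smult_r_distr[of \<zero> \<zero> c] smult_closed[of \<zero> c] by (simp add: add.l_cancel_one')

lemma mult_zero_left: "x \<in> carrier A \<Longrightarrow> \<zero> \<otimes> x = \<zero>"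
  using mult_smult_left[of \<zero> x 0] mult_closed[of \<zero> x] by (simp add: zero_smult smult_zero)

lemma mult_zero_right: "x \<in> carrier A \<Longrightarrow> x \<otimes> \<zero> = \<zero>"
  using mult_smult_right[of x \<zero> 0] mult_closed[of x \<zero>] by (simp add: zero_smult smult_zero)

lemma smult_minus_one: "x \<in> carrier A \<Longrightarrow> (- 1) \<odot> x = \<ominus> x"
  using smult_l_distr[of x "-1" 1] zero_smult[of x] smult_one[of x] smult_closed[of x "-1"]
  by (metis add.left_inverse minus_equality)

lemma minus_eq_smult: "x \<in> carrier A \<Longrightarrow> y \<in> carrier A \<Longrightarrow> x \<ominus> y = x \<oplus> (- 1) \<odot> y"
  by (simp add: a_minus_def smult_minus_one)

definition word_val :: "('x \<Rightarrow> 'a) \<Rightarrow> 'x list \<Rightarrow> 'a"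
  where "word_val \<phi> w = foldl (\<otimes>) (\<phi> (hd w)) (map \<phi> (tl w))"

definition free_ext :: "('x \<Rightarrow> 'a) \<Rightarrow> ('x list \<Rightarrow>\<^sub>0 'k) \<Rightarrow> 'a"
  where "free_ext \<phi> f = (\<Oplus>w\<in>keys f. lookup f w \<odot> word_val \<phi> w)"

context
  fixes X :: "bit \<Rightarrow> 'x set" and \<phi> :: "'x \<Rightarrow> 'a"
  assumes disj: "X 0 \<inter> X 1 = {}" and \<phi>: "\<And>i x. x \<in> X i \<Longrightarrow> \<phi> x \<in> part A i"
begin

lemma letter_part: "x \<in> gset X \<Longrightarrow> \<phi> x \<in> part A (letter_parity X x)"
  using \<phi> disj by (auto simp: gset_def letter_parity_def)

lemma word_val_snoc: "w \<noteq> [] \<Longrightarrow> word_val \<phi> (w @ [b]) = word_val \<phi> w \<otimes> \<phi> b"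
  by (cases w) (auto simp: word_val_def)

lemma word_val_part: "w \<in> NF X \<Longrightarrow> word_val \<phi> w \<in> part A (parity X w)"
proof (induction w rule: rev_induct)
  case (snoc b w)
  then show ?case
  proof (cases "w = []")
    case True
    then show ?thesis using snoc letter_part by (auto simp: NF_def word_val_def)
  next
    case False
    then have "w \<in> NF X" "b \<in> gset X" using snoc by (auto simp: NF_def)
    then show ?thesis
      using False snoc.IH part_mult letter_part by (metis parity_append parity_single word_val_snoc)
  qed
qed (auto simp: NF_def)

lemma word_val_carrier: "w \<in> NF X \<Longrightarrow> word_val \<phi> w \<in> carrier A"
  using word_val_part part_carrier by blast

lemma free_ext_superset:
  assumes "finite W" "keys f \<subseteq> W" "W \<subseteq> NF X"
  shows "free_ext \<phi> f = (\<Oplus>w\<in>W. lookup f w \<odot> word_val \<phi> w)"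
  unfolding free_ext_def using assms
  by (intro add.finprod_mono_neutral_cong_left)
    (auto simp: in_keys_iff subset_iff zero_smult word_val_carrier smult_closed)

lemma free_ext_closed: "keys f \<subseteq> NF X \<Longrightarrow> free_ext \<phi> f \<in> carrier A"
  unfolding free_ext_def by (intro finsum_closed) (auto intro!: smult_closed word_val_carrier)

lemma free_ext_add:
  assumes "keys f \<subseteq> NF X" "keys g \<subseteq> NF X"
  shows "free_ext \<phi> (f + g) = free_ext \<phi> f \<oplus> free_ext \<phi> g"
proof -
  let ?W = "keys f \<union> keys g"
  have W: "finite ?W" "keys (f + g) \<subseteq> ?W" "keys f \<subseteq> ?W" "keys g \<subseteq> ?W" "?W \<subseteq> NF X"
    using assms Poly_Mapping.keys_add[of f g] by auto
  have cl: "(\<lambda>w. lookup h w \<odot> word_val \<phi> w) \<in> ?W \<rightarrow> carrier A" for h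
    using W(5) by (auto intro!: smult_closed word_val_carrier)
  have "(\<Oplus>w\<in>?W. lookup (f + g) w \<odot> word_val \<phi> w) =
      (\<Oplus>w\<in>?W. lookup f w \<odot> word_val \<phi> w \<oplus> lookup g w \<odot> word_val \<phi> w)"
    using W(5) by (intro finsum_cong')
      (auto simp: lookup_add subset_iff intro!: smult_l_distr smult_closed word_val_carrier)
  also have "\<dots> = (\<Oplus>w\<in>?W. lookup f w \<odot> word_val \<phi> w) \<oplus> (\<Oplus>w\<in>?W. lookup g w \<odot> word_val \<phi> w)"
    by (intro finsum_addf cl)
  finally show ?thesis
    using W by (simp add: free_ext_superset[of ?W])
qed

lemma free_ext_zero: "free_ext \<phi> 0 = \<zero>"
  by (simp add: free_ext_def)

lemma free_ext_pscale_nfmon: "w \<in> NF X \<Longrightarrow> free_ext \<phi> (c *p nfmon w) = c \<odot> word_val \<phi> w"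
proof -
  assume w: "w \<in> NF X"
  have "keys (c *p nfmon w) \<subseteq> {w}"
    using keys_pscale[of c "nfmon w"] by simp
  from free_ext_superset[OF _ this] w show ?thesis
    by (simp add: smult_closed word_val_carrier finsum_insert finsum_empty)
qed

lemma free_ext_nfmon: "w \<in> NF X \<Longrightarrow> free_ext \<phi> (nfmon w) = word_val \<phi> w"
  using free_ext_pscale_nfmon[of w 1] by (simp add: smult_one word_val_carrier)

lemma free_ext_pscale:
  assumes "keys f \<subseteq> NF X"
  shows "free_ext \<phi> (c *p f) = c \<odot> free_ext \<phi> f"
  using assms
proof (induction f rule: nfmon_induct)
  case (nfmon w d)
  then show ?case
    by (simp add: free_ext_pscale_nfmon smult_assoc word_val_carrier)
next
  case (add f g)
  then show ?case
    by (simp add: lb.scale_right_distrib free_ext_add keys_pscale_subset smult_r_distr free_ext_closed)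
qed (simp add: free_ext_zero smult_zero)

lemma free_ext_diff:
  assumes "keys f \<subseteq> NF X" "keys g \<subseteq> NF X"
  shows "free_ext \<phi> (f - g) = free_ext \<phi> f \<ominus> free_ext \<phi> g"
  using free_ext_add[of f "(-1) *p g"] free_ext_pscale[of g "-1"] assms
  by (simp add: keys_pscale_subset minus_eq_smult free_ext_closed)

lemma keys_lb_mult_NF: "keys f \<subseteq> NF X \<Longrightarrow> keys g \<subseteq> NF X \<Longrightarrow> keys (lb_mult X f g) \<subseteq> NF X"
  using keys_lb_mult[of f X UNIV g UNIV] by auto

lemma free_ext_mult_gen:
  assumes "keys f \<subseteq> NF X" "b \<in> gset X"
  shows "free_ext \<phi> (lb_mult X f (gen b)) = free_ext \<phi> f \<otimes> \<phi> b"
proof -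
  have b: "\<phi> b \<in> carrier A" "[b] \<in> NF X"
    using assms(2) letter_part part_carrier by (blast, simp add: NF_def)
  show ?thesis
    using assms(1)
  proof (induction f rule: nfmon_induct)
    case (nfmon w d)
    moreover have "w @ [b] \<in> NF X" "w \<noteq> []"
      using nfmon assms(2) by (auto simp: NF_def)
    ultimately show ?case
      by (simp add: lb_mult_linear lb_mult_nfmon_gen free_ext_pscale_nfmon word_val_snoc
          mult_smult_left word_val_carrier b)
  next
    case (add f g)
    moreover have "keys (gen b :: _ \<Rightarrow>\<^sub>0 'k) \<subseteq> NF X" using b by simp
    ultimately show ?case
      by (simp add: lb_mult_linear free_ext_add mult_add_left free_ext_closed b
          keys_lb_mult_NF del: keys_single)
  qed (simp add: free_ext_zero mult_zero_left b)
qed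

lemma free_ext_mult_nfmon:
  assumes "v \<noteq> []" "v \<in> NF X" "keys f \<subseteq> NF X"
  shows "free_ext \<phi> (lb_mult X f (nfmon v)) = free_ext \<phi> f \<otimes> word_val \<phi> v"
  using assms
proof (induction v arbitrary: f rule: rev_nonempty_induct)
  case (single b)
  then show ?case by (simp add: free_ext_mult_gen NF_def word_val_def)
next
  case (snoc b v)
  have v: "v \<in> NF X" "b \<in> gset X" "[b] \<in> NF X"
    using snoc by (auto simp: NF_def)
  have bc: "\<phi> b \<in> carrier A" using v(2) letter_part part_carrier by blast
  have k: "keys (nfmon v :: _ \<Rightarrow>\<^sub>0 'k) \<subseteq> NF X" "keys (gen b :: _ \<Rightarrow>\<^sub>0 'k) \<subseteq> NF X" using v by simp_all
  have wb: "word_val \<phi> (v @ [b]) = word_val \<phi> v \<otimes> \<phi> b"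
    using snoc.hyps by (rule word_val_snoc)
  have vb: "(nfmon (v @ [b]) :: _ \<Rightarrow>\<^sub>0 'k) = lb_mult X (nfmon v) (gen b)"
    by (simp add: lb_mult_nfmon_gen)
  show ?case
    using snoc.prems(2)
  proof (induction f rule: nfmon_induct)
    case (nfmon u c)
    let ?e = "ksign (letter_parity X b * parity X v) :: 'k"
    have u: "u \<in> NF X" "u @ [b] \<in> NF X" "u \<noteq> []" using nfmon v(2) by (auto simp: NF_def)
    have ku: "keys (nfmon u :: _ \<Rightarrow>\<^sub>0 'k) \<subseteq> NF X" using u by simp
    have "free_ext \<phi> (lb_mult X (nfmon u) (nfmon (v @ [b]))) =
      free_ext \<phi> (lb_mult X (lb_mult X (nfmon u) (nfmon v)) (gen b)) \<ominus>
      ?e \<odot> free_ext \<phi> (lb_mult X (lb_mult X (nfmon u) (gen b)) (nfmon v))"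
      unfolding lb_mult_nfmon_snoc[OF snoc.hyps]
      using ku k by (simp only: free_ext_diff free_ext_pscale keys_lb_mult_NF keys_pscale_subset)
    also have "\<dots> = (word_val \<phi> u \<otimes> word_val \<phi> v) \<otimes> \<phi> b \<ominus> ?e \<odot> ((word_val \<phi> u \<otimes> \<phi> b) \<otimes> word_val \<phi> v)"
      using u v ku k snoc.IH
      by (simp add: free_ext_mult_gen free_ext_nfmon keys_lb_mult_NF del: keys_single)
    also have "\<dots> = word_val \<phi> u \<otimes> (word_val \<phi> v \<otimes> \<phi> b)"
      by (rule leibniz[symmetric]) (use u v letter_part word_val_part in auto)
    finally have "free_ext \<phi> (lb_mult X (nfmon u) (nfmon (v @ [b]))) =
      word_val \<phi> u \<otimes> word_val \<phi> (v @ [b])"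
      by (simp only: wb)
    moreover have "keys (lb_mult X (nfmon u) (nfmon (v @ [b]) :: _ \<Rightarrow>\<^sub>0 'k)) \<subseteq> NF X"
      unfolding vb by (intro keys_lb_mult_NF ku k)
    ultimately show ?case
      using u snoc.prems by (simp add: lb_mult_linear free_ext_pscale free_ext_nfmon
          mult_smult_left word_val_carrier)
  next
    case (add f g)
    moreover have "keys (nfmon (v @ [b]) :: _ \<Rightarrow>\<^sub>0 'k) \<subseteq> NF X" using snoc.prems by simp
    ultimately show ?case
      using snoc.prems
      by (simp add: lb_mult_linear free_ext_add mult_add_left free_ext_closed word_val_carrier
          keys_lb_mult_NF del: keys_single)
  qed (use snoc.prems in \<open>simp add: free_ext_zero mult_zero_left word_val_carrier\<close>)
qed

lemma free_ext_mult:
  assumes f: "keys f \<subseteq> NF X" and g: "keys g \<subseteq> NF X"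
  shows "free_ext \<phi> (lb_mult X f g) = free_ext \<phi> f \<otimes> free_ext \<phi> g"
  using g
proof (induction g rule: nfmon_induct)
  case zero
  show ?case
    by (simp only: lb_mult_zero_right free_ext_zero mult_zero_right[OF free_ext_closed[OF f]])
next
  case (nfmon v c)
  then have v: "v \<noteq> []" "keys (nfmon v :: _ \<Rightarrow>\<^sub>0 'k) \<subseteq> NF X" by (auto simp: NF_def)
  show ?case
    unfolding lb_mult_pscale_right free_ext_pscale[OF keys_lb_mult_NF[OF f v(2)]]
      free_ext_mult_nfmon[OF v(1) nfmon f] free_ext_pscale_nfmon[OF nfmon]
    by (rule mult_smult_right[symmetric, OF free_ext_closed[OF f] word_val_carrier[OF nfmon]])
next
  case (add g h)
  note gh = add.IH add.hyps
  show ?case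
    unfolding lb_mult_add_right free_ext_add[OF keys_lb_mult_NF[OF f gh(3)] keys_lb_mult_NF[OF f gh(4)]]
      free_ext_add[OF gh(3,4)] gh(1,2)
    by (rule mult_add_right[symmetric, OF free_ext_closed[OF gh(3)]
          free_ext_closed[OF gh(4)] free_ext_closed[OF f]])
qed

lemma free_ext_part:
  assumes "keys f \<subseteq> {w \<in> NF X. parity X w = i}"
  shows "free_ext \<phi> f \<in> part A i"
  using assms
proof (induction f rule: nfmon_induct)
  case (nfmon w c)
  then show ?case using part_smult word_val_part by (auto simp: free_ext_pscale_nfmon)
next
  case (add f g)
  moreover from add have "keys f \<subseteq> NF X" "keys g \<subseteq> NF X" by auto
  ultimately show ?case by (simp add: free_ext_add part_add)
qed (simp add: free_ext_zero part_zero)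

lemma free_ext_hom: "superalgebra_hom (Lbs X) A (free_ext \<phi>)"
  unfolding superalgebra_hom_def linear_map_def
  using free_ext_closed free_ext_add free_ext_pscale free_ext_mult free_ext_part by auto

lemma free_ext_gen: "x \<in> gset X \<Longrightarrow> free_ext \<phi> (gen x) = \<phi> x"
  by (subst free_ext_nfmon) (auto simp: NF_def word_val_def)

lemma free_ext_unique:
  assumes h: "superalgebra_hom (Lbs X) A h" and gen: "\<forall>x\<in>gset X. h (gen x) = \<phi> x"
    and f: "keys f \<subseteq> NF X"
  shows "h f = free_ext \<phi> f"
proof -
  have hadd: "h (f + g) = h f \<oplus> h g" and hmult: "h (lb_mult X f g) = h f \<otimes> h g"
    if "keys f \<subseteq> NF X" "keys g \<subseteq> NF X" for f g
    using h that by (auto simp: superalgebra_hom_def linear_map_def)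
  have hscale: "h (c *p f) = c \<odot> h f" and hcl: "h f \<in> carrier A" if "keys f \<subseteq> NF X" for f c
    using h that by (auto simp: superalgebra_hom_def linear_map_def)
  have hw: "h (nfmon w) = word_val \<phi> w" if "w \<noteq> []" "w \<in> NF X" for w
    using that
  proof (induction w rule: rev_nonempty_induct)
    case (single b)
    then show ?case using gen by (auto simp: NF_def word_val_def)
  next
    case (snoc b w)
    then have w: "w \<in> NF X" "b \<in> gset X" "[b] \<in> NF X" by (auto simp: NF_def)
    then show ?case
      using hmult[of "nfmon w" "gen b"] gen snoc by (simp add: lb_mult_nfmon_gen word_val_snoc)
  qed
  show ?thesis
    using f
  proof (induction f rule: nfmon_induct)
    case zero
    show ?case using hscale[of 0 0] hcl[of 0] by (simp add: free_ext_zero zero_smult)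
  next
    case (nfmon w c)
    then have "w \<noteq> []" by (simp add: NF_def)
    with nfmon show ?case using hscale[of "nfmon w" c] by (simp add: hw free_ext_pscale_nfmon)
  next
    case (add f g)
    then show ?case by (simp add: hadd free_ext_add)
  qed
qed

end

end

theorem Lbs_universal:
  fixes L :: "('k::field, 'l, 'm) superalgebra_scheme" and X :: "bit \<Rightarrow> 'x set"
  assumes "leibniz_superalgebra L" "X 0 \<inter> X 1 = {}" "\<And>i x. x \<in> X i \<Longrightarrow> \<phi> x \<in> part L i"
  shows "\<exists>h. superalgebra_hom (Lbs X) L h \<and> (\<forall>x\<in>gset X. h (gen x) = \<phi> x) \<and>
    (\<forall>h'. superalgebra_hom (Lbs X) L h' \<and> (\<forall>x\<in>gset X. h' (gen x) = \<phi> x) \<longrightarrow>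
      (\<forall>f\<in>carrier (Lbs X). h' f = h f))"
proof -
  interpret leibniz_superalgebra L by fact
  show ?thesis
  proof (intro exI[of _ "free_ext \<phi>"] conjI allI impI ballI)
    show "superalgebra_hom (Lbs X) L (free_ext \<phi>)"
      using assms(2,3) by (rule free_ext_hom)
    show "free_ext \<phi> (gen x) = \<phi> x" if "x \<in> gset X" for x
      using assms(2,3) that by (rule free_ext_gen)
    show "h f = free_ext \<phi> f"
      if "superalgebra_hom (Lbs X) L h \<and> (\<forall>x\<in>gset X. h (gen x) = \<phi> x)" "f \<in> carrier (Lbs X)" for h f
      by (rule free_ext_unique[of X \<phi> h f, OF assms(2,3) conjunct1[OF that(1)] conjunct2[OF that(1)]])
        (use that(2) in simp_all)
  qed
qed

text \<open>The basis element encoded by a list is the left-normed product of its letters.\<close>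

lemma foldl_gen: "foldl (lb_mult X) (gen a) (map gen w) = nfmon (a # w)"
  by (induction w rule: rev_induct) (simp_all add: lb_mult_nfmon_gen)

section \<open>Groebner--Shirshov bases\<close>

text \<open>
  The well-order of \<open>X\<close> is a reflexive relation \<open>r\<close>, as in \<^const>\<open>well_order_on\<close>. Since every
  letter has degree \<open>1\<close>, degree and length coincide and the order on \<open>NF X\<close> compares
  first lengths and then letters from the left.
\<close>

definition mono_less :: "'x rel \<Rightarrow> 'x list rel"
  where "mono_less r = lenlex (r - Id)"

definition lead :: "'x rel \<Rightarrow> ('x list \<Rightarrow>\<^sub>0 'k::field) \<Rightarrow> 'x list"
  where "lead r f = (THE u. u \<in> keys f \<and> (\<forall>v\<in>keys f. v \<noteq> u \<longrightarrow> (v, u) \<in> mono_less r))"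

definition monic :: "'x rel \<Rightarrow> ('x list \<Rightarrow>\<^sub>0 'k::field) \<Rightarrow> bool"
  where "monic r f \<longleftrightarrow> f \<noteq> 0 \<and> lookup f (lead r f) = 1"

definition left_normed :: "(bit \<Rightarrow> 'x set) \<Rightarrow> ('x list \<Rightarrow>\<^sub>0 'k::field) \<Rightarrow> ('x list \<Rightarrow>\<^sub>0 'k) list \<Rightarrow>
    ('x list \<Rightarrow>\<^sub>0 'k)"
  where "left_normed X f fs = foldl (lb_mult X) f fs"

definition normal_polys :: "(bit \<Rightarrow> 'x set) \<Rightarrow> 'x rel \<Rightarrow> ('x list \<Rightarrow>\<^sub>0 'k::field) \<Rightarrow> ('x list \<Rightarrow>\<^sub>0 'k) set"
  where "normal_polys X r s =
    {left_normed X s (map gen as) |as. as \<in> lists (gset X)} \<union>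
    {left_normed X (gen a) (map gen as @ s # map gen bs) |a as bs.
       length (lead r s) = 1 \<and> a \<in> gset X \<and> as \<in> lists (gset X) \<and> bs \<in> lists (gset X)}"

definition Irr :: "(bit \<Rightarrow> 'x set) \<Rightarrow> 'x rel \<Rightarrow> ('x list \<Rightarrow>\<^sub>0 'k::field) set \<Rightarrow> 'x list set"
  where "Irr X r S = {\<mu> \<in> NF X. \<forall>s\<in>S. \<forall>h\<in>normal_polys X r s. \<mu> \<noteq> lead r h}"

definition trivial_below ::
  "(bit \<Rightarrow> 'x set) \<Rightarrow> 'x rel \<Rightarrow> ('x list \<Rightarrow>\<^sub>0 'k::field) set \<Rightarrow> 'x list \<Rightarrow> ('x list \<Rightarrow>\<^sub>0 'k) \<Rightarrow> bool"
  where "trivial_below X r S \<mu> f \<longleftrightarrow>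
    f \<in> lb.span {h. \<exists>s\<in>S. h \<in> normal_polys X r s \<and> (lead r h, \<mu>) \<in> mono_less r}"

definition trivial_deg ::
  "(bit \<Rightarrow> 'x set) \<Rightarrow> 'x rel \<Rightarrow> ('x list \<Rightarrow>\<^sub>0 'k::field) set \<Rightarrow> nat \<Rightarrow> ('x list \<Rightarrow>\<^sub>0 'k) \<Rightarrow> bool"
  where "trivial_deg X r S n f \<longleftrightarrow>
    f \<in> lb.span {h. \<exists>s\<in>S. h \<in> normal_polys X r s \<and> length (lead r h) \<le> n}"

definition GS_basis :: "(bit \<Rightarrow> 'x set) \<Rightarrow> 'x rel \<Rightarrow> ('x list \<Rightarrow>\<^sub>0 'k::field) set \<Rightarrow> bool"
  where "GS_basis X r S \<longleftrightarrow>
    (\<forall>s\<in>S. monic r s \<and> (\<exists>i. s \<in> part (Lbs X) i)) \<and>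
    (\<forall>f\<in>S. \<forall>g\<in>S. \<forall>h\<in>normal_polys X r g.
       f \<noteq> g \<and> lead r f = lead r h \<longrightarrow> trivial_below X r S (lead r f) (f - h)) \<and>
    (\<forall>f\<in>S. \<forall>\<mu>\<in>NF X. length (lead r f) > 1 \<and> lb_mult X (nfmon \<mu>) f \<noteq> 0 \<longrightarrow>
       trivial_deg X r S (length \<mu> + length (lead r f)) (lb_mult X (nfmon \<mu>) f))"

definition reduced_GS_basis :: "(bit \<Rightarrow> 'x set) \<Rightarrow> 'x rel \<Rightarrow> ('x list \<Rightarrow>\<^sub>0 'k::field) set \<Rightarrow> bool"
  where "reduced_GS_basis X r S \<longleftrightarrow>
    GS_basis X r S \<and> (\<forall>s\<in>S. keys s \<subseteq> Irr X r (S - {s}))"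

text \<open>
  An expression $\sum_i \alpha_i [s_i c_{i,1} \cdots c_{i,n_i}]_L$ is encoded by the list of the triples
  $(\alpha_i, s_i, [c_{i,1}, \dots, c_{i,n_i}])$.
\<close>

definition is_normal_expr ::
  "(bit \<Rightarrow> 'x set) \<Rightarrow> 'x rel \<Rightarrow> ('x list \<Rightarrow>\<^sub>0 'k::field) set \<Rightarrow> ('x list \<Rightarrow>\<^sub>0 'k) \<Rightarrow>
   ('k \<times> ('x list \<Rightarrow>\<^sub>0 'k) \<times> 'x list) list \<Rightarrow> bool"
  where "is_normal_expr X r S h ts \<longleftrightarrow>
    (\<forall>(\<alpha>, s, c) \<in> set ts. \<alpha> \<noteq> 0 \<and> s \<in> S \<and> c \<in> lists (gset X)) \<and>
    h = (\<Sum>(\<alpha>, s, c)\<leftarrow>ts. \<alpha> *p left_normed X s (map gen c)) \<and>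
    sorted_wrt (\<lambda>u v. (v, u) \<in> mono_less r)
      (map (\<lambda>(\<alpha>, s, c). lead r (left_normed X s (map gen c))) ts) \<and>
    (if h = 0 then ts = []
     else \<exists>\<alpha> s c us. ts = (\<alpha>, s, c) # us \<and> lead r (left_normed X s (map gen c)) = lead r h)"

definition normal_expr ::
  "(bit \<Rightarrow> 'x set) \<Rightarrow> 'x rel \<Rightarrow> ('x list \<Rightarrow>\<^sub>0 'k::field) set \<Rightarrow> ('x list \<Rightarrow>\<^sub>0 'k) \<Rightarrow>
   ('k \<times> ('x list \<Rightarrow>\<^sub>0 'k) \<times> 'x list) list"
  where "normal_expr X r S h = (THE ts. is_normal_expr X r S h ts)"

section \<open>Extensions\<close>

text \<open>\<open>floor_expr\<close> is $\sum_i \alpha_i h_{i,\lfloor s_i\rfloor}$ for the expression $\sum_i \alpha_i h_{i,s_i}$;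
  \<open>fl\<close> is the map $\lfloor\ \rfloor$.\<close>

definition floor_expr ::
  "('k::field, 'a, 'm) superalgebra_scheme \<Rightarrow> ('a \<Rightarrow> ('b list \<Rightarrow>\<^sub>0 'k) \<Rightarrow> 'a) \<Rightarrow>
   (('b list \<Rightarrow>\<^sub>0 'k) \<Rightarrow> 'a) \<Rightarrow> ('k \<times> ('b list \<Rightarrow>\<^sub>0 'k) \<times> 'b list) list \<Rightarrow> 'a"
  where "floor_expr \<AA> ract fl ts =
    foldr (\<lambda>(\<alpha>, s, c) x. \<alpha> \<odot>\<^bsub>\<AA>\<^esub> foldl (\<lambda>y b. ract y (gen b)) (fl s) c \<oplus>\<^bsub>\<AA>\<^esub> x) ts \<zero>\<^bsub>\<AA>\<^esub>"

text \<open>The disjoint union \<open>A \<union> B\<close> is realised in the sum type, and the elements of the algebra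
  \<open>\<AA>\<close> and of \<open>Lbs B\<close> are embedded into \<open>Lbs (gplus A B)\<close> by \<open>emb_alg\<close> and \<open>emb_free\<close>.\<close>

definition gplus :: "(bit \<Rightarrow> 'a set) \<Rightarrow> (bit \<Rightarrow> 'b set) \<Rightarrow> bit \<Rightarrow> ('a + 'b) set"
  where "gplus A B i = Inl ` A i \<union> Inr ` B i"

definition emb_alg ::
  "('k::field, 'a, 'm) superalgebra_scheme \<Rightarrow> (bit \<Rightarrow> 'a set) \<Rightarrow> 'a \<Rightarrow> (('a + 'b) list \<Rightarrow>\<^sub>0 'k)"
  where "emb_alg \<AA> A x = lin_ext (\<lambda>a. gen (Inl a)) (coordinates \<AA> (gset A) x)"

definition emb_free :: "('b list \<Rightarrow>\<^sub>0 'k::field) \<Rightarrow> (('a + 'b) list \<Rightarrow>\<^sub>0 'k)"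
  where "emb_free f = lin_ext (\<lambda>w. nfmon (map Inr w)) f"

definition ext_relations ::
  "('k::field, 'a) superalgebra \<Rightarrow> (bit \<Rightarrow> 'a set) \<Rightarrow> (bit \<Rightarrow> 'b set) \<Rightarrow> ('b list \<Rightarrow>\<^sub>0 'k) set \<Rightarrow>
   (('b list \<Rightarrow>\<^sub>0 'k) \<Rightarrow> 'a \<Rightarrow> 'a) \<Rightarrow> ('a \<Rightarrow> ('b list \<Rightarrow>\<^sub>0 'k) \<Rightarrow> 'a) \<Rightarrow> (('b list \<Rightarrow>\<^sub>0 'k) \<Rightarrow> 'a) \<Rightarrow>
   (('a + 'b) list \<Rightarrow>\<^sub>0 'k) set"
  where "ext_relations \<AA> A B R lact ract fl =
    {lb_mult (gplus A B) (gen (Inl a)) (gen (Inl a')) - emb_alg \<AA> A (a \<otimes>\<^bsub>\<AA>\<^esub> a') |a a'.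
       a \<in> gset A \<and> a' \<in> gset A} \<union>
    {lb_mult (gplus A B) (gen (Inl a)) (gen (Inr b)) - emb_alg \<AA> A (ract a (gen b)) |a b.
       a \<in> gset A \<and> b \<in> gset B} \<union>
    {lb_mult (gplus A B) (emb_free (nfmon \<nu>)) (gen (Inl a)) - emb_alg \<AA> A (lact (nfmon \<nu>) a) |\<nu> a.
       \<nu> \<in> NF B \<and> a \<in> gset A} \<union>
    {emb_free f - emb_alg \<AA> A (fl f) |f. f \<in> R}"

definition ext_algebra ::
  "('k::field, 'a) superalgebra \<Rightarrow> (bit \<Rightarrow> 'a set) \<Rightarrow> (bit \<Rightarrow> 'b set) \<Rightarrow> ('b list \<Rightarrow>\<^sub>0 'k) set \<Rightarrow>
   (('b list \<Rightarrow>\<^sub>0 'k) \<Rightarrow> 'a \<Rightarrow> 'a) \<Rightarrow> ('a \<Rightarrow> ('b list \<Rightarrow>\<^sub>0 'k) \<Rightarrow> 'a) \<Rightarrow> (('b list \<Rightarrow>\<^sub>0 'k) \<Rightarrow> 'a) \<Rightarrow>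
   ('k, (('a + 'b) list \<Rightarrow>\<^sub>0 'k) set) superalgebra"
  where "ext_algebra \<AA> A B R lact ract fl =
    Lbs_rel (gplus A B) (ext_relations \<AA> A B R lact ract fl)"

definition ext_class ::
  "('k::field, 'a) superalgebra \<Rightarrow> (bit \<Rightarrow> 'a set) \<Rightarrow> (bit \<Rightarrow> 'b set) \<Rightarrow> ('b list \<Rightarrow>\<^sub>0 'k) set \<Rightarrow>
   (('b list \<Rightarrow>\<^sub>0 'k) \<Rightarrow> 'a \<Rightarrow> 'a) \<Rightarrow> ('a \<Rightarrow> ('b list \<Rightarrow>\<^sub>0 'k) \<Rightarrow> 'a) \<Rightarrow> (('b list \<Rightarrow>\<^sub>0 'k) \<Rightarrow> 'a) \<Rightarrow>
   (('a + 'b) list \<Rightarrow>\<^sub>0 'k) \<Rightarrow> (('a + 'b) list \<Rightarrow>\<^sub>0 'k) set"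
  where "ext_class \<AA> A B R lact ract fl =
    Lbs_class (gplus A B) (ext_relations \<AA> A B R lact ract fl)"

text \<open>\<open>fl\<close> stands for a map \<open>R \<rightarrow> \<AA>\<close>, so only its values on \<open>R\<close> matter. In the last conjunct,
  \<^const>\<open>normal_expr\<close> is the unique expression of $(\mu f)$ by normal \<open>R\<close>-polynomials.\<close>

definition extension_data ::
  "('k::field, 'a) superalgebra \<Rightarrow> (bit \<Rightarrow> 'a set) \<Rightarrow> (bit \<Rightarrow> 'b set) \<Rightarrow> 'b rel \<Rightarrow>
   ('b list \<Rightarrow>\<^sub>0 'k) set \<Rightarrow> (('b list \<Rightarrow>\<^sub>0 'k) \<Rightarrow> 'a \<Rightarrow> 'a) \<Rightarrow> ('a \<Rightarrow> ('b list \<Rightarrow>\<^sub>0 'k) \<Rightarrow> 'a) \<Rightarrow>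
   (('b list \<Rightarrow>\<^sub>0 'k) \<Rightarrow> 'a) \<Rightarrow> bool"
  where "extension_data \<AA> A B r R lact ract fl \<longleftrightarrow>
    compatible_supermodule (Lbs B) \<AA> lact ract \<and>
    (\<forall>i. \<forall>f \<in> R \<inter> part (Lbs B) i. fl f \<in> part \<AA> i) \<and>
    (\<forall>a\<in>gset A. \<forall>f\<in>R. ract a f = a \<otimes>\<^bsub>\<AA>\<^esub> fl f \<and> lact f a = fl f \<otimes>\<^bsub>\<AA>\<^esub> a) \<and>
    (\<forall>\<mu>\<in>NF B. \<forall>f\<in>R. lact (nfmon \<mu>) (fl f) =
       floor_expr \<AA> ract fl (normal_expr B r R (lb_mult B (nfmon \<mu>) f)))"

end

theory Submission
  imports Defs
begin

text \<open>
  Since \<open>R\<close> is reduced and its leading monomials have length greater than \<open>1\<close>, the normal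
  \<open>R\<close>-polynomials have pairwise distinct leading monomials and form a linear basis of \<open>Id(R)\<close>.
  Hence the map \<open>\<lfloor> \<rfloor>\<close> extends linearly to \<open>Id(R)\<close>, and conditions (i) and (ii) say exactly that
  this extension intertwines the products of \<open>Lb\<^sub>s(B)\<close> with the two actions. A compatible supermodule
  structure makes \<open>\<AA> \<oplus> Lb\<^sub>s(B)\<close> a Leibniz superalgebra, in which the elements \<open>h - \<lfloor>h\<rfloor>\<close> with
  \<open>h \<in> Id(R)\<close> form a graded ideal \<open>J\<close>. The canonical homomorphism from \<open>Lb\<^sub>s(A \<union> B)\<close> onto this
  semidirect product pulls \<open>J\<close> back to the ideal of the defining relations: modulo the relations every
  element reduces to the span of \<open>A\<close> and \<open>Irr(R)\<close>, and that span meets \<open>J\<close> trivially. So the presented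
  algebra is the quotient of the semidirect product by \<open>J\<close>, which is an extension of the required kind.
  Conversely, lifting the generators of \<open>\<BB>\<close> to homogeneous elements of \<open>\<EE>\<close> turns \<open>\<AA>\<close> into a
  supermodule over \<open>Lb\<^sub>s(B)\<close>, and \<open>\<EE>\<close> is recovered as the same quotient.
\<close>

section \<open>Homomorphisms and quotients\<close>

text \<open>Right multiplication by a letter is plain concatenation in \<open>Lbs\<close>, with no
  correction terms, so the leading word of a normal polynomial is \<open>lead r s @ c\<close>.
  Distinctness of these words thus reduces to the fact that no leading word of R is a prefix of
  another one. Left multiplication is the obstacle: it is governed only by x(yb) = (xy)b -+ (xb)y,
  which shortens y at the price of lengthening the factor on its left. This is why condition (ii)
  and the relations for products of a word of B with an element of A range over all words and not
  only over letters, and why the inductions on the last letter generalise over the other factor.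

  No Groebner-Shirshov basis for the union of A and B is computed. Rewriting bounds the presented
  algebra from above, the homomorphism to the semidirect product modulo J from below. J is the graph
  of minus the extended floor map; it therefore meets \<AA> in zero and projects onto Id(R), which
  gives the embedding of \<AA> and the quotient \<BB>.\<close>

context leibniz_superalgebra
begin

lemma part_in_carrier: "x \<in> part A i \<Longrightarrow> x \<in> carrier A"
  using part_carrier by blast

lemma part_decompose:
  assumes "x \<in> carrier A"
  obtains x0 x1 where "x0 \<in> part A 0" "x1 \<in> part A 1" "x = x0 \<oplus> x1"
proof -
  obtain p where "p \<in> part A 0 \<times> part A 1" "x = fst p \<oplus> snd p"
    using part_direct_sum[OF assms] by blast
  then show thesis by (intro that[of "fst p" "snd p"]) auto
qed

lemma part_sum_unique:
  assumes "x0 \<in> part A 0" "x1 \<in> part A 1" "y0 \<in> part A 0" "y1 \<in> part A 1" "x0 \<oplus> x1 = y0 \<oplus> y1"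
  shows "x0 = y0 \<and> x1 = y1"
proof -
  have "x0 \<oplus> x1 \<in> carrier A"
    using assms part_in_carrier by auto
  from part_direct_sum[OF this] have "(x0, x1) = (y0, y1)"
    using assms by (metis (mono_tags, lifting) fst_conv mem_Sigma_iff snd_conv)
  then show ?thesis by simp
qed

lemma part_sum_zero:
  assumes "x0 \<in> part A 0" "x1 \<in> part A 1" "x0 \<oplus> x1 = \<zero>"
  shows "x0 = \<zero> \<and> x1 = \<zero>"
  using part_sum_unique[OF assms(1,2) part_zero part_zero] assms(3) by simp

lemma part_sum_in_part:
  assumes "x0 \<in> part A 0" "x1 \<in> part A 1" "x0 \<oplus> x1 \<in> part A i"
  shows "x0 \<oplus> x1 = (if i = 0 then x0 else x1) \<and> (if i = 0 then x1 else x0) = \<zero>"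
proof (cases "i = 0")
  case True
  with assms have "x0 = x0 \<oplus> x1 \<and> x1 = \<zero>"
    by (intro part_sum_unique part_zero) (auto simp: part_in_carrier)
  with True show ?thesis by (metis (full_types))
next
  case False
  then have "i = 1" by (cases i) auto
  with assms have "x0 = \<zero> \<and> x1 = x0 \<oplus> x1"
    by (intro part_sum_unique part_zero) (auto simp: part_in_carrier)
  with False show ?thesis by (metis (full_types))
qed

lemma part_induct [consumes 1, case_names part add]:
  assumes "x \<in> carrier A" "\<And>i x. x \<in> part A i \<Longrightarrow> P x"
    "\<And>x y. x \<in> carrier A \<Longrightarrow> y \<in> carrier A \<Longrightarrow> P x \<Longrightarrow> P y \<Longrightarrow> P (x \<oplus> y)"
  shows "P x"
  using assms by (metis part_decompose part_in_carrier)

text \<open>The gradedness clause of \<open>super_ideal\<close> in a form that can be proved by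
  induction over homogeneous spanning elements; \<open>graded_sum_components\<close> turns it back
  into that clause.\<close>

definition graded_sum :: "'a set \<Rightarrow> 'a \<Rightarrow> bool"
  where "graded_sum I z \<longleftrightarrow> (\<exists>z0\<in>I \<inter> part A 0. \<exists>z1\<in>I \<inter> part A 1. z = z0 \<oplus> z1)"

lemma graded_sum_zero: "\<zero> \<in> I \<Longrightarrow> graded_sum I \<zero>"
  unfolding graded_sum_def using part_zero by (intro bexI[of _ \<zero>]) auto

lemma graded_sum_add:
  assumes I: "\<And>x y. x \<in> I \<Longrightarrow> y \<in> I \<Longrightarrow> x \<oplus> y \<in> I"
    and x: "x \<in> I" "x \<in> part A j" and y: "graded_sum I y"
  shows "graded_sum I (x \<oplus> y)"
proof -
  obtain y0 y1 where y01: "y0 \<in> I" "y0 \<in> part A 0" "y1 \<in> I" "y1 \<in> part A 1" "y = y0 \<oplus> y1"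
    using y by (auto simp: graded_sum_def)
  note c = part_in_carrier[OF x(2)] part_in_carrier[OF y01(2)] part_in_carrier[OF y01(4)]
  have eq: "x \<oplus> y = (x \<oplus> y0) \<oplus> y1" "x \<oplus> y = y0 \<oplus> (x \<oplus> y1)"
    using c by (simp_all add: y01(5) a_ac)
  consider "j = 0" | "j = 1" by (cases j) auto
  then show ?thesis
  proof cases
    case 1
    show ?thesis
      unfolding graded_sum_def using x(2) y01 I[OF x(1) y01(1)] eq(1) part_add[of x 0 y0] unfolding 1
      by (intro bexI[of _ "x \<oplus> y0"] bexI[of _ y1]) auto
  next
    case 2
    show ?thesis
      unfolding graded_sum_def using x(2) y01 I[OF x(1) y01(3)] eq(2) part_add[of x 1 y1] unfolding 2
      by (intro bexI[of _ y0] bexI[of _ "x \<oplus> y1"]) auto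
  qed
qed

lemma graded_sum_components:
  "x \<in> part A 0 \<Longrightarrow> y \<in> part A 1 \<Longrightarrow> graded_sum I (x \<oplus> y) \<Longrightarrow> x \<in> I \<and> y \<in> I"
  unfolding graded_sum_def using part_sum_unique[of x y] by auto

lemma a_inv_part: "x \<in> part A i \<Longrightarrow> \<ominus> x \<in> part A i"
  using part_smult[of x i "-1"] by (simp add: smult_minus_one part_in_carrier)

lemma minus_closed_part: "x \<in> part A i \<Longrightarrow> y \<in> part A i \<Longrightarrow> x \<ominus> y \<in> part A i"
  by (simp add: a_minus_def a_inv_part part_add)

lemma a_inv_zero: "\<ominus> \<zero> = \<zero>"
  by (rule minus_equality) auto

lemma smult_a_inv: "x \<in> carrier A \<Longrightarrow> c \<odot> (\<ominus> x) = \<ominus> (c \<odot> x)"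
  using smult_assoc[of x c "-1"] smult_assoc[of x "-1" c]
  by (simp add: smult_closed smult_minus_one[symmetric])

lemma mult_a_inv_left: "x \<in> carrier A \<Longrightarrow> y \<in> carrier A \<Longrightarrow> (\<ominus> x) \<otimes> y = \<ominus> (x \<otimes> y)"
  using mult_smult_left[of x y "-1"] by (simp add: mult_closed smult_minus_one)

lemma mult_a_inv_right: "x \<in> carrier A \<Longrightarrow> y \<in> carrier A \<Longrightarrow> x \<otimes> (\<ominus> y) = \<ominus> (x \<otimes> y)"
  using mult_smult_right[of x y "-1"] by (simp add: mult_closed smult_minus_one)

lemma minus_eq_zero_iff: "x \<in> carrier A \<Longrightarrow> y \<in> carrier A \<Longrightarrow> x \<ominus> y = \<zero> \<longleftrightarrow> x = y"
  by (metis a_minus_def add.inv_closed add.inv_equality add.r_inv minus_minus)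

end

subsection \<open>Homomorphisms\<close>

lemma super_idealD:
  assumes "super_ideal L I"
  shows "I \<subseteq> carrier L" "\<zero>\<^bsub>L\<^esub> \<in> I" "x \<in> I \<Longrightarrow> y \<in> I \<Longrightarrow> x \<oplus>\<^bsub>L\<^esub> y \<in> I" "x \<in> I \<Longrightarrow> c \<odot>\<^bsub>L\<^esub> x \<in> I"
    "x \<in> I \<Longrightarrow> z \<in> carrier L \<Longrightarrow> x \<otimes>\<^bsub>L\<^esub> z \<in> I" "x \<in> I \<Longrightarrow> z \<in> carrier L \<Longrightarrow> z \<otimes>\<^bsub>L\<^esub> x \<in> I"
    "u \<in> part L 0 \<Longrightarrow> v \<in> part L 1 \<Longrightarrow> u \<oplus>\<^bsub>L\<^esub> v \<in> I \<Longrightarrow> u \<in> I \<and> v \<in> I"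
  using assms unfolding super_ideal_def by blast+

lemma linear_mapD:
  assumes "linear_map M N h"
  shows "x \<in> carrier M \<Longrightarrow> h x \<in> carrier N"
    "x \<in> carrier M \<Longrightarrow> y \<in> carrier M \<Longrightarrow> h (x \<oplus>\<^bsub>M\<^esub> y) = h x \<oplus>\<^bsub>N\<^esub> h y"
    "x \<in> carrier M \<Longrightarrow> h (c \<odot>\<^bsub>M\<^esub> x) = c \<odot>\<^bsub>N\<^esub> h x"
  using assms unfolding linear_map_def by blast+

locale leibniz_hom = L: leibniz_superalgebra L + M: leibniz_superalgebra M
  for L :: "('k::field, 'a, 'm) superalgebra_scheme" and M :: "('k, 'b, 'n) superalgebra_scheme" +
  fixes h :: "'a \<Rightarrow> 'b"
  assumes hom: "superalgebra_hom L M h"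
begin

lemma linear: "linear_map L M h"
  using hom by (simp add: superalgebra_hom_def)

lemmas closed = linear_mapD(1)[OF linear]
  and add = linear_mapD(2)[OF linear]
  and smult = linear_mapD(3)[OF linear]

lemma zero: "h \<zero>\<^bsub>L\<^esub> = \<zero>\<^bsub>M\<^esub>"
  using smult[of "\<zero>\<^bsub>L\<^esub>" 0] by (simp add: L.zero_smult M.zero_smult closed)

lemma a_inv: "x \<in> carrier L \<Longrightarrow> h (\<ominus>\<^bsub>L\<^esub> x) = \<ominus>\<^bsub>M\<^esub> h x"
  using smult[of x "-1"] by (simp add: L.smult_minus_one M.smult_minus_one closed)

lemma minus: "x \<in> carrier L \<Longrightarrow> y \<in> carrier L \<Longrightarrow> h (x \<ominus>\<^bsub>L\<^esub> y) = h x \<ominus>\<^bsub>M\<^esub> h y"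
  by (simp add: a_minus_def add a_inv)

lemma eq_iff:
  "x \<in> carrier L \<Longrightarrow> y \<in> carrier L \<Longrightarrow> h x = h y \<longleftrightarrow> h (x \<ominus>\<^bsub>L\<^esub> y) = \<zero>\<^bsub>M\<^esub>"
  by (simp add: minus M.minus_eq_zero_iff closed)

lemma inj_onI_kernel:
  assumes "\<And>x. x \<in> carrier L \<Longrightarrow> h x = \<zero>\<^bsub>M\<^esub> \<Longrightarrow> x = \<zero>\<^bsub>L\<^esub>"
  shows "inj_on h (carrier L)"
proof (rule inj_onI)
  fix x y assume xy: "x \<in> carrier L" "y \<in> carrier L" "h x = h y"
  then have "x \<ominus>\<^bsub>L\<^esub> y = \<zero>\<^bsub>L\<^esub>" by (intro assms) (auto simp: eq_iff)
  with xy show "x = y" by (simp add: L.minus_eq_zero_iff)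
qed

lemma mult: "x \<in> carrier L \<Longrightarrow> y \<in> carrier L \<Longrightarrow> h (x \<otimes>\<^bsub>L\<^esub> y) = h x \<otimes>\<^bsub>M\<^esub> h y"
  using hom by (auto simp: superalgebra_hom_def)

lemma part: "x \<in> part L i \<Longrightarrow> h x \<in> part M i"
  using hom unfolding superalgebra_hom_def by blast

text \<open>A preimage of a homogeneous element need not be homogeneous, but its component of parity
  i has the same image: the other component maps into the other part, hence to zero. Surjections
  therefore admit homogeneous lifts.\<close>

lemma part_preimage:
  assumes x: "x \<in> carrier L" and hx: "h x \<in> part M i"
  shows "\<exists>y\<in>part L i. h y = h x"
proof -
  obtain x0 x1 where x01: "x0 \<in> part L 0" "x1 \<in> part L 1" "x = x0 \<oplus>\<^bsub>L\<^esub> x1"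
    using L.part_decompose[OF x] .
  then have eq: "h x = h x0 \<oplus>\<^bsub>M\<^esub> h x1"
    by (simp add: add L.part_in_carrier)
  from M.part_sum_in_part[OF part[OF x01(1)] part[OF x01(2)]] hx
  have "h x = (if i = 0 then h x0 else h x1)"
    unfolding eq by blast
  moreover have "i = 1" if "i \<noteq> 0" using that by (cases i) auto
  ultimately show ?thesis using x01 by metis
qed

lemma vimage_ideal:
  assumes "super_ideal M I"
  shows "super_ideal L {x \<in> carrier L. h x \<in> I}"
  unfolding super_ideal_def
proof (intro conjI ballI allI impI)
  fix x y assume "x \<in> part L 0" "y \<in> part L 1" "x \<oplus>\<^bsub>L\<^esub> y \<in> {x \<in> carrier L. h x \<in> I}"
  then show "x \<in> {x \<in> carrier L. h x \<in> I}" "y \<in> {x \<in> carrier L. h x \<in> I}"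
    using super_idealD(7)[OF assms, of "h x" "h y"] part[of x 0] part[of y 1]
    by (simp_all add: add L.part_in_carrier)
qed (simp_all add: zero add smult mult closed L.smult_closed L.mult_closed super_idealD[OF assms] subset_iff)

text \<open>Linearity and multiplicativity of the inverse are formal; that it respects the parts
  follows from \<open>part_preimage\<close> together with injectivity.\<close>

lemma inverse:
  assumes bij: "bij_betw h (carrier L) (carrier M)"
  shows "superalgebra_hom M L (inv_into (carrier L) h)"
proof -
  let ?g = "inv_into (carrier L) h"
  have inj: "inj_on h (carrier L)" and im: "h ` carrier L = carrier M"
    using bij by (auto simp: bij_betw_def)
  have g: "?g z \<in> carrier L" "h (?g z) = z" if "z \<in> carrier M" for z
    using that by (auto simp: im[symmetric] inv_into_into f_inv_into_f)
  have eq: "?g z = x" if "x \<in> carrier L" "h x = z" for x z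
    using that inj by auto
  show ?thesis
    unfolding superalgebra_hom_def linear_map_def
  proof (intro conjI ballI allI)
    fix i
    show "?g ` part M i \<subseteq> part L i"
    proof
      fix y assume "y \<in> ?g ` part M i"
      then obtain z where z: "z \<in> part M i" "y = ?g z" by auto
      then have zc: "z \<in> carrier M" by (simp add: M.part_in_carrier)
      with z(1) obtain x where x: "x \<in> part L i" "h x = z"
        using part_preimage[of "?g z" i] g by auto
      with z(2) eq[OF L.part_in_carrier[OF x(1)] x(2)] show "y \<in> part L i" by simp
    qed
  qed (use g in \<open>auto intro!: eq simp: L.mult_closed L.smult_closed add mult smult\<close>)
qed

end

lemma leibniz_homI:
  "leibniz_superalgebra L \<Longrightarrow> leibniz_superalgebra M \<Longrightarrow> superalgebra_hom L M h \<Longrightarrow> leibniz_hom L M h"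
  by (simp add: leibniz_hom_def leibniz_hom_axioms_def)

text \<open>The conclusion runs against the direction of \<open>h\<close>: the map built later
  starts at the presented algebra, while the isomorphism is wanted out of the given
  extension.\<close>

lemma superalgebra_isomorphicI:
  assumes "leibniz_superalgebra L" "leibniz_superalgebra M"
    "superalgebra_hom L M h" "bij_betw h (carrier L) (carrier M)"
  shows "superalgebra_isomorphic M L"
proof -
  interpret leibniz_hom L M h
    using assms by (simp add: leibniz_homI)
  show ?thesis
    unfolding superalgebra_isomorphic_def using inverse[OF assms(4)] bij_betw_inv_into[OF assms(4)]
    by blast
qed

lemma superalgebra_hom_comp:
  assumes "superalgebra_hom L M h" "superalgebra_hom M N k"
  shows "superalgebra_hom L N (\<lambda>x. k (h x))"
proof -
  have h: "linear_map L M h" and k: "linear_map M N k"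
    using assms by (auto simp: superalgebra_hom_def)
  have "linear_map L N (\<lambda>x. k (h x))"
    using linear_mapD[OF h] linear_mapD[OF k] by (auto simp: linear_map_def)
  with assms linear_mapD(1)[OF h] show ?thesis
    unfolding superalgebra_hom_def by (simp add: image_subset_iff)
qed

text \<open>The universal property of a quotient, stated for an arbitrary surjection
  \<open>q\<close> so that no coset has to be opened. The value at \<open>z\<close> uses a chosen
  preimage; the inclusion of kernels makes the choice irrelevant, and \<open>part_preimage\<close>
  supplies a homogeneous one for parity.\<close>

lemma superalgebra_hom_factor:
  assumes "leibniz_superalgebra L" "leibniz_superalgebra Q" "leibniz_superalgebra M"
    and q: "superalgebra_hom L Q q" "q ` carrier L = carrier Q" and h: "superalgebra_hom L M h"
    and ker: "\<And>x. x \<in> carrier L \<Longrightarrow> q x = \<zero>\<^bsub>Q\<^esub> \<Longrightarrow> h x = \<zero>\<^bsub>M\<^esub>"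
  obtains k where "superalgebra_hom Q M k" "\<And>x. x \<in> carrier L \<Longrightarrow> k (q x) = h x"
proof -
  interpret q: leibniz_hom L Q q
    using assms by (simp add: leibniz_homI)
  interpret h: leibniz_hom L M h
    using assms by (simp add: leibniz_homI)
  define k where "k z = h (inv_into (carrier L) q z)" for z
  have k: "k (q x) = h x" if x: "x \<in> carrier L" for x
  proof -
    let ?y = "inv_into (carrier L) q (q x)"
    have y: "?y \<in> carrier L" "q ?y = q x"
      using x by (auto simp: inv_into_into f_inv_into_f)
    then have "h (?y \<ominus>\<^bsub>L\<^esub> x) = \<zero>\<^bsub>M\<^esub>"
      using x q.eq_iff by (intro ker) auto
    then show ?thesis
      using x y h.eq_iff unfolding k_def by blast
  qed
  have "superalgebra_hom Q M k"
    unfolding superalgebra_hom_def linear_map_def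
  proof (intro conjI ballI allI)
    show "k \<in> carrier Q \<rightarrow> carrier M"
      using k h.closed by (auto simp flip: q(2))
    fix x y c i
    show "k ` part Q i \<subseteq> part M i"
    proof
      fix y assume "y \<in> k ` part Q i"
      then obtain z where z: "z \<in> part Q i" "y = k z" by auto
      then obtain x' where "x' \<in> carrier L" "z = q x'"
        using q(2) q.M.part_in_carrier by blast
      then obtain x where "x \<in> part L i" "q x = z"
        using z(1) q.part_preimage by blast
      then show "y \<in> part M i"
        using z(2) k h.part q.L.part_in_carrier by auto
    qed
    assume "x \<in> carrier Q"
    then obtain x' where x': "x' \<in> carrier L" "x = q x'" using q(2) by blast
    show "k (c \<odot>\<^bsub>Q\<^esub> x) = c \<odot>\<^bsub>M\<^esub> k x"
      using x' by (simp add: k h.smult q.L.smult_closed flip: q.smult)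
    assume "y \<in> carrier Q"
    then obtain y' where y': "y' \<in> carrier L" "y = q y'" using q(2) by blast
    show "k (x \<oplus>\<^bsub>Q\<^esub> y) = k x \<oplus>\<^bsub>M\<^esub> k y"
      using x' y' by (simp add: k h.add flip: q.add)
    show "k (x \<otimes>\<^bsub>Q\<^esub> y) = k x \<otimes>\<^bsub>M\<^esub> k y"
      using x' y' by (simp add: k h.mult q.L.mult_closed flip: q.mult)
  qed
  with k that show thesis by blast
qed

subsection \<open>Quotients\<close>

lemma super_Id_least: "super_ideal L I \<Longrightarrow> S \<subseteq> I \<Longrightarrow> super_Id L S \<subseteq> I"
  unfolding super_Id_def by blast

lemma super_Id_superset: "S \<subseteq> super_Id L S"
  unfolding super_Id_def by blast

context leibniz_superalgebra
begin

lemma super_ideal_carrier: "super_ideal A (carrier A)"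
  unfolding super_ideal_def by (auto simp: smult_closed mult_closed part_in_carrier)

text \<open>Because S lies in the carrier, the carrier is one of the ideals being intersected; this
  keeps the intersection inside the algebra, and all other closure properties pass to
  intersections.\<close>

lemma super_ideal_super_Id: "S \<subseteq> carrier A \<Longrightarrow> super_ideal A (super_Id A S)"
proof -
  assume "S \<subseteq> carrier A"
  then have "super_Id A S \<subseteq> carrier A"
    by (intro super_Id_least super_ideal_carrier)
  then show "super_ideal A (super_Id A S)"
    by (subst super_ideal_def, intro conjI ballI allI impI) (auto simp: super_Id_def dest: super_idealD)
qed

context
  fixes I assumes I: "super_ideal A I"
begin

lemma ideal_a_inv: "x \<in> I \<Longrightarrow> \<ominus> x \<in> I"
  using super_idealD(4)[OF I, of x "-1"] super_idealD(1)[OF I] by (auto simp: smult_minus_one)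

lemma ideal_minus: "x \<in> I \<Longrightarrow> y \<in> I \<Longrightarrow> x \<ominus> y \<in> I"
  by (simp add: a_minus_def ideal_a_inv super_idealD(3)[OF I])

lemma abelian_subgroup_ideal: "abelian_subgroup I A"
proof (rule abelian_subgroupI3)
  show "additive_subgroup I A"
    using super_idealD[OF I] ideal_a_inv
    by (intro additive_subgroupI subgroup.intro) (auto simp flip: a_inv_def)
qed (rule abelian_group_axioms)

interpretation I: abelian_subgroup I A
  by (rule abelian_subgroup_ideal)

lemma coset_eq_iff:
  assumes "x \<in> carrier A" "y \<in> carrier A"
  shows "I +> x = I +> y \<longleftrightarrow> x \<ominus> y \<in> I"
  using assms I.a_rcos_module[OF assms(2,1)] I.a_rcos_self[OF assms(1)] I.a_repr_independence'[of x y]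
  by (auto simp: a_minus_def)

lemma coset_mem_carrier: "x \<in> carrier A \<Longrightarrow> y \<in> I +> x \<Longrightarrow> y \<in> carrier A"
  using a_r_coset_subset_G[of I x] super_idealD(1)[OF I] by blast

lemma coset_mem_minus: "x \<in> carrier A \<Longrightarrow> y \<in> I +> x \<Longrightarrow> y \<ominus> x \<in> I"
  using I.a_rcos_module_imp by (simp add: a_minus_def)

lemma quot_mult:
  assumes "x \<in> carrier A" "y \<in> carrier A"
  shows "rcoset_mult A I (I +> x) (I +> y) = I +> (x \<otimes> y)"
proof -
  \<comment> \<open>\<open>rcoset_mult\<close> is a union over all pairs of representatives, so
    every member of that union has to be shown to be the same coset.\<close>
  have "I +> (u \<otimes> v) = I +> (x \<otimes> y)" if uv: "u \<in> I +> x" "v \<in> I +> y" for u v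
  proof -
    have c: "u \<in> carrier A" "v \<in> carrier A" "u \<ominus> x \<in> I" "v \<ominus> y \<in> I"
      using uv assms coset_mem_carrier coset_mem_minus by blast+
    have "(u \<ominus> x) \<otimes> v \<oplus> x \<otimes> (v \<ominus> y) = (u \<otimes> v) \<ominus> (x \<otimes> y)"
      using c(1,2) assms
      by (simp add: a_minus_def mult_add_left mult_add_right mult_a_inv_left mult_a_inv_right
          mult_closed a_assoc r_neg2 r_neg1)
    moreover have "(u \<ominus> x) \<otimes> v \<oplus> x \<otimes> (v \<ominus> y) \<in> I"
      using c assms by (intro super_idealD(3)[OF I] super_idealD(5)[OF I] super_idealD(6)[OF I])
    ultimately show ?thesis
      using c assms by (simp add: coset_eq_iff mult_closed)
  qed
  then show ?thesis
    using I.a_rcos_self[OF assms(1)] I.a_rcos_self[OF assms(2)]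
    unfolding rcoset_mult_def by blast
qed

lemma quot_smult:
  assumes "x \<in> carrier A"
  shows "(\<Union>u\<in>I +> x. I +> (c \<odot> u)) = I +> (c \<odot> x)"
proof -
  have "I +> (c \<odot> u) = I +> (c \<odot> x)" if u: "u \<in> I +> x" for u
  proof -
    have c: "u \<in> carrier A" "u \<ominus> x \<in> I"
      using u assms coset_mem_carrier coset_mem_minus by blast+
    have "c \<odot> (u \<ominus> x) = (c \<odot> u) \<ominus> (c \<odot> x)"
      using c(1) assms by (simp add: a_minus_def smult_r_distr smult_a_inv smult_closed)
    with super_idealD(4)[OF I c(2), of c] show ?thesis
      using c assms by (simp add: coset_eq_iff smult_closed)
  qed
  then show ?thesis
    using I.a_rcos_self[OF assms(1)] by blast
qed

lemma super_quot_carrier: "carrier (super_quot A I) = (\<lambda>x. I +> x) ` carrier A"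
  by (auto simp: super_quot_def A_RCOSETS_def RCOSETS_def a_r_coset_def)

lemma super_quot_ops:
  "x \<in> carrier A \<Longrightarrow> y \<in> carrier A \<Longrightarrow> (I +> x) \<oplus>\<^bsub>super_quot A I\<^esub> (I +> y) = I +> (x \<oplus> y)"
  "x \<in> carrier A \<Longrightarrow> y \<in> carrier A \<Longrightarrow> (I +> x) \<otimes>\<^bsub>super_quot A I\<^esub> (I +> y) = I +> (x \<otimes> y)"
  "x \<in> carrier A \<Longrightarrow> c \<odot>\<^bsub>super_quot A I\<^esub> (I +> x) = I +> (c \<odot> x)"
  "\<zero>\<^bsub>super_quot A I\<^esub> = I +> \<zero>"
  "part (super_quot A I) i = (\<lambda>x. I +> x) ` part A i"
  using super_idealD(1)[OF I]
  by (simp_all add: super_quot_def I.a_rcos_sum quot_mult quot_smult)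

lemma abelian_group_super_quot: "abelian_group (super_quot A I)"
proof (rule abelian_groupI)
  fix x assume "x \<in> carrier (super_quot A I)"
  then obtain x' where "x' \<in> carrier A" "x = I +> x'" by (auto simp: super_quot_carrier)
  then show "\<exists>y\<in>carrier (super_quot A I). y \<oplus>\<^bsub>super_quot A I\<^esub> x = \<zero>\<^bsub>super_quot A I\<^esub>"
    by (intro bexI[of _ "I +> (\<ominus> x')"]) (auto simp: super_quot_ops l_neg super_quot_carrier)
qed (auto simp: super_quot_carrier super_quot_ops a_ac)

theorem leibniz_superalgebra_super_quot: "leibniz_superalgebra (super_quot A I)"
proof -
  let ?Q = "super_quot A I"
  interpret Q: abelian_group ?Q by (rule abelian_group_super_quot)
  have inv: "\<ominus>\<^bsub>?Q\<^esub> (I +> x) = I +> (\<ominus> x)" if "x \<in> carrier A" for x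
    using that by (intro Q.minus_equality) (auto simp: super_quot_ops super_quot_carrier l_neg)
  have minus: "(I +> x) \<ominus>\<^bsub>?Q\<^esub> (I +> y) = I +> (x \<ominus> y)" if "x \<in> carrier A" "y \<in> carrier A" for x y
    using that by (simp add: a_minus_def inv super_quot_ops)
  show ?thesis
  proof
    fix x assume "x \<in> carrier ?Q"
    then obtain x' where x': "x' \<in> carrier A" "x = I +> x'" by (auto simp: super_quot_carrier)
    obtain x0 x1 where x01: "x0 \<in> part A 0" "x1 \<in> part A 1" "x' = x0 \<oplus> x1"
      using part_decompose[OF x'(1)] .
    show "\<exists>!p. p \<in> part ?Q 0 \<times> part ?Q 1 \<and> x = fst p \<oplus>\<^bsub>?Q\<^esub> snd p"
    proof (intro ex1I[of _ "(I +> x0, I +> x1)"])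
      show "(I +> x0, I +> x1) \<in> part ?Q 0 \<times> part ?Q 1 \<and>
          x = fst (I +> x0, I +> x1) \<oplus>\<^bsub>?Q\<^esub> snd (I +> x0, I +> x1)"
        using x01 x'(2) by (auto simp: super_quot_ops part_in_carrier)
    next
      fix p assume p: "p \<in> part ?Q 0 \<times> part ?Q 1 \<and> x = fst p \<oplus>\<^bsub>?Q\<^esub> snd p"
      then obtain y0 y1 where y: "y0 \<in> part A 0" "y1 \<in> part A 1" "p = (I +> y0, I +> y1)"
        by (auto simp: super_quot_ops)
      have c: "x0 \<in> carrier A" "x1 \<in> carrier A" "y0 \<in> carrier A" "y1 \<in> carrier A"
        using x01 y by (auto simp: part_in_carrier)
      have "I +> (x0 \<oplus> x1) = I +> (y0 \<oplus> y1)"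
        using p x' x01 y c by (simp add: super_quot_ops)
      then have "(x0 \<oplus> x1) \<ominus> (y0 \<oplus> y1) \<in> I"
        using c by (simp add: coset_eq_iff)
      moreover have "(x0 \<oplus> x1) \<ominus> (y0 \<oplus> y1) = (x0 \<ominus> y0) \<oplus> (x1 \<ominus> y1)"
        using c by (simp add: a_minus_def minus_add a_ac)
      \<comment> \<open>Gradedness of I makes the parts of the quotient form a direct sum: a
        difference lying in I has both homogeneous components in I.\<close>
      ultimately have "x0 \<ominus> y0 \<in> I \<and> x1 \<ominus> y1 \<in> I"
        using super_idealD(7)[OF I] minus_closed_part x01 y by metis
      then show "p = (I +> x0, I +> x1)"
        using y c by (simp add: coset_eq_iff[symmetric])
    qed
  next
    fix x y z i j l assume "x \<in> part ?Q i" "y \<in> part ?Q j" "z \<in> part ?Q l"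
    then obtain x' y' z' where xyz: "x' \<in> part A i" "y' \<in> part A j" "z' \<in> part A l"
      "x = I +> x'" "y = I +> y'" "z = I +> z'" by (auto simp: super_quot_ops)
    then show "x \<otimes>\<^bsub>?Q\<^esub> (y \<otimes>\<^bsub>?Q\<^esub> z) = x \<otimes>\<^bsub>?Q\<^esub> y \<otimes>\<^bsub>?Q\<^esub> z \<ominus>\<^bsub>?Q\<^esub>
        ksign (l * j) \<odot>\<^bsub>?Q\<^esub> (x \<otimes>\<^bsub>?Q\<^esub> z \<otimes>\<^bsub>?Q\<^esub> y)"
      using leibniz[OF xyz(1-3)]
      by (simp add: super_quot_ops mult_closed part_in_carrier smult_closed minus)
  next
    fix x y i j assume "x \<in> part ?Q i" "y \<in> part ?Q j"
    then obtain x' y' where xy: "x' \<in> part A i" "y' \<in> part A j" "x = I +> x'" "y = I +> y'"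
      by (auto simp: super_quot_ops)
    show "x \<otimes>\<^bsub>?Q\<^esub> y \<in> part ?Q (i + j)"
      unfolding xy(3,4) super_quot_ops(5)
        super_quot_ops(2)[OF xy(1,2)[THEN part_in_carrier]]
      by (rule imageI[OF part_mult[OF xy(1,2)]])
  next
    fix i show "\<zero>\<^bsub>?Q\<^esub> \<in> part ?Q i" unfolding super_quot_ops using part_zero by blast
  qed (auto simp: super_quot_carrier super_quot_ops smult_closed mult_closed smult_l_distr smult_r_distr
      smult_assoc smult_one mult_add_left mult_add_right mult_smult_left mult_smult_right
      part_in_carrier intro!: imageI part_add part_smult)
qed

lemma coset_hom: "superalgebra_hom A (super_quot A I) (\<lambda>x. I +> x)"
  unfolding superalgebra_hom_def linear_map_def
  by (auto simp: super_quot_carrier super_quot_ops)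

lemma coset_zero_iff: "x \<in> carrier A \<Longrightarrow> I +> x = \<zero>\<^bsub>super_quot A I\<^esub> \<longleftrightarrow> x \<in> I"
  unfolding super_quot_ops by (simp add: coset_eq_iff minus_eq_smult smult_zero)

end

end

text \<open>From here on a presented algebra is handled as the target of a surjective homomorphism
  with known kernel, not as a set of cosets.\<close>

lemma
  assumes "S \<subseteq> carrier (Lbs X)"
  shows super_ideal_Lbs_Id: "super_ideal (Lbs X) (super_Id (Lbs X) S)"
    and leibniz_superalgebra_Lbs_rel: "leibniz_superalgebra (Lbs_rel X S)"
    and Lbs_class_hom: "superalgebra_hom (Lbs X) (Lbs_rel X S) (Lbs_class X S)"
    and Lbs_class_surj: "Lbs_class X S ` carrier (Lbs X) = carrier (Lbs_rel X S)"
    and Lbs_class_zero_iff: "f \<in> carrier (Lbs X) \<Longrightarrow>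
      Lbs_class X S f = \<zero>\<^bsub>Lbs_rel X S\<^esub> \<longleftrightarrow> f \<in> super_Id (Lbs X) S"
proof -
  interpret leibniz_superalgebra "Lbs X" by (rule leibniz_superalgebra_Lbs)
  show *: "super_ideal (Lbs X) (super_Id (Lbs X) S)"
    using assms by (rule super_ideal_super_Id)
  have cls: "Lbs_class X S = (\<lambda>f. super_Id (Lbs X) S +>\<^bsub>Lbs X\<^esub> f)"
    by (simp add: Lbs_class_def fun_eq_iff)
  show "leibniz_superalgebra (Lbs_rel X S)"
    unfolding Lbs_rel_def by (rule leibniz_superalgebra_super_quot[OF *])
  show "superalgebra_hom (Lbs X) (Lbs_rel X S) (Lbs_class X S)"
    unfolding Lbs_rel_def cls by (rule coset_hom[OF *])
  show "Lbs_class X S ` carrier (Lbs X) = carrier (Lbs_rel X S)"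
    unfolding Lbs_rel_def cls by (simp only: super_quot_carrier[OF *])
  show "f \<in> carrier (Lbs X) \<Longrightarrow> Lbs_class X S f = \<zero>\<^bsub>Lbs_rel X S\<^esub> \<longleftrightarrow> f \<in> super_Id (Lbs X) S"
    unfolding Lbs_rel_def cls by (rule coset_zero_iff[OF *])
qed

section \<open>Normal polynomials\<close>

lemma lin_ext_lin_ext: "lin_ext G (lin_ext F f) = lin_ext (\<lambda>w. lin_ext G (F w)) f"
  unfolding lin_ext_def[of F] lin_ext_def[of "\<lambda>w. lin_ext G (F w)"]
  by (simp add: lin_ext_sum lin_ext_pscale)

lemma lin_ext_nfmon [simp]: "lin_ext nfmon f = f"
  by (simp add: lin_ext_def sum_nfmon)

lemma lin_ext_cong: "(\<And>w. w \<in> keys f \<Longrightarrow> F w = G w) \<Longrightarrow> lin_ext F f = lin_ext G f"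
  by (simp add: lin_ext_def)

lemma lookup_lin_ext_inj:
  assumes "inj F"
  shows "lookup (lin_ext (\<lambda>w. nfmon (F w)) f) (F w) = lookup f w"
proof -
  have "lookup (lin_ext (\<lambda>w. nfmon (F w)) f) (F w) = (\<Sum>v\<in>keys f. if v = w then lookup f v else 0)"
    unfolding lin_ext_def lookup_sum
    by (rule sum.cong) (auto simp: lookup_single when_def inj_eq[OF assms])
  also have "\<dots> = lookup f w"
    by (simp add: in_keys_iff)
  finally show ?thesis .
qed

lemma keys_lin_ext_inj:
  fixes f :: "'v \<Rightarrow>\<^sub>0 'k::field"
  assumes "inj F"
  shows "keys (lin_ext (\<lambda>w. nfmon (F w)) f) = F ` keys f"
proof
  show "keys (lin_ext (\<lambda>w. nfmon (F w)) f) \<subseteq> F ` keys f"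
    using keys_lin_ext[of "\<lambda>w. nfmon (F w) :: _ \<Rightarrow>\<^sub>0 'k" f] by auto
  show "F ` keys f \<subseteq> keys (lin_ext (\<lambda>w. nfmon (F w)) f)"
    by (auto simp: in_keys_iff lookup_lin_ext_inj[OF assms])
qed

lemma span_nfmon: "lb.span (nfmon ` W) = {f :: 'w list \<Rightarrow>\<^sub>0 'k::field. keys f \<subseteq> W}"
proof
  have "lb.subspace {f :: 'w list \<Rightarrow>\<^sub>0 'k. keys f \<subseteq> W}"
    by (intro lb.subspaceI) (simp_all add: keys_add_subset keys_pscale_subset)
  then show "lb.span (nfmon ` W) \<subseteq> {f :: 'w list \<Rightarrow>\<^sub>0 'k. keys f \<subseteq> W}"
    by (intro lb.span_minimal) auto
  show "{f :: 'w list \<Rightarrow>\<^sub>0 'k. keys f \<subseteq> W} \<subseteq> lb.span (nfmon ` W)"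
  proof
    fix f :: "'w list \<Rightarrow>\<^sub>0 'k" assume "f \<in> {f. keys f \<subseteq> W}"
    then have "keys f \<subseteq> W" by simp
    then show "f \<in> lb.span (nfmon ` W)"
      by (induction f rule: nfmon_induct) (auto intro: lb.span_zero lb.span_add lb.span_scale lb.span_base)
  qed
qed

lemma left_normed_snoc: "left_normed X f (gs @ [g]) = lb_mult X (left_normed X f gs) g"
  by (simp add: left_normed_def)

text \<open>Appending letters relabels the monomials injectively. Hence a normal polynomial has the
  same coefficients as \<open>s\<close>, and everything about its support and leading term can be
  read off from \<open>s\<close>.\<close>

lemma left_normed_gens: "left_normed X f (map gen c) = lin_ext (\<lambda>w. nfmon (w @ c)) f"
proof (induction c rule: rev_induct)
  case Nil
  show ?case by (simp add: left_normed_def)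
next
  case (snoc b c)
  then show ?case by (simp add: left_normed_snoc lb_mult_gen lin_ext_lin_ext)
qed

lemma keys_left_normed_gens: "keys (left_normed X f (map gen c)) = (\<lambda>w. w @ c) ` keys f"
  unfolding left_normed_gens by (rule keys_lin_ext_inj) (simp add: inj_def)

lemma lookup_left_normed_gens: "lookup (left_normed X f (map gen c)) (w @ c) = lookup f w"
  unfolding left_normed_gens by (rule lookup_lin_ext_inj) (simp add: inj_def)

lemma lb_leibniz_Lbs:
  assumes "y \<in> part (Lbs X) j" "z \<in> part (Lbs X) l"
  shows "lb_mult X x (lb_mult X y z) =
    lb_mult X (lb_mult X x y) z - ksign (l * j) *p lb_mult X (lb_mult X x z) y"
  by (rule lb_leibniz) (use assms in \<open>auto simp: NF_def\<close>)

lemma lb_mult_closed: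
  "f \<in> carrier (Lbs X) \<Longrightarrow> g \<in> carrier (Lbs X) \<Longrightarrow> lb_mult X f g \<in> carrier (Lbs X)"
  using superalgebra.mult_closed[OF leibniz_superalgebra.axioms(1)[OF leibniz_superalgebra_Lbs], of f X g]
  by simp

lemma nfmon_part: "w \<in> NF X \<Longrightarrow> nfmon w \<in> part (Lbs X) (parity X w)"
  by simp

lemma nfmon_snoc: "nfmon (v @ [b]) = lb_mult X (nfmon v) (gen b)"
  by (simp add: lb_mult_nfmon_gen)

subsection \<open>The monomial order\<close>

locale monomial_order =
  fixes X :: "bit \<Rightarrow> 'x set" and r :: "'x rel"
  assumes wo: "well_order_on (gset X) r"
begin

abbreviation less :: "'x list \<Rightarrow> 'x list \<Rightarrow> bool"  (infix \<open>\<prec>\<close> 50)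
  where "u \<prec> v \<equiv> (u, v) \<in> mono_less r"

lemma wf_mono_less: "wf (mono_less r)"
  using wo unfolding mono_less_def well_order_on_def by (intro wf_lenlex) simp

lemma less_irrefl: "\<not> u \<prec> u"
  using wf_mono_less by simp

lemma less_asym: "u \<prec> v \<Longrightarrow> \<not> v \<prec> u"
  using wf_mono_less by (rule wf_not_sym)

lemma less_trans: "u \<prec> v \<Longrightarrow> v \<prec> w \<Longrightarrow> u \<prec> w"
proof -
  have "trans (r - Id)"
    using wo by (intro trans_diff_Id)
      (auto simp: well_order_on_def linear_order_on_def partial_order_on_def preorder_on_def)
  then show "u \<prec> v \<Longrightarrow> v \<prec> w \<Longrightarrow> u \<prec> w"
    unfolding mono_less_def by (rule lenlex_trans[rotated 2])
qed

lemma less_total: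
  assumes "set u \<subseteq> gset X" "set v \<subseteq> gset X" "u \<noteq> v"
  shows "u \<prec> v \<or> v \<prec> u"
proof (cases "length u = length v")
  case True
  from this assms have "(u, v) \<in> lex (r - Id) \<or> (v, u) \<in> lex (r - Id)"
  proof (induction u v rule: list_induct2)
    case (Cons x xs y ys)
    have "total_on (gset X) r"
      using wo by (simp add: well_order_on_def linear_order_on_def)
    with Cons.prems have "x = y \<or> (x, y) \<in> r - Id \<or> (y, x) \<in> r - Id"
      by (auto simp: total_on_def)
    with Cons show ?case by auto
  qed simp
  with True show ?thesis by (simp add: mono_less_def lenlex_conv)
next
  case False
  then show ?thesis by (auto simp: mono_less_def lenlex_conv)
qed

lemma less_append: "u \<prec> v \<Longrightarrow> u @ c \<prec> v @ c"
  unfolding mono_less_def by (rule lenlex_append1) simp_all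

text \<open>Stated for an image so that one lemma yields both the leading monomial of a polynomial
  (with \<open>id\<close>) and the dominant term of a combination of normal polynomials (with the
  map to \<open>lead r s @ c\<close>).\<close>

lemma ex_max_image:
  assumes "finite S" "S \<noteq> {}" "\<And>p. p \<in> S \<Longrightarrow> set (F p) \<subseteq> gset X"
  shows "\<exists>p\<in>S. \<forall>q\<in>S. F q \<noteq> F p \<longrightarrow> F q \<prec> F p"
  using assms
proof (induction S rule: finite_ne_induct)
  case (insert q S)
  then obtain p where p: "p \<in> S" "\<forall>q\<in>S. F q \<noteq> F p \<longrightarrow> F q \<prec> F p" by auto
  consider "F q = F p" | "F q \<prec> F p" | "F p \<prec> F q"
    using less_total[of "F q" "F p"] insert.prems p(1) by auto
  then show ?case
  proof cases
    case 3
    then have "\<forall>q'\<in>insert q S. F q' \<noteq> F q \<longrightarrow> F q' \<prec> F q"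
      using p less_trans by (metis insert_iff)
    then show ?thesis by blast
  qed (use p in \<open>auto intro!: bexI[of _ p]\<close>)
qed simp

lemma lead_eqI:
  assumes "u \<in> keys f" "\<And>v. v \<in> keys f \<Longrightarrow> v \<noteq> u \<Longrightarrow> v \<prec> u"
  shows "lead r f = u"
  unfolding lead_def
proof (rule the_equality)
  show "u \<in> keys f \<and> (\<forall>v\<in>keys f. v \<noteq> u \<longrightarrow> v \<prec> u)" using assms by simp
  fix w assume "w \<in> keys f \<and> (\<forall>v\<in>keys f. v \<noteq> w \<longrightarrow> v \<prec> w)"
  then show "w = u" using assms(1) assms(2)[of w] less_asym[of u w] by auto
qed

lemma lead_props:
  assumes "f \<noteq> 0" "keys f \<subseteq> NF X"
  shows "lead r f \<in> keys f" "v \<in> keys f \<Longrightarrow> v \<noteq> lead r f \<Longrightarrow> v \<prec> lead r f"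
proof -
  from assms obtain u where u: "u \<in> keys f" "\<And>v. v \<in> keys f \<Longrightarrow> v \<noteq> u \<Longrightarrow> v \<prec> u"
    using ex_max_image[of "keys f" id] by (auto simp: NF_def subset_iff)
  then have "lead r f = u" by (rule lead_eqI)
  with u show "lead r f \<in> keys f" "v \<in> keys f \<Longrightarrow> v \<noteq> lead r f \<Longrightarrow> v \<prec> lead r f" by auto
qed

end

subsection \<open>The ideal of relations\<close>

locale reduced_relations = monomial_order B r for B :: "bit \<Rightarrow> 'b set" and r :: "'b rel" +
  fixes R :: "('b list \<Rightarrow>\<^sub>0 'k::field) set"
  assumes R_carrier: "R \<subseteq> carrier (Lbs B)"
    and reduced: "reduced_GS_basis B r R"
    and lead_length: "\<forall>f\<in>R. length (lead r f) > 1"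
begin

sublocale L: leibniz_superalgebra "Lbs B :: ('k, 'b list \<Rightarrow>\<^sub>0 'k) superalgebra"
  by (rule leibniz_superalgebra_Lbs)

abbreviation np :: "('b list \<Rightarrow>\<^sub>0 'k) \<Rightarrow> 'b list \<Rightarrow> ('b list \<Rightarrow>\<^sub>0 'k)"
  where "np s c \<equiv> left_normed B s (map gen c)"

text \<open>Normal polynomials are indexed by pairs, because the floor map needs \<open>s\<close>
  and \<open>c\<close> separately and not just their product.\<close>

definition D :: "(('b list \<Rightarrow>\<^sub>0 'k) \<times> 'b list) set"
  where "D = R \<times> lists (gset B)"

text \<open>A linear span, so that induction over normal polynomials is available;
  \<open>super_Id_R\<close> identifies it with the ideal generated by R.\<close>

definition IR :: "('b list \<Rightarrow>\<^sub>0 'k) set"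
  where "IR = lb.span ((\<lambda>(s, c). np s c) ` D)"

lemma D_iff: "(s, c) \<in> D \<longleftrightarrow> s \<in> R \<and> c \<in> lists (gset B)"
  by (simp add: D_def)

lemma GS: "GS_basis B r R"
  using reduced by (simp add: reduced_GS_basis_def)

lemma R_keys: "s \<in> R \<Longrightarrow> keys s \<subseteq> NF B"
  using R_carrier by auto

lemma R_monic: "s \<in> R \<Longrightarrow> s \<noteq> 0" "s \<in> R \<Longrightarrow> lookup s (lead r s) = 1"
  using GS by (auto simp: GS_basis_def monic_def)

lemma R_part: "s \<in> R \<Longrightarrow> \<exists>i. s \<in> part (Lbs B) i"
  using GS unfolding GS_basis_def by blast

lemma R_lead:
  assumes "s \<in> R"
  shows "lead r s \<in> keys s" "v \<in> keys s \<Longrightarrow> v \<noteq> lead r s \<Longrightarrow> v \<prec> lead r s"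
  using lead_props[OF R_monic(1)[OF assms] R_keys[OF assms]] by auto

lemma np_keys: "(s, c) \<in> D \<Longrightarrow> keys (np s c) \<subseteq> NF B"
  using R_keys[of s] unfolding keys_left_normed_gens by (fastforce simp: NF_def D_iff)

lemma np_carrier: "(s, c) \<in> D \<Longrightarrow> np s c \<in> carrier (Lbs B)"
  using np_keys by simp

lemma lead_np: "(s, c) \<in> D \<Longrightarrow> lead r (np s c) = lead r s @ c"
  by (rule lead_eqI) (use R_lead[of s] less_append in \<open>auto simp: keys_left_normed_gens D_iff\<close>)

lemma np_lower: "(s, c) \<in> D \<Longrightarrow> v \<in> keys (np s c) \<Longrightarrow> v \<noteq> lead r s @ c \<Longrightarrow> v \<prec> lead r s @ c"
  using R_lead[of s] less_append by (auto simp: keys_left_normed_gens D_iff)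

lemma np_lookup: "(s, c) \<in> D \<Longrightarrow> lookup (np s c) (lead r s @ c) = 1"
  by (simp add: lookup_left_normed_gens R_monic D_iff)

lemma lead_set: "(s, c) \<in> D \<Longrightarrow> set (lead r s @ c) \<subseteq> gset B"
  using R_lead(1)[of s] R_keys[of s] by (auto simp: D_iff NF_def)

lemma np_part: "s \<in> part (Lbs B) i \<Longrightarrow> c \<in> lists (gset B) \<Longrightarrow> np s c \<in> part (Lbs B) (i + parity B c)"
  unfolding Lbs_simps keys_left_normed_gens mem_Collect_eq
proof (rule image_subsetI)
  fix w assume s: "keys s \<subseteq> {w \<in> NF B. parity B w = i}" and c: "c \<in> lists (gset B)" and w: "w \<in> keys s"
  have "w \<in> NF B" "parity B w = i" using s w by auto
  moreover from this have "w @ c \<in> NF B" using c by (auto simp: NF_def)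
  ultimately show "w @ c \<in> {w \<in> NF B. parity B w = i + parity B c}"
    unfolding mem_Collect_eq parity_append by metis
qed

lemma np_snoc: "np s (c @ [b]) = lb_mult B (np s c) (gen b)"
  by (simp add: left_normed_snoc)

text \<open>Normal polynomials of the second kind require a leading monomial of length 1, which
  \<open>lead_length\<close> excludes.\<close>

lemma normal_polys_R: "s \<in> R \<Longrightarrow> normal_polys B r s = np s ` lists (gset B)"
  using lead_length by (auto simp: normal_polys_def)

lemma Irr_iff: "w \<in> Irr B r R \<longleftrightarrow> w \<in> NF B \<and> (\<forall>(s, c)\<in>D. w \<noteq> lead r s @ c)"
  by (simp add: Irr_def normal_polys_R D_def lead_np[unfolded D_def])

text \<open>Otherwise \<open>lead r s\<close> would be the leading word of a normal polynomial of
  another element \<open>s'\<close>, whereas reducedness puts it into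
  \<open>Irr B r (R - {s})\<close>.\<close>

lemma lead_prefix:
  assumes "s \<in> R" "s' \<in> R" "lead r s = lead r s' @ us"
  shows "s = s'"
proof (rule ccontr)
  assume "s \<noteq> s'"
  have us: "(s', us) \<in> D"
    using lead_set[of s "[]"] assms by (auto simp: D_iff)
  then have "np s' us \<in> normal_polys B r s'"
    using normal_polys_R by (auto simp: D_iff)
  moreover have "lead r s \<in> Irr B r (R - {s})"
    using assms(1) R_lead(1) reduced by (auto simp: reduced_GS_basis_def)
  ultimately show False
    using \<open>s \<noteq> s'\<close> assms lead_np[OF us] unfolding Irr_def by force
qed

text \<open>Distinct normal polynomials have distinct leading monomials, so they form a basis of the ideal.\<close>

lemma lead_inj:
  assumes "(s, c) \<in> D" "(s', c') \<in> D" "lead r s @ c = lead r s' @ c'"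
  shows "s = s' \<and> c = c'"
proof -
  \<comment> \<open>If two concatenations agree, one of the two leading words is a prefix of the
    other, so \<open>lead_prefix\<close> applies in one of its two orientations.\<close>
  have "s = s'"
    using assms lead_prefix[of s s'] lead_prefix[of s' s]
    unfolding append_eq_append_conv2 D_iff by metis
  with assms show ?thesis by simp
qed

text \<open>Formal combinations of index pairs are kept apart from their values: injectivity of
  \<open>hsum\<close> on those supported in \<open>D\<close> is the linear independence of the
  normal polynomials, and it allows a map given on pairs to be extended to
  \<open>IR\<close>.\<close>

definition hsum :: "(('b list \<Rightarrow>\<^sub>0 'k) \<times> 'b list \<Rightarrow>\<^sub>0 'k) \<Rightarrow> ('b list \<Rightarrow>\<^sub>0 'k)"
  where "hsum \<phi> = lin_ext (\<lambda>(s, c). np s c) \<phi>"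

text \<open>Take the pair whose word \<open>lead r s @ c\<close> is largest. By
  \<open>lead_inj\<close> every other pair in the support has a strictly smaller leading word, so
  nothing can cancel at this word.\<close>

lemma hsum_lead:
  assumes "keys \<phi> \<subseteq> D" "\<phi> \<noteq> 0"
  shows "\<exists>(s, c)\<in>keys \<phi>. lookup (hsum \<phi>) (lead r s @ c) = lookup \<phi> (s, c) \<and>
    (\<forall>v\<in>keys (hsum \<phi>). v \<noteq> lead r s @ c \<longrightarrow> v \<prec> lead r s @ c)"
proof -
  let ?F = "\<lambda>(s, c). lead r s @ c"
  have "\<exists>p\<in>keys \<phi>. \<forall>q\<in>keys \<phi>. ?F q \<noteq> ?F p \<longrightarrow> ?F q \<prec> ?F p"
  proof (rule ex_max_image)
    fix p assume "p \<in> keys \<phi>"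
    then have "(fst p, snd p) \<in> D" using assms(1) by auto
    from lead_set[OF this] show "set (?F p) \<subseteq> gset B" by (simp add: case_prod_beta)
  qed (use assms(2) in auto)
  then obtain s c where sc: "(s, c) \<in> keys \<phi>" "(s, c) \<in> D"
    and max: "\<And>q. q \<in> keys \<phi> \<Longrightarrow> ?F q \<noteq> lead r s @ c \<Longrightarrow> ?F q \<prec> lead r s @ c"
    using assms(1) by fastforce
  have lower: "?F q \<prec> lead r s @ c" if "q \<in> keys \<phi>" "q \<noteq> (s, c)" for q
    using that max[of q] lead_inj[of "fst q" "snd q" s c] sc(2) assms(1) by (cases q) auto
  have less: "v \<prec> lead r s @ c" if "q \<in> keys \<phi>" "q \<noteq> (s, c)" "v \<in> keys (case q of (s, c) \<Rightarrow> np s c)" for q v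
    using lower[OF that(1,2)] np_lower[of "fst q" "snd q" v] that assms(1)
    by (cases q) (auto intro: less_trans)
  have "lookup (hsum \<phi>) (lead r s @ c) = (\<Sum>q\<in>keys \<phi>. if q = (s, c) then lookup \<phi> q else 0)"
    unfolding hsum_def lin_ext_def lookup_sum
  proof (rule sum.cong)
    fix q assume q: "q \<in> keys \<phi>"
    show "lookup (lookup \<phi> q *p (case q of (s, c) \<Rightarrow> np s c)) (lead r s @ c) = (if q = (s, c) then lookup \<phi> q else 0)"
    proof (cases "q = (s, c)")
      case False
      then have "lead r s @ c \<notin> keys (case q of (s, c) \<Rightarrow> np s c)"
        using less[OF q False] less_irrefl by blast
      with False show ?thesis by (simp add: in_keys_iff)
    qed (simp add: np_lookup[OF sc(2)])
  qed simp
  then have "lookup (hsum \<phi>) (lead r s @ c) = lookup \<phi> (s, c)"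
    using sc by simp
  moreover have "v \<prec> lead r s @ c" if v: "v \<in> keys (hsum \<phi>)" "v \<noteq> lead r s @ c" for v
  proof -
    obtain q where q: "q \<in> keys \<phi>" "v \<in> keys (case q of (s, c) \<Rightarrow> np s c)"
      using v(1) keys_lin_ext[of "\<lambda>(s, c). np s c" \<phi>] unfolding hsum_def by auto
    show ?thesis
      by (cases "q = (s, c)") (use q v(2) less np_lower[OF sc(2)] in auto)
  qed
  ultimately show ?thesis using sc(1) by (intro bexI[of _ "(s, c)"]) auto
qed

lemma hsum_zero_iff:
  assumes "keys \<phi> \<subseteq> D"
  shows "hsum \<phi> = 0 \<longleftrightarrow> \<phi> = 0"
proof
  assume "hsum \<phi> = 0"
  then show "\<phi> = 0"
    using hsum_lead[OF assms] by (force simp: in_keys_iff)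
qed (simp add: hsum_def)

lemma hsum_inj:
  assumes "keys \<phi> \<subseteq> D" "keys \<psi> \<subseteq> D" "hsum \<phi> = hsum \<psi>"
  shows "\<phi> = \<psi>"
proof -
  have "hsum (\<phi> - \<psi>) = 0"
    using assms(3) by (simp add: hsum_def lin_ext_diff)
  moreover have "keys (\<phi> - \<psi>) \<subseteq> D"
    using keys_minus_subset[of \<phi> \<psi>] assms by blast
  ultimately show ?thesis
    using hsum_zero_iff[of "\<phi> - \<psi>"] by simp
qed

lemma IR_hsum: "IR = hsum ` {\<phi>. keys \<phi> \<subseteq> D}"
proof
  show "hsum ` {\<phi>. keys \<phi> \<subseteq> D} \<subseteq> IR"
  proof safe
    fix \<phi> :: "('b list \<Rightarrow>\<^sub>0 'k) \<times> 'b list \<Rightarrow>\<^sub>0 'k" assume "keys \<phi> \<subseteq> D"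
    then show "hsum \<phi> \<in> IR"
      unfolding IR_def hsum_def lin_ext_def by (intro lb.span_sum lb.span_scale lb.span_base imageI) auto
  qed
  have "lb.subspace (hsum ` {\<phi>. keys \<phi> \<subseteq> D})"
  proof (rule lb.subspaceI)
    show "0 \<in> hsum ` {\<phi>. keys \<phi> \<subseteq> D}"
      by (rule image_eqI[of _ _ 0]) (auto simp: hsum_def)
    fix x y :: "'b list \<Rightarrow>\<^sub>0 'k" and c :: 'k
    assume "x \<in> hsum ` {\<phi>. keys \<phi> \<subseteq> D}"
    then obtain \<phi> where \<phi>: "x = hsum \<phi>" "keys \<phi> \<subseteq> D" by auto
    show "c *p x \<in> hsum ` {\<phi>. keys \<phi> \<subseteq> D}"
      using \<phi> by (intro image_eqI[of _ _ "c *p \<phi>"]) (simp_all add: hsum_def lin_ext_pscale keys_pscale_subset)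
    assume "y \<in> hsum ` {\<phi>. keys \<phi> \<subseteq> D}"
    then obtain \<psi> where \<psi>: "y = hsum \<psi>" "keys \<psi> \<subseteq> D" by auto
    show "x + y \<in> hsum ` {\<phi>. keys \<phi> \<subseteq> D}"
      using \<phi> \<psi> keys_add_subset[of \<phi> D \<psi>] by (intro image_eqI[of _ _ "\<phi> + \<psi>"]) (auto simp: hsum_def lin_ext_add)
  qed
  moreover have "(\<lambda>(s, c). np s c) ` D \<subseteq> hsum ` {\<phi>. keys \<phi> \<subseteq> D}"
  proof safe
    fix s c assume "(s, c) \<in> D"
    then show "np s c \<in> hsum ` {\<phi>. keys \<phi> \<subseteq> D}"
      by (intro image_eqI[of _ _ "Poly_Mapping.single (s, c) 1"]) (auto simp: hsum_def)
  qed
  ultimately show "IR \<subseteq> hsum ` {\<phi>. keys \<phi> \<subseteq> D}"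
    unfolding IR_def by (intro lb.span_minimal)
qed

lemma IR_induct [consumes 1, case_names zero step]:
  assumes "h \<in> IR" "P 0"
    "\<And>\<alpha> s c h. (s, c) \<in> D \<Longrightarrow> h \<in> IR \<Longrightarrow> P h \<Longrightarrow> P (\<alpha> *p np s c + h)"
  shows "P h"
proof -
  have "P h \<and> h \<in> IR"
    using assms(1)[unfolded IR_def]
  proof (induction h rule: lb.span_induct_alt)
    case (step \<alpha> x y)
    then obtain s c where "(s, c) \<in> D" "x = np s c" by auto
    with step assms(3) show ?case
      unfolding IR_def by (auto intro!: lb.span_add lb.span_scale intro: lb.span_base)
  qed (use assms(2) in \<open>auto simp: IR_def intro: lb.span_zero\<close>)
  then show ?thesis by simp
qed

lemma IR_np: "(s, c) \<in> D \<Longrightarrow> np s c \<in> IR"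
  unfolding IR_def by (auto intro: lb.span_base)

lemma IR_subspace: "0 \<in> IR" "g \<in> IR \<Longrightarrow> h \<in> IR \<Longrightarrow> g + h \<in> IR" "h \<in> IR \<Longrightarrow> \<alpha> *p h \<in> IR"
  "g \<in> IR \<Longrightarrow> h \<in> IR \<Longrightarrow> g - h \<in> IR"
  unfolding IR_def by (auto intro: lb.span_zero lb.span_add lb.span_scale lb.span_diff)

lemma IR_carrier: "h \<in> IR \<Longrightarrow> h \<in> carrier (Lbs B)"
proof (induction h rule: IR_induct)
  case (step \<alpha> s c h)
  then show ?case
    using np_keys[of s c] by (simp add: keys_add_subset keys_pscale_subset)
qed simp

lemma R_subset_IR: "R \<subseteq> IR"
  using IR_np[of _ "[]"] by (auto simp: D_iff left_normed_def)

section \<open>Closure of the span of the normal polynomials under multiplication\<close>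

lemma IR_mult_gen: "h \<in> IR \<Longrightarrow> b \<in> gset B \<Longrightarrow> lb_mult B h (gen b) \<in> IR"
proof (induction h rule: IR_induct)
  case (step \<alpha> s c h)
  then have "np s (c @ [b]) \<in> IR" by (intro IR_np) (auto simp: D_iff)
  with step show ?case
    unfolding lb_mult_linear np_snoc by (intro IR_subspace)
qed (simp add: IR_subspace)

text \<open>The identity h(vb) = (hv)b -+ (hb)v shortens the word but replaces h by hb; the
  induction therefore runs over all \<open>h\<close> in \<open>IR\<close> at once.\<close>

lemma IR_mult_nfmon:
  assumes "v \<noteq> []" "v \<in> NF B" "h \<in> IR"
  shows "lb_mult B h (nfmon v) \<in> IR"
  using assms
proof (induction v arbitrary: h rule: rev_nonempty_induct)
  case (single b)
  then show ?case by (intro IR_mult_gen) (auto simp: NF_def)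
next
  case (snoc b v)
  then have v: "v \<in> NF B" "b \<in> gset B" "[b] \<in> NF B" by (auto simp: NF_def)
  show ?case
    unfolding nfmon_snoc[of v b B] lb_leibniz_Lbs[OF nfmon_part[OF v(1)] nfmon_part[OF v(3)]]
    using snoc v by (intro IR_subspace IR_mult_gen snoc.IH)
qed

text \<open>With x = \<open>np s c\<close>, the identity u(xb) = (ux)b -+ (ub)x removes the last
  letter of \<open>c\<close> and moves it to \<open>u\<close>. What remains at the bottom is a word
  times an element of R, the case covered by the second Groebner-Shirshov condition.\<close>

lemma nfmon_mult_np:
  assumes "u \<in> NF B" "s \<in> R" "c \<in> lists (gset B)"
  shows "lb_mult B (nfmon u) (np s c) \<in> IR"
  using assms
proof (induction c arbitrary: u rule: rev_induct)
  case Nil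
  show ?case
  proof (cases "lb_mult B (nfmon u) s = 0")
    case True
    then show ?thesis by (simp add: left_normed_def IR_subspace)
  next
    case False
    \<comment> \<open>The condition speaks of nonzero products only, hence the case distinction; its
      requirement on the length of the leading monomial is \<open>lead_length\<close>.\<close>
    then have "trivial_deg B r R (length u + length (lead r s)) (lb_mult B (nfmon u) s)"
      using GS lead_length Nil by (auto simp: GS_basis_def)
    moreover have "lb.span {h. \<exists>s\<in>R. h \<in> normal_polys B r s \<and> length (lead r h) \<le> n} \<subseteq> IR" for n
      unfolding IR_def by (rule lb.span_mono) (auto simp: normal_polys_R D_iff)
    ultimately show ?thesis by (auto simp: trivial_deg_def left_normed_def)
  qed
next
  case (snoc b c)
  then have b: "b \<in> gset B" "[b] \<in> NF B" "c \<in> lists (gset B)" "u @ [b] \<in> NF B" by (auto simp: NF_def)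
  obtain i where "s \<in> part (Lbs B) i" using R_part snoc by blast
  from np_part[OF this b(3)] have p: "np s c \<in> part (Lbs B) (i + parity B c)" .
  show ?case
    unfolding np_snoc lb_leibniz_Lbs[OF p nfmon_part[OF b(2)]] lb_mult_nfmon_gen
    using snoc b by (intro IR_subspace IR_mult_gen snoc.IH)
qed

lemma IR_mult_right: "h \<in> IR \<Longrightarrow> f \<in> carrier (Lbs B) \<Longrightarrow> lb_mult B h f \<in> IR"
proof -
  assume h: "h \<in> IR" and "f \<in> carrier (Lbs B)"
  then have "keys f \<subseteq> NF B" by simp
  then show "lb_mult B h f \<in> IR"
  proof (induction f rule: nfmon_induct)
    case (nfmon w c)
    with h IR_mult_nfmon[of w h] show ?case by (auto simp: lb_mult_linear NF_def intro: IR_subspace)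
  qed (auto simp: lb_mult_linear intro: IR_subspace)
qed

lemma IR_mult_left: "h \<in> IR \<Longrightarrow> f \<in> carrier (Lbs B) \<Longrightarrow> lb_mult B f h \<in> IR"
proof (induction h rule: IR_induct)
  case (step \<alpha> s c h)
  then have "keys f \<subseteq> NF B" by simp
  moreover have "s \<in> R" "c \<in> lists (gset B)" using step(1) by (simp_all only: D_iff)
  ultimately have "lb_mult B f (np s c) \<in> IR"
    by (induction f rule: nfmon_induct)
      (simp_all only: lb_mult_linear lb_mult_zero_left IR_subspace nfmon_mult_np)
  with step show ?case by (auto simp: lb_mult_linear intro: IR_subspace)
qed (simp add: IR_subspace)

lemma IR_graded: "h \<in> IR \<Longrightarrow> L.graded_sum IR h"
proof (induction h rule: IR_induct)
  case zero
  show ?case using L.graded_sum_zero[of IR] by (simp add: IR_subspace)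
next
  case (step \<alpha> s c h)
  then obtain i where "s \<in> part (Lbs B) i" using R_part by (auto simp only: D_iff)
  with step have "np s c \<in> part (Lbs B) (i + parity B c)" by (intro np_part) (simp_all only: D_iff)
  from L.graded_sum_add[OF _ _ L.part_smult[OF this] step(3), of \<alpha>] step(1) show ?case
    by (simp add: IR_subspace IR_np)
qed

lemma super_ideal_IR: "super_ideal (Lbs B) IR"
  unfolding super_ideal_def
proof (intro conjI ballI allI impI)
  fix x y :: "'b list \<Rightarrow>\<^sub>0 'k"
  assume "x \<in> part (Lbs B) 0" "y \<in> part (Lbs B) 1" "x \<oplus>\<^bsub>Lbs B\<^esub> y \<in> IR"
  then show "x \<in> IR" "y \<in> IR"
    using L.graded_sum_components[of x y IR] IR_graded by blast+
qed (use IR_carrier IR_subspace IR_mult_right IR_mult_left in auto)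

text \<open>The span is itself a graded ideal containing R, so minimality gives one inclusion;
  conversely a normal polynomial is obtained from an element of R by right multiplications.\<close>

lemma super_Id_R: "super_Id (Lbs B) R = IR"
proof
  show "super_Id (Lbs B) R \<subseteq> IR"
    by (rule super_Id_least[OF super_ideal_IR R_subset_IR])
  note I = super_idealD[OF super_ideal_Lbs_Id[OF R_carrier]]
  have np: "np s c \<in> super_Id (Lbs B) R" if "s \<in> R" "c \<in> lists (gset B)" for s c
    using that(2)
  proof (induction c rule: rev_induct)
    case Nil
    then show ?case using that(1) super_Id_superset[of R "Lbs B"] by (auto simp: left_normed_def)
  next
    case (snoc b c)
    then show ?case
      unfolding np_snoc using I(5)[of "np s c" "gen b"] by (auto simp: NF_def)
  qed
  show "IR \<subseteq> super_Id (Lbs B) R"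
  proof
    fix h assume "h \<in> IR"
    then show "h \<in> super_Id (Lbs B) R"
    proof (induction h rule: IR_induct)
      case (step \<alpha> s c h)
      then show ?case using I(3)[of "\<alpha> *p np s c" h] I(4)[of "np s c" \<alpha>] np by (auto simp: D_iff)
    qed (use I(2) in simp)
  qed
qed

section \<open>Irreducible words span a complement of the ideal\<close>

lemma IR_lead:
  assumes "h \<in> IR" "h \<noteq> 0"
  obtains s c where "(s, c) \<in> D" "lead r h = lead r s @ c"
proof -
  obtain \<phi> where \<phi>: "h = hsum \<phi>" "keys \<phi> \<subseteq> D" using assms(1) by (auto simp: IR_hsum)
  with assms have "\<phi> \<noteq> 0" using hsum_zero_iff by auto
  from hsum_lead[OF \<phi>(2) this] obtain s c where sc: "(s, c) \<in> keys \<phi>"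
    "lookup h (lead r s @ c) = lookup \<phi> (s, c)" "\<forall>v\<in>keys h. v \<noteq> lead r s @ c \<longrightarrow> v \<prec> lead r s @ c"
    using \<phi> by auto
  then have "lead r h = lead r s @ c" by (intro lead_eqI) (auto simp: in_keys_iff)
  with sc \<phi> that show thesis by blast
qed

text \<open>The leading word of a nonzero element of the ideal has the form
  \<open>lead r s @ c\<close>, and no irreducible word has it. Together with \<open>reduce\<close>
  this says that the irreducible words represent a basis of the quotient.\<close>

lemma Irr_IR_zero:
  assumes "keys h \<subseteq> Irr B r R" "h \<in> IR"
  shows "h = 0"
proof (rule ccontr)
  assume h: "h \<noteq> 0"
  then obtain s c where "(s, c) \<in> D" "lead r h = lead r s @ c" using IR_lead assms by blast
  moreover have "lead r h \<in> keys h" using lead_props(1)[OF h] IR_carrier[OF assms(2)] by simp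
  ultimately show False using assms(1) Irr_iff by fastforce
qed

text \<open>A reducible word equals some \<open>lead r s @ c\<close>; subtracting the monic
  polynomial \<open>np s c\<close> removes it and leaves smaller words only, so well-founded
  induction on the monomial order applies.\<close>

lemma nfmon_reduce: "w \<in> NF B \<Longrightarrow> \<exists>d. keys d \<subseteq> Irr B r R \<and> nfmon w - d \<in> IR"
proof -
  let ?U = "lb.span (nfmon ` Irr B r R \<union> (\<lambda>(s, c). np s c) ` D)"
  assume "w \<in> NF B"
  then have "nfmon w \<in> ?U"
  proof (induction w rule: wf_induct_rule[OF wf_mono_less])
    case (1 w)
    show ?case
    proof (cases "w \<in> Irr B r R")
      case False
      with 1 obtain s c where sc: "(s, c) \<in> D" "w = lead r s @ c" by (auto simp: Irr_iff)
      let ?g = "nfmon w - np s c"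
      have keys: "v \<in> NF B \<and> v \<prec> w" if "v \<in> keys ?g" for v
      proof -
        have "v \<noteq> w"
          using that np_lookup[OF sc(1)] sc(2) by (auto simp: in_keys_iff lookup_minus)
        with that have "v \<in> keys (np s c)"
          by (auto simp: in_keys_iff lookup_minus lookup_single)
        with \<open>v \<noteq> w\<close> show ?thesis
          using np_keys[OF sc(1)] np_lower[OF sc(1)] sc(2) by blast
      qed
      have "?g \<in> ?U"
        by (subst sum_nfmon[symmetric], intro lb.span_sum lb.span_scale) (use 1 keys in blast)
      moreover have "np s c \<in> ?U" using sc(1) by (auto intro: lb.span_base)
      ultimately have "?g + np s c \<in> ?U" by (rule lb.span_add)
      then show ?thesis by simp
    qed (auto intro: lb.span_base)
  qed
  then obtain d h where "nfmon w = d + h" "d \<in> lb.span (nfmon ` Irr B r R)" "h \<in> IR"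
    unfolding lb.span_Un IR_def by auto
  then show ?thesis unfolding span_nfmon by (intro exI[of _ d]) auto
qed

lemma reduce:
  assumes "f \<in> carrier (Lbs B)"
  obtains d where "keys d \<subseteq> Irr B r R" "f - d \<in> IR"
proof -
  have "keys f \<subseteq> NF B" using assms by simp
  then have "\<exists>d. keys d \<subseteq> Irr B r R \<and> f - d \<in> IR"
  proof (induction f rule: nfmon_induct)
    case zero
    show ?case by (intro exI[of _ 0]) (simp add: IR_subspace)
  next
    case (nfmon w c)
    then obtain d where "keys d \<subseteq> Irr B r R" "nfmon w - d \<in> IR" using nfmon_reduce by blast
    then show ?case
      using IR_subspace(3)[of "nfmon w - d" c]
      by (intro exI[of _ "c *p d"]) (auto simp: keys_pscale_subset lb.scale_right_diff_distrib)
  next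
    case (add f g)
    then obtain d e where "keys d \<subseteq> Irr B r R" "f - d \<in> IR" "keys e \<subseteq> Irr B r R" "g - e \<in> IR" by blast
    then show ?case
      using IR_subspace(2)[of "f - d" "g - e"]
      by (intro exI[of _ "d + e"]) (auto simp: keys_add_subset algebra_simps)
  qed
  with that show thesis by blast
qed

lemma Irr_NF: "Irr B r R \<subseteq> NF B"
  by (auto simp: Irr_def)

subsection \<open>Normal expressions\<close>

abbreviation expr_sum :: "('k \<times> ('b list \<Rightarrow>\<^sub>0 'k) \<times> 'b list) list \<Rightarrow> ('b list \<Rightarrow>\<^sub>0 'k)"
  where "expr_sum ts \<equiv> (\<Sum>(\<alpha>, s, c)\<leftarrow>ts. \<alpha> *p np s c)"

text \<open>The part of \<open>is_normal_expr\<close> that concerns the list alone, with leading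
  words written as \<open>lead r s @ c\<close>. Separating it from the value of the sum makes
  inductions on the list possible.\<close>

definition valid_terms :: "('k \<times> ('b list \<Rightarrow>\<^sub>0 'k) \<times> 'b list) list \<Rightarrow> bool"
  where "valid_terms ts \<longleftrightarrow> (\<forall>(\<alpha>, s, c)\<in>set ts. \<alpha> \<noteq> 0 \<and> (s, c) \<in> D) \<and>
    sorted_wrt (\<lambda>u v. v \<prec> u) (map (\<lambda>(\<alpha>, s, c). lead r s @ c) ts)"

lemma expr_sum_IR: "\<forall>(\<alpha>, s, c)\<in>set ts. (s, c) \<in> D \<Longrightarrow> expr_sum ts \<in> IR"
  by (induction ts) (auto intro!: IR_subspace IR_np)

lemma keys_expr_sum:
  assumes "\<forall>(\<alpha>, s, c)\<in>set ts. (s, c) \<in> D" "v \<in> keys (expr_sum ts)"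
  shows "\<exists>(\<alpha>, s, c)\<in>set ts. v = lead r s @ c \<or> v \<prec> lead r s @ c"
  using assms
proof (induction ts)
  case (Cons t ts)
  obtain \<alpha> s c where t: "t = (\<alpha>, s, c)" by (cases t)
  from Cons.prems have "v \<in> keys (np s c) \<or> v \<in> keys (expr_sum ts)"
    unfolding t using Poly_Mapping.keys_add[of "\<alpha> *p np s c" "expr_sum ts"] keys_pscale[of \<alpha> "np s c"] by auto
  with Cons t np_lower[of s c v] show ?case by auto
qed simp

lemma valid_terms_Cons:
  assumes "valid_terms ((\<alpha>, s, c) # ts)"
  shows "lookup (expr_sum ((\<alpha>, s, c) # ts)) (lead r s @ c) = \<alpha>"
    "v \<in> keys (expr_sum ((\<alpha>, s, c) # ts)) \<Longrightarrow> v \<noteq> lead r s @ c \<Longrightarrow> v \<prec> lead r s @ c"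
proof -
  have sc: "(s, c) \<in> D" and ts: "\<forall>(\<alpha>, s, c)\<in>set ts. (s, c) \<in> D"
    and sorted: "\<forall>(\<alpha>', s', c')\<in>set ts. lead r s' @ c' \<prec> lead r s @ c"
    using assms by (auto simp: valid_terms_def)
  have lower: "v \<prec> lead r s @ c" if "v \<in> keys (expr_sum ts)" for v
    using keys_expr_sum[OF ts that] sorted less_trans by blast
  then have "lead r s @ c \<notin> keys (expr_sum ts)" using less_irrefl by blast
  then show "lookup (expr_sum ((\<alpha>, s, c) # ts)) (lead r s @ c) = \<alpha>"
    using np_lookup[OF sc] by (simp add: lookup_add in_keys_iff)
  assume "v \<in> keys (expr_sum ((\<alpha>, s, c) # ts))" "v \<noteq> lead r s @ c"
  then show "v \<prec> lead r s @ c"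
    using lower[of v] np_lower[OF sc, of v] keys_pscale[of \<alpha> "np s c"]
      Poly_Mapping.keys_add[of "\<alpha> *p np s c" "expr_sum ts"] by auto
qed

lemma valid_terms_lead:
  assumes "valid_terms ((\<alpha>, s, c) # ts)"
  shows "expr_sum ((\<alpha>, s, c) # ts) \<noteq> 0" "lead r (expr_sum ((\<alpha>, s, c) # ts)) = lead r s @ c"
proof -
  have "\<alpha> \<noteq> 0" using assms by (simp add: valid_terms_def)
  with valid_terms_Cons[OF assms] have "lead r s @ c \<in> keys (expr_sum ((\<alpha>, s, c) # ts))"
    by (simp add: in_keys_iff)
  with valid_terms_Cons(2)[OF assms]
  show "expr_sum ((\<alpha>, s, c) # ts) \<noteq> 0" "lead r (expr_sum ((\<alpha>, s, c) # ts)) = lead r s @ c"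
    by (auto intro!: lead_eqI)
qed

text \<open>The clause about the head of the list is automatic: leading words decrease strictly, so
  the first one cannot cancel and is the leading word of the whole sum.\<close>

lemma is_normal_expr_iff: "is_normal_expr B r R h ts \<longleftrightarrow> valid_terms ts \<and> h = expr_sum ts"
proof -
  let ?val = "\<forall>(\<alpha>, s, c)\<in>set ts. \<alpha> \<noteq> 0 \<and> s \<in> R \<and> c \<in> lists (gset B)"
  have "map (\<lambda>(\<alpha>, s, c). lead r (np s c)) ts = map (\<lambda>(\<alpha>, s, c). lead r s @ c) ts" if ?val
    by (rule map_cong) (use that in \<open>auto simp: D_iff intro!: lead_np\<close>)
  then have "valid_terms ts \<longleftrightarrow> ?val \<and>
      sorted_wrt (\<lambda>u v. v \<prec> u) (map (\<lambda>(\<alpha>, s, c). lead r (np s c)) ts)"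
    unfolding valid_terms_def D_iff by metis
  moreover have "if expr_sum ts = 0 then ts = []
      else \<exists>\<alpha> s c us. ts = (\<alpha>, s, c) # us \<and> lead r (np s c) = lead r (expr_sum ts)" if v: "valid_terms ts"
  proof (cases ts)
    case (Cons t us)
    obtain \<alpha> s c where t: "t = (\<alpha>, s, c)" by (cases t)
    have "(s, c) \<in> D" using v by (auto simp: valid_terms_def Cons t)
    with valid_terms_lead[of \<alpha> s c us] v show ?thesis
      unfolding Cons t by (simp add: lead_np)
  qed simp
  ultimately show ?thesis
    unfolding is_normal_expr_def by blast
qed

text \<open>The leading word of the sum determines the first pair by \<open>lead_inj\<close>, and
  the coefficient there determines the first scalar; after cancelling the first term the tails are
  compared.\<close>

lemma valid_terms_unique: "valid_terms ts \<Longrightarrow> valid_terms ts' \<Longrightarrow> expr_sum ts = expr_sum ts' \<Longrightarrow> ts = ts'"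
proof (induction ts arbitrary: ts')
  case Nil
  show ?case
  proof (cases ts')
    case (Cons t us)
    with Nil valid_terms_lead(1)[of "fst t" "fst (snd t)" "snd (snd t)" us] show ?thesis by simp
  qed simp
next
  case (Cons t us)
  obtain \<alpha> s c where t: "t = (\<alpha>, s, c)" by (cases t)
  note v = Cons.prems(1)[unfolded t]
  have "ts' \<noteq> []" using valid_terms_lead(1)[OF v] Cons.prems(3) t by auto
  then obtain \<alpha>' s' c' us' where ts': "ts' = (\<alpha>', s', c') # us'"
    by (metis list.exhaust prod_cases3)
  note v' = Cons.prems(2)[unfolded ts']
  have eq: "expr_sum ((\<alpha>, s, c) # us) = expr_sum ((\<alpha>', s', c') # us')"
    using Cons.prems(3) t ts' by simp
  have lead: "lead r s @ c = lead r s' @ c'"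
    using valid_terms_lead(2)[OF v] valid_terms_lead(2)[OF v'] eq by simp
  moreover have "(s, c) \<in> D" "(s', c') \<in> D" using v v' by (auto simp: valid_terms_def)
  ultimately have sc: "s = s'" "c = c'" using lead_inj by blast+
  moreover have "\<alpha> = \<alpha>'"
    using valid_terms_Cons(1)[OF v] valid_terms_Cons(1)[OF v'] eq lead by simp
  moreover have "us = us'"
    using Cons.IH[of us'] v v' eq sc \<open>\<alpha> = \<alpha>'\<close> by (auto simp: valid_terms_def)
  ultimately show ?case using t ts' by simp
qed

text \<open>Subtracting the matching normal polynomial, scaled by the leading coefficient, lowers
  the leading word; the induction is on that word.\<close>

lemma valid_terms_exist: "h \<in> IR \<Longrightarrow> \<exists>ts. valid_terms ts \<and> h = expr_sum ts"
proof (induction "lead r h" arbitrary: h rule: wf_induct_rule[OF wf_mono_less])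
  case 1
  show ?case
  proof (cases "h = 0")
    case True
    then show ?thesis by (intro exI[of _ "[]"]) (simp add: valid_terms_def)
  next
    case False
    obtain s c where sc: "(s, c) \<in> D" "lead r h = lead r s @ c" using IR_lead[OF 1(2) False] .
    define \<alpha> where "\<alpha> = lookup h (lead r h)"
    define h' where "h' = h - \<alpha> *p np s c"
    have keys_h: "keys h \<subseteq> NF B" using IR_carrier[OF 1(2)] by simp
    have \<alpha>: "\<alpha> \<noteq> 0" unfolding \<alpha>_def using lead_props(1)[OF False keys_h] by (simp add: in_keys_iff)
    have h': "h' \<in> IR" unfolding h'_def using 1 sc by (intro IR_subspace IR_np)
    have keys_h': "keys h' \<subseteq> NF B" using IR_carrier[OF h'] by simp
    have lower: "v \<prec> lead r h" if "v \<in> keys h'" for v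
    proof -
      have "v \<noteq> lead r h" using that np_lookup[OF sc(1)] sc(2) by (auto simp: h'_def in_keys_iff lookup_minus \<alpha>_def)
      moreover from that have "v \<in> keys h \<or> v \<in> keys (np s c)"
        by (auto simp: h'_def in_keys_iff lookup_minus)
      ultimately show ?thesis using lead_props(2)[OF False keys_h] np_lower[OF sc(1)] sc(2) by auto
    qed
    \<comment> \<open>The case \<open>h' = 0\<close> is separate because \<open>lead\<close> has no
      meaningful value at 0, so the induction hypothesis cannot be invoked there.\<close>
    obtain ts where ts: "valid_terms ts" "h' = expr_sum ts"
    proof (cases "h' = 0")
      case True
      then show thesis using that[of "[]"] by (simp add: valid_terms_def)
    next
      case h'0: False
      show thesis
        using 1(1)[OF lower[OF lead_props(1)[OF h'0 keys_h']] h'] that by blast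
    qed
    have "valid_terms ((\<alpha>, s, c) # ts)"
    proof (cases ts)
      case Nil
      then show ?thesis using \<alpha> sc by (simp add: valid_terms_def)
    next
      case (Cons t us)
      obtain \<beta> s' c' where t: "t = (\<beta>, s', c')" by (cases t)
      note v = ts(1)[unfolded Cons t]
      have "lead r s' @ c' \<in> keys h'"
        using lead_props(1)[OF valid_terms_lead(1)[OF v]] valid_terms_lead(2)[OF v] ts(2) keys_h'
        by (simp add: Cons t)
      then have "lead r s' @ c' \<prec> lead r s @ c" using lower sc(2) by simp
      with v \<alpha> sc show ?thesis unfolding Cons t by (auto simp: valid_terms_def intro: less_trans)
    qed
    moreover have "h = expr_sum ((\<alpha>, s, c) # ts)" using ts(2) by (simp add: h'_def algebra_simps)
    ultimately show ?thesis by blast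
  qed
qed

lemma normal_expr:
  assumes "h \<in> IR"
  shows "valid_terms (normal_expr B r R h)" "expr_sum (normal_expr B r R h) = h"
proof -
  have "\<exists>!ts. is_normal_expr B r R h ts"
    unfolding is_normal_expr_iff using valid_terms_exist[OF assms] valid_terms_unique by blast
  then have "is_normal_expr B r R h (normal_expr B r R h)"
    unfolding normal_expr_def by (rule theI')
  then show "valid_terms (normal_expr B r R h)" "expr_sum (normal_expr B r R h) = h"
    unfolding is_normal_expr_iff by auto
qed

end

section \<open>Semidirect products\<close>

text \<open>A pair (a, x) stands for the sum a + x; the product is the expansion of (a + x)(b + y),
  in which the mixed products are supplied by the two actions.\<close>

definition semidirect ::
  "('k::field, 'c, 'm) superalgebra_scheme \<Rightarrow> ('k, 'a, 'n) superalgebra_scheme \<Rightarrow>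
   ('c \<Rightarrow> 'a \<Rightarrow> 'a) \<Rightarrow> ('a \<Rightarrow> 'c \<Rightarrow> 'a) \<Rightarrow> ('k, 'a \<times> 'c) superalgebra"
  where "semidirect C A lact ract =
    \<lparr>carrier = carrier A \<times> carrier C,
     mult = (\<lambda>(a, x) (b, y). (a \<otimes>\<^bsub>A\<^esub> b \<oplus>\<^bsub>A\<^esub> ract a y \<oplus>\<^bsub>A\<^esub> lact x b, x \<otimes>\<^bsub>C\<^esub> y)),
     one = (\<zero>\<^bsub>A\<^esub>, \<zero>\<^bsub>C\<^esub>), zero = (\<zero>\<^bsub>A\<^esub>, \<zero>\<^bsub>C\<^esub>),
     add = (\<lambda>(a, x) (b, y). (a \<oplus>\<^bsub>A\<^esub> b, x \<oplus>\<^bsub>C\<^esub> y)), smult = (\<lambda>c (a, x). (c \<odot>\<^bsub>A\<^esub> a, c \<odot>\<^bsub>C\<^esub> x)),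
     part = (\<lambda>i. part A i \<times> part C i)\<rparr>"

lemma semidirect_simps [simp]:
  "carrier (semidirect C A lact ract) = carrier A \<times> carrier C"
  "(a, x) \<otimes>\<^bsub>semidirect C A lact ract\<^esub> (b, y) =
    (a \<otimes>\<^bsub>A\<^esub> b \<oplus>\<^bsub>A\<^esub> ract a y \<oplus>\<^bsub>A\<^esub> lact x b, x \<otimes>\<^bsub>C\<^esub> y)"
  "\<zero>\<^bsub>semidirect C A lact ract\<^esub> = (\<zero>\<^bsub>A\<^esub>, \<zero>\<^bsub>C\<^esub>)"
  "(a, x) \<oplus>\<^bsub>semidirect C A lact ract\<^esub> (b, y) = (a \<oplus>\<^bsub>A\<^esub> b, x \<oplus>\<^bsub>C\<^esub> y)"
  "c \<odot>\<^bsub>semidirect C A lact ract\<^esub> (a, x) = (c \<odot>\<^bsub>A\<^esub> a, c \<odot>\<^bsub>C\<^esub> x)"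
  "part (semidirect C A lact ract) i = part A i \<times> part C i"
  by (simp_all add: semidirect_def)

context leibniz_superalgebra
begin

lemma minus_smult: "t \<in> carrier A \<Longrightarrow> x \<in> carrier A \<Longrightarrow> t \<ominus> c \<odot> x = t \<oplus> (- c) \<odot> x"
  using smult_assoc[of x "-1" c] by (simp add: minus_eq_smult smult_closed)

text \<open>Signs square to 1, so a signed term can be isolated by applying the same sign once
  more.\<close>

lemma minus_ksign_cancel:
  assumes "t \<in> carrier A" "x \<in> carrier A" "y \<in> carrier A" "t \<ominus> ksign e \<odot> x = t \<ominus> ksign e \<odot> y"
  shows "x = y"
proof -
  have "(- ksign e) \<odot> x = (- ksign e) \<odot> y"
    using assms by (simp add: minus_smult smult_closed)
  then have "(- ksign e) \<odot> ((- ksign e) \<odot> x) = (- ksign e) \<odot> ((- ksign e) \<odot> y)" by simp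
  then show ?thesis
    using assms(2,3) by (simp add: smult_assoc[symmetric] ksign_mult_self smult_one)
qed

text \<open>Of the eight ways to draw the three factors from A or C, seven contribute to the
  A-component. Each contributes p - e q, with p and q the two left-normed products; the lemma
  regroups these seven differences into one difference of sums.\<close>

lemma leibniz_rearrange:
  assumes "p1 \<in> carrier A" "p2 \<in> carrier A" "p3 \<in> carrier A" "p4 \<in> carrier A"
    "p5 \<in> carrier A" "p6 \<in> carrier A" "p7 \<in> carrier A"
    "q1 \<in> carrier A" "q2 \<in> carrier A" "q3 \<in> carrier A" "q4 \<in> carrier A"
    "q5 \<in> carrier A" "q6 \<in> carrier A" "q7 \<in> carrier A"
  shows "((p1 \<ominus> e \<odot> q1) \<oplus> (p2 \<ominus> e \<odot> q2) \<oplus> (p3 \<ominus> e \<odot> q3)) \<oplus> (p4 \<ominus> e \<odot> q4) \<oplus>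
      ((p5 \<ominus> e \<odot> q5) \<oplus> (p6 \<ominus> e \<odot> q6) \<oplus> (p7 \<ominus> e \<odot> q7)) =
    ((p1 \<oplus> p3 \<oplus> p5) \<oplus> (p2 \<oplus> p4 \<oplus> p6) \<oplus> p7) \<ominus>
      e \<odot> ((q1 \<oplus> q2 \<oplus> q5) \<oplus> (q3 \<oplus> q4 \<oplus> q7) \<oplus> q6)"
  using assms by (simp add: minus_smult) (simp add: smult_r_distr smult_closed a_ac)

end

locale compatible_action = A: leibniz_superalgebra A + C: leibniz_superalgebra C
  for A :: "('k::field, 'a, 'n) superalgebra_scheme" (structure) and C :: "('k, 'c, 'm) superalgebra_scheme" +
  fixes lact :: "'c \<Rightarrow> 'a \<Rightarrow> 'a" and ract :: "'a \<Rightarrow> 'c \<Rightarrow> 'a"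
  assumes compatible: "compatible_supermodule C A lact ract"
begin

lemma action_linear:
  "x \<in> carrier C \<Longrightarrow> linear_map A A (lact x)" "f \<in> carrier A \<Longrightarrow> linear_map C A (\<lambda>x. lact x f)"
  "x \<in> carrier C \<Longrightarrow> linear_map A A (\<lambda>f. ract f x)" "f \<in> carrier A \<Longrightarrow> linear_map C A (ract f)"
  using compatible unfolding compatible_supermodule_def supermodule_def by auto

lemma action_closed:
  assumes "x \<in> carrier C" "f \<in> carrier A"
  shows "lact x f \<in> carrier A" "ract f x \<in> carrier A"
  using linear_mapD(1)[OF action_linear(1)[OF assms(1)]] linear_mapD(1)[OF action_linear(3)[OF assms(1)]] assms
  by auto

lemma action_add:
  "x \<in> carrier C \<Longrightarrow> f \<in> carrier A \<Longrightarrow> g \<in> carrier A \<Longrightarrow> lact x (f \<oplus> g) = lact x f \<oplus> lact x g"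
  "x \<in> carrier C \<Longrightarrow> y \<in> carrier C \<Longrightarrow> f \<in> carrier A \<Longrightarrow> lact (x \<oplus>\<^bsub>C\<^esub> y) f = lact x f \<oplus> lact y f"
  "x \<in> carrier C \<Longrightarrow> f \<in> carrier A \<Longrightarrow> g \<in> carrier A \<Longrightarrow> ract (f \<oplus> g) x = ract f x \<oplus> ract g x"
  "x \<in> carrier C \<Longrightarrow> y \<in> carrier C \<Longrightarrow> f \<in> carrier A \<Longrightarrow> ract f (x \<oplus>\<^bsub>C\<^esub> y) = ract f x \<oplus> ract f y"
  using action_linear[THEN linear_mapD(2)] by simp_all

lemma action_smult:
  "x \<in> carrier C \<Longrightarrow> f \<in> carrier A \<Longrightarrow> lact x (c \<odot> f) = c \<odot> lact x f"
  "x \<in> carrier C \<Longrightarrow> f \<in> carrier A \<Longrightarrow> lact (c \<odot>\<^bsub>C\<^esub> x) f = c \<odot> lact x f"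
  "x \<in> carrier C \<Longrightarrow> f \<in> carrier A \<Longrightarrow> ract (c \<odot> f) x = c \<odot> ract f x"
  "x \<in> carrier C \<Longrightarrow> f \<in> carrier A \<Longrightarrow> ract f (c \<odot>\<^bsub>C\<^esub> x) = c \<odot> ract f x"
  using action_linear[THEN linear_mapD(3)] by simp_all

lemma action_a_inv:
  "x \<in> carrier C \<Longrightarrow> f \<in> carrier A \<Longrightarrow> lact x (\<ominus> f) = \<ominus> lact x f"
  "x \<in> carrier C \<Longrightarrow> f \<in> carrier A \<Longrightarrow> ract (\<ominus> f) x = \<ominus> ract f x"
  using action_smult(1)[of x f "-1"] action_smult(3)[of x f "-1"]
  by (simp_all add: A.smult_minus_one action_closed)

lemma action_zero:
  "x \<in> carrier C \<Longrightarrow> lact x \<zero> = \<zero>" "f \<in> carrier A \<Longrightarrow> lact \<zero>\<^bsub>C\<^esub> f = \<zero>"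
  "x \<in> carrier C \<Longrightarrow> ract \<zero> x = \<zero>" "f \<in> carrier A \<Longrightarrow> ract f \<zero>\<^bsub>C\<^esub> = \<zero>"
  using action_smult(1)[of x "\<zero>" 0] action_smult(2)[of "\<zero>\<^bsub>C\<^esub>" f 0]
    action_smult(3)[of x "\<zero>" 0] action_smult(4)[of "\<zero>\<^bsub>C\<^esub>" f 0]
  by (simp_all add: A.zero_smult C.zero_smult action_closed)

lemma action_part:
  assumes "f \<in> part A i" "x \<in> part C j"
  shows "ract f x \<in> part A (i + j)" "lact x f \<in> part A (j + i)"
  using compatible assms unfolding compatible_supermodule_def supermodule_def by blast+

lemma action_leibniz:
  assumes "f \<in> part A l" "x \<in> part C i" "y \<in> part C j"
  shows "ract f (x \<otimes>\<^bsub>C\<^esub> y) = ract (ract f x) y \<ominus> ksign (i * j) \<odot> ract (ract f y) x"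
    "lact x (lact y f) = lact (x \<otimes>\<^bsub>C\<^esub> y) f \<ominus> ksign (l * j) \<odot> ract (lact x f) y"
    "lact x (ract f y) = ract (lact x f) y \<ominus> ksign (l * j) \<odot> lact (x \<otimes>\<^bsub>C\<^esub> y) f"
  using compatible assms unfolding compatible_supermodule_def supermodule_def by blast+

lemma action_compat:
  assumes "f \<in> part A l" "f' \<in> part A m" "x \<in> part C i"
  shows "lact x (f \<otimes> f') = lact x f \<otimes> f' \<ominus> ksign (l * m) \<odot> (lact x f' \<otimes> f)"
    "f \<otimes> ract f' x = ract (f \<otimes> f') x \<ominus> ksign (i * m) \<odot> (ract f x \<otimes> f')"
    "f \<otimes> lact x f' = ract f x \<otimes> f' \<ominus> ksign (i * m) \<odot> ract (f \<otimes> f') x"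
  using compatible assms unfolding compatible_supermodule_def by blast+

lemma abelian_group_semidirect: "abelian_group (semidirect C A lact ract)"
proof (rule abelian_groupI)
  fix p assume "p \<in> carrier (semidirect C A lact ract)"
  then obtain a x where "p = (a, x)" "a \<in> carrier A" "x \<in> carrier C" by auto
  then show "\<exists>q\<in>carrier (semidirect C A lact ract).
      q \<oplus>\<^bsub>semidirect C A lact ract\<^esub> p = \<zero>\<^bsub>semidirect C A lact ract\<^esub>"
    by (intro bexI[of _ "(\<ominus> a, \<ominus>\<^bsub>C\<^esub> x)"]) (auto simp: A.l_neg C.l_neg)
qed (auto simp: A.a_ac C.a_ac)

lemma semidirect_minus:
  assumes "a \<in> carrier A" "b \<in> carrier A" "x \<in> carrier C" "y \<in> carrier C"
  shows "(a, x) \<ominus>\<^bsub>semidirect C A lact ract\<^esub> (b, y) = (a \<ominus> b, x \<ominus>\<^bsub>C\<^esub> y)"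
proof -
  interpret P: abelian_group "semidirect C A lact ract" by (rule abelian_group_semidirect)
  have "\<ominus>\<^bsub>semidirect C A lact ract\<^esub> (b, y) = (\<ominus> b, \<ominus>\<^bsub>C\<^esub> y)"
    using assms by (intro P.minus_equality) (auto simp: A.l_neg C.l_neg)
  then show ?thesis by (simp add: a_minus_def)
qed

text \<open>Each of the seven mixed triples is one axiom: the Leibniz identity of A, the three
  supermodule identities when one factor is from A, and the three compatibility identities when two
  are.\<close>

lemma semidirect_leibniz:
  assumes a: "a \<in> part A i" and x: "x \<in> part C i" and b: "b \<in> part A j" and y: "y \<in> part C j"
    and c: "c \<in> part A l" and z: "z \<in> part C l"
  shows "a \<otimes> (b \<otimes> c \<oplus> ract b z \<oplus> lact y c) \<oplus> ract a (y \<otimes>\<^bsub>C\<^esub> z) \<oplus>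
      lact x (b \<otimes> c \<oplus> ract b z \<oplus> lact y c) =
    ((a \<otimes> b \<oplus> ract a y \<oplus> lact x b) \<otimes> c \<oplus>
      ract (a \<otimes> b \<oplus> ract a y \<oplus> lact x b) z \<oplus> lact (x \<otimes>\<^bsub>C\<^esub> y) c) \<ominus>
    ksign (l * j) \<odot>
    ((a \<otimes> c \<oplus> ract a z \<oplus> lact x c) \<otimes> b \<oplus>
      ract (a \<otimes> c \<oplus> ract a z \<oplus> lact x c) y \<oplus> lact (x \<otimes>\<^bsub>C\<^esub> z) b)"
proof -
  have cl: "a \<in> carrier A" "b \<in> carrier A" "c \<in> carrier A" "x \<in> carrier C" "y \<in> carrier C" "z \<in> carrier C"
    using assms A.part_in_carrier C.part_in_carrier by blast+
  note clo = A.mult_closed C.mult_closed action_closed cl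
  \<comment> \<open>The axioms write their signs in both orders of the parities; a common order is
    needed before regrouping.\<close>
  have jl: "j * l = l * j" by (rule mult.commute)
  show ?thesis
    by (simp only: A.mult_add_left A.mult_add_right action_add clo A.add.m_closed
      A.leibniz[OF a b c] action_compat(2)[OF a b z] action_compat(3)[OF a c y]
      action_leibniz(1)[OF a y z] action_compat(1)[OF b c x] action_leibniz(3)[OF b x z]
      action_leibniz(2)[OF c x y] jl A.leibniz_rearrange)
qed

theorem leibniz_superalgebra_semidirect: "leibniz_superalgebra (semidirect C A lact ract)"
proof -
  let ?P = "semidirect C A lact ract"
  interpret P: abelian_group ?P by (rule abelian_group_semidirect)
  show ?thesis
  proof
    fix p q s i j l assume "p \<in> part ?P i" "q \<in> part ?P j" "s \<in> part ?P l"
    then obtain a x b y c z where pqs: "p = (a, x)" "q = (b, y)" "s = (c, z)"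
      and ax: "a \<in> part A i" "x \<in> part C i" "b \<in> part A j" "y \<in> part C j" "c \<in> part A l" "z \<in> part C l"
      by auto
    have cl: "a \<in> carrier A" "b \<in> carrier A" "c \<in> carrier A" "x \<in> carrier C" "y \<in> carrier C" "z \<in> carrier C"
      using ax A.part_in_carrier C.part_in_carrier by blast+
    note clo = A.mult_closed C.mult_closed action_closed A.smult_closed C.smult_closed cl
    show "p \<otimes>\<^bsub>?P\<^esub> (q \<otimes>\<^bsub>?P\<^esub> s) =
        p \<otimes>\<^bsub>?P\<^esub> q \<otimes>\<^bsub>?P\<^esub> s \<ominus>\<^bsub>?P\<^esub> ksign (l * j) \<odot>\<^bsub>?P\<^esub> (p \<otimes>\<^bsub>?P\<^esub> s \<otimes>\<^bsub>?P\<^esub> q)"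
      unfolding pqs semidirect_simps
      by (simp only: semidirect_minus clo A.add.m_closed semidirect_leibniz[OF ax] C.leibniz[OF ax(2,4,6)])
  next
    fix p assume "p \<in> carrier ?P"
    then obtain a x where p: "p = (a, x)" "a \<in> carrier A" "x \<in> carrier C" by auto
    obtain a0 a1 where a: "a0 \<in> part A 0" "a1 \<in> part A 1" "a = a0 \<oplus> a1"
      using A.part_decompose[OF p(2)] .
    obtain x0 x1 where x: "x0 \<in> part C 0" "x1 \<in> part C 1" "x = x0 \<oplus>\<^bsub>C\<^esub> x1"
      using C.part_decompose[OF p(3)] .
    show "\<exists>!u. u \<in> part ?P 0 \<times> part ?P 1 \<and> p = fst u \<oplus>\<^bsub>?P\<^esub> snd u"
    proof (rule ex1I[of _ "((a0, x0), (a1, x1))"])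
      show "((a0, x0), (a1, x1)) \<in> part ?P 0 \<times> part ?P 1 \<and>
          p = fst ((a0, x0), (a1, x1)) \<oplus>\<^bsub>?P\<^esub> snd ((a0, x0), (a1, x1))"
        using p a x by simp
    next
      fix u assume u: "u \<in> part ?P 0 \<times> part ?P 1 \<and> p = fst u \<oplus>\<^bsub>?P\<^esub> snd u"
      then obtain b0 y0 b1 y1 where uu: "u = ((b0, y0), (b1, y1))"
        and b: "b0 \<in> part A 0" "b1 \<in> part A 1" "y0 \<in> part C 0" "y1 \<in> part C 1" by auto
      have "b0 \<oplus> b1 = a0 \<oplus> a1" "y0 \<oplus>\<^bsub>C\<^esub> y1 = x0 \<oplus>\<^bsub>C\<^esub> x1"
        using u p(1) a(3) x(3) by (simp_all add: uu)
      then show "u = ((a0, x0), (a1, x1))"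
        using A.part_sum_unique[OF b(1,2) a(1,2)] C.part_sum_unique[OF b(3,4) x(1,2)] uu by simp
    qed
  next
    fix p q i j assume "p \<in> part ?P i" "q \<in> part ?P j"
    then obtain a x b y where pq: "p = (a, x)" "q = (b, y)"
      and ax: "a \<in> part A i" "x \<in> part C i" "b \<in> part A j" "y \<in> part C j" by auto
    show "p \<otimes>\<^bsub>?P\<^esub> q \<in> part ?P (i + j)"
      unfolding pq semidirect_simps
      by (intro SigmaI A.part_add A.part_mult C.part_mult action_part ax)
  next
    fix i show "part ?P i \<subseteq> carrier ?P" using A.part_carrier C.part_carrier by auto
  qed (auto simp: A.smult_closed C.smult_closed A.smult_l_distr C.smult_l_distr A.smult_r_distr C.smult_r_distr
      A.smult_assoc C.smult_assoc A.smult_one C.smult_one A.mult_closed C.mult_closed action_closed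
      A.mult_add_left C.mult_add_left A.mult_add_right C.mult_add_right action_add action_smult
      A.mult_smult_left C.mult_smult_left A.mult_smult_right C.mult_smult_right
      A.part_zero C.part_zero A.a_ac intro: A.part_add C.part_add A.part_smult C.part_smult)
qed

end

section \<open>Linear extension and bases\<close>

lemma sum_single: "(\<Sum>w\<in>keys f. lookup f w *p Poly_Mapping.single w 1) = f"
proof (rule poly_mapping_eqI)
  fix v
  show "lookup (\<Sum>w\<in>keys f. lookup f w *p Poly_Mapping.single w 1) v = lookup f v"
    by (simp add: lookup_sum lookup_single when_def in_keys_iff if_distrib cong: if_cong)
qed

context leibniz_superalgebra
begin

definition lsum :: "('v \<Rightarrow> 'a) \<Rightarrow> ('v \<Rightarrow>\<^sub>0 'k) \<Rightarrow> 'a"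
  where "lsum F f = (\<Oplus>w\<in>keys f. lookup f w \<odot> F w)"

lemma lin_comb_lsum: "lin_comb A f = lsum (\<lambda>a. a) f"
  by (simp add: lin_comb_def lsum_def)

lemma lsum_zero: "lsum F 0 = \<zero>"
  by (simp add: lsum_def)

context
  fixes F :: "'v \<Rightarrow> 'a" and V :: "'v set"
  assumes F: "\<And>v. v \<in> V \<Longrightarrow> F v \<in> carrier A"
begin

lemma lsum_superset:
  assumes "finite W" "keys f \<subseteq> W" "W \<subseteq> V"
  shows "lsum F f = (\<Oplus>w\<in>W. lookup f w \<odot> F w)"
  unfolding lsum_def using assms
  by (intro add.finprod_mono_neutral_cong_left)
    (auto simp: in_keys_iff subset_iff zero_smult F smult_closed)

lemma lsum_closed: "keys f \<subseteq> V \<Longrightarrow> lsum F f \<in> carrier A"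
  unfolding lsum_def by (intro finsum_closed) (auto intro!: smult_closed F)

lemma lsum_add:
  assumes "keys f \<subseteq> V" "keys g \<subseteq> V"
  shows "lsum F (f + g) = lsum F f \<oplus> lsum F g"
proof -
  let ?W = "keys f \<union> keys g"
  have W: "finite ?W" "keys (f + g) \<subseteq> ?W" "keys f \<subseteq> ?W" "keys g \<subseteq> ?W" "?W \<subseteq> V"
    using assms Poly_Mapping.keys_add[of f g] by auto
  have cl: "(\<lambda>w. lookup h w \<odot> F w) \<in> ?W \<rightarrow> carrier A" for h
    using W(5) by (auto intro!: smult_closed F)
  have "(\<Oplus>w\<in>?W. lookup (f + g) w \<odot> F w) = (\<Oplus>w\<in>?W. lookup f w \<odot> F w \<oplus> lookup g w \<odot> F w)"
    using W(5) by (intro finsum_cong')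
      (auto simp: lookup_add subset_iff intro!: smult_l_distr smult_closed F)
  also have "\<dots> = (\<Oplus>w\<in>?W. lookup f w \<odot> F w) \<oplus> (\<Oplus>w\<in>?W. lookup g w \<odot> F w)"
    by (intro finsum_addf cl)
  finally show ?thesis
    using W by (simp add: lsum_superset[of ?W])
qed

lemma lsum_single: "v \<in> V \<Longrightarrow> lsum F (c *p Poly_Mapping.single v 1) = c \<odot> F v"
proof -
  assume v: "v \<in> V"
  have "keys (c *p Poly_Mapping.single v 1) \<subseteq> {v}"
    using keys_pscale[of c "Poly_Mapping.single v 1"] by simp
  from lsum_superset[OF _ this] v show ?thesis
    by (simp add: smult_closed F finsum_insert finsum_empty)
qed

lemma lsum_pscale:
  assumes "keys f \<subseteq> V"
  shows "lsum F (c *p f) = c \<odot> lsum F f"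
proof -
  have "lsum F (c *p f) = (\<Oplus>w\<in>keys f. c \<odot> (lookup f w \<odot> F w))"
    using assms by (subst lsum_superset[OF _ keys_pscale])
      (auto intro!: finsum_cong' smult_assoc smult_closed F)
  also have "\<dots> = c \<odot> lsum F f"
  proof -
    have "(\<Oplus>w\<in>W. c \<odot> (lookup f w \<odot> F w)) = c \<odot> (\<Oplus>w\<in>W. lookup f w \<odot> F w)"
      if "finite W" "W \<subseteq> V" for W
      using that by (induction W rule: finite_induct)
        (auto simp: smult_zero smult_r_distr smult_closed F finsum_insert Pi_iff subset_iff finsum_closed)
    with assms show ?thesis by (simp add: lsum_def)
  qed
  finally show ?thesis .
qed

lemma lsum_diff:
  assumes "keys f \<subseteq> V" "keys g \<subseteq> V"
  shows "lsum F (f - g) = lsum F f \<ominus> lsum F g"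
  using lsum_add[of f "(-1) *p g"] lsum_pscale[of g "-1"] assms
  by (simp add: keys_pscale_subset minus_eq_smult lsum_closed)

end

lemma lsum_part:
  assumes "\<And>v. v \<in> V \<Longrightarrow> F v \<in> part A i" "keys f \<subseteq> V"
  shows "lsum F f \<in> part A i"
proof -
  have "(\<Oplus>w\<in>W. lookup f w \<odot> F w) \<in> part A i" if "finite W" "W \<subseteq> V" for W
    using that
  proof (induction W rule: finite_induct)
    case (insert w W)
    then have "w \<in> V" "\<And>v. v \<in> W \<Longrightarrow> F v \<in> carrier A" "F w \<in> carrier A"
      using assms(1) part_in_carrier by (blast, blast, blast)
    with insert show ?case
      by (subst finsum_insert) (auto intro!: smult_closed part_add part_smult assms(1))
  qed (simp add: part_zero)
  with assms(2) show ?thesis by (simp add: lsum_def)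
qed

end

section \<open>Coordinates with respect to a homogeneous basis\<close>

locale graded_basis = leibniz_superalgebra \<AA>
  for \<AA> :: "('k::field, 'a) superalgebra" (structure) +
  fixes A :: "bit \<Rightarrow> 'a set"
  assumes basis: "\<And>i. linear_basis \<AA> (part \<AA> i) (A i)"
begin

lemma basis_part: "a \<in> A i \<Longrightarrow> a \<in> part \<AA> i"
  using basis[of i] by (auto simp: linear_basis_def)

lemma basis_carrier: "a \<in> gset A \<Longrightarrow> a \<in> carrier \<AA>"
  unfolding gset_def using basis_part part_in_carrier by blast

lemma basis_indep:
  assumes "keys c \<subseteq> A i" "lsum (\<lambda>a. a) c = \<zero>"
  shows "c = 0"
proof -
  have "\<exists>!c. keys c \<subseteq> A i \<and> \<zero> = lsum (\<lambda>a. a) c"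
    using basis[of i] part_zero[of i] by (auto simp: linear_basis_def lin_comb_lsum)
  moreover have "keys 0 \<subseteq> A i \<and> \<zero> = lsum (\<lambda>a. a) 0" by (simp add: lsum_zero)
  ultimately show ?thesis using assms by metis
qed

text \<open>A common element would lie in both parts and hence be zero, but a zero basis vector
  contradicts uniqueness of coordinates.\<close>

lemma basis_disjoint: "A 0 \<inter> A 1 = {}"
proof (rule ccontr)
  assume "A 0 \<inter> A 1 \<noteq> {}"
  then obtain a where a: "a \<in> A 0" "a \<in> A 1" by auto
  then have "a \<in> part \<AA> 0" "a \<in> part \<AA> 1" using basis_part by auto
  then have "a \<oplus> \<zero> = \<zero> \<oplus> a" by (simp add: part_in_carrier)
  then have "a = \<zero>"
    using part_sum_unique[OF \<open>a \<in> part \<AA> 0\<close> part_zero part_zero \<open>a \<in> part \<AA> 1\<close>] by blast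
  then have "lsum (\<lambda>a. a) (1 *p Poly_Mapping.single a 1) = \<zero>"
    by (subst lsum_single[of "{a}"]) (auto simp: smult_one)
  then have "1 *p Poly_Mapping.single a (1::'k) = 0" using a by (intro basis_indep) auto
  then have "lookup (1 *p Poly_Mapping.single a (1::'k)) a = 0" by (simp only: lookup_zero)
  then show False by simp
qed

text \<open>Only the two parts are given with bases. Splitting the coefficients into
  \<open>c0\<close> and \<open>c1\<close> gives an even and an odd sum; since the parts form a
  direct sum, both vanish and independence inside each part applies.\<close>

lemma gset_indep:
  assumes c: "keys c \<subseteq> gset A" and z: "lsum (\<lambda>a. a) c = \<zero>"
  shows "c = 0"
proof -
  define c0 where "c0 = lin_ext (\<lambda>a. if a \<in> A 0 then Poly_Mapping.single a 1 else 0) c"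
  define c1 where "c1 = lin_ext (\<lambda>a. if a \<in> A 0 then 0 else Poly_Mapping.single a 1) c"
  have k0: "keys c0 \<subseteq> A 0"
    unfolding c0_def using keys_lin_ext[of "\<lambda>a. if a \<in> A 0 then Poly_Mapping.single a 1 else 0" c]
    by (auto split: if_splits)
  have k1: "keys c1 \<subseteq> A 1"
    unfolding c1_def using keys_lin_ext[of "\<lambda>a. if a \<in> A 0 then 0 else Poly_Mapping.single a 1" c] c
    by (fastforce simp: gset_def split: if_splits)
  have "c0 + c1 = lin_ext (\<lambda>a. Poly_Mapping.single a 1) c"
    unfolding c0_def c1_def lin_ext_fun_add[symmetric] by (rule lin_ext_cong) auto
  then have sum: "c = c0 + c1" by (simp add: lin_ext_def sum_single)
  have "lsum (\<lambda>a. a) c = lsum (\<lambda>a. a) c0 \<oplus> lsum (\<lambda>a. a) c1"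
    unfolding sum by (rule lsum_add[of "gset A"]) (use k0 k1 basis_carrier in \<open>auto simp: gset_def\<close>)
  moreover have "lsum (\<lambda>a. a) c0 \<in> part \<AA> 0" "lsum (\<lambda>a. a) c1 \<in> part \<AA> 1"
    using lsum_part[OF basis_part k0] lsum_part[OF basis_part k1] by auto
  ultimately have "lsum (\<lambda>a. a) c0 = \<zero>" "lsum (\<lambda>a. a) c1 = \<zero>"
    using part_sum_zero z by auto
  then show ?thesis using basis_indep k0 k1 sum by (metis add_0)
qed

lemma gset_unique:
  assumes "keys c \<subseteq> gset A" "keys d \<subseteq> gset A" "lsum (\<lambda>a. a) c = lsum (\<lambda>a. a) d"
  shows "c = d"
proof -
  have "keys (c - d) \<subseteq> gset A" using keys_minus_subset[of c d] assms by blast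
  moreover have "lsum (\<lambda>a. a) (c - d) = \<zero>"
    using assms lsum_diff[of "gset A" "\<lambda>a. a" c d] basis_carrier
    by (simp add: minus_eq_zero_iff lsum_closed[of "gset A"])
  ultimately show ?thesis using gset_indep by fastforce
qed

abbreviation coords :: "'a \<Rightarrow> ('a \<Rightarrow>\<^sub>0 'k)"
  where "coords \<equiv> coordinates \<AA> (gset A)"

lemma coords_eqI:
  assumes "keys c \<subseteq> gset A"
  shows "coords (lsum (\<lambda>a. a) c) = c"
  unfolding coordinates_def lin_comb_lsum using assms gset_unique by (intro the_equality) auto

lemma coords:
  assumes "x \<in> carrier \<AA>"
  shows "keys (coords x) \<subseteq> gset A" "lsum (\<lambda>a. a) (coords x) = x"
proof -
  obtain x0 x1 where x: "x0 \<in> part \<AA> 0" "x1 \<in> part \<AA> 1" "x = x0 \<oplus> x1"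
    using part_decompose[OF assms] .
  obtain c0 where c0: "keys c0 \<subseteq> A 0" "x0 = lsum (\<lambda>a. a) c0"
    using basis[of 0] x(1) unfolding linear_basis_def lin_comb_lsum by blast
  obtain c1 where c1: "keys c1 \<subseteq> A 1" "x1 = lsum (\<lambda>a. a) c1"
    using basis[of 1] x(2) unfolding linear_basis_def lin_comb_lsum by blast
  have k: "keys c0 \<subseteq> gset A" "keys c1 \<subseteq> gset A" using c0 c1 by (auto simp: gset_def)
  have "x = lsum (\<lambda>a. a) (c0 + c1)"
    unfolding x(3) c0(2) c1(2) using lsum_add[of "gset A" "\<lambda>a. a", OF basis_carrier k] by simp
  moreover have "keys (c0 + c1) \<subseteq> gset A" using k by (rule keys_add_subset)
  ultimately show "keys (coords x) \<subseteq> gset A" "lsum (\<lambda>a. a) (coords x) = x"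
    by (simp_all add: coords_eqI)
qed

lemma basis_induct [consumes 1, case_names basis zero add smult]:
  assumes "x \<in> carrier \<AA>" "\<And>a. a \<in> gset A \<Longrightarrow> P a" "P \<zero>"
    "\<And>x y. x \<in> carrier \<AA> \<Longrightarrow> y \<in> carrier \<AA> \<Longrightarrow> P x \<Longrightarrow> P y \<Longrightarrow> P (x \<oplus> y)"
    "\<And>c x. x \<in> carrier \<AA> \<Longrightarrow> P x \<Longrightarrow> P (c \<odot> x)"
  shows "P x"
proof -
  have "P (\<Oplus>a\<in>W. lookup (coords x) a \<odot> a) \<and> (\<Oplus>a\<in>W. lookup (coords x) a \<odot> a) \<in> carrier \<AA>"
    if "finite W" "W \<subseteq> gset A" for W
    using that
  proof (induction W rule: finite_induct)
    case (insert w W)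
    then have "w \<in> gset A" "\<And>v. v \<in> W \<Longrightarrow> v \<in> carrier \<AA>" "w \<in> carrier \<AA>"
      using basis_carrier by auto
    with insert show ?case
      by (subst (1 2) finsum_insert) (auto intro!: smult_closed assms(4,5) assms(2)[of w])
  qed (use assms in auto)
  from this[of "keys (coords x)"] show ?thesis
    using coords[OF assms(1)] by (simp add: lsum_def)
qed

lemma coords_add: "x \<in> carrier \<AA> \<Longrightarrow> y \<in> carrier \<AA> \<Longrightarrow> coords (x \<oplus> y) = coords x + coords y"
  using coords_eqI[of "coords x + coords y"] coords[of x] coords[of y]
    lsum_add[of "gset A" "\<lambda>a. a" "coords x" "coords y"] basis_carrier
  by (simp add: keys_add_subset)

lemma coords_smult: "x \<in> carrier \<AA> \<Longrightarrow> coords (c \<odot> x) = c *p coords x"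
  using coords_eqI[of "c *p coords x"] coords[of x]
    lsum_pscale[of "gset A" "\<lambda>a. a" "coords x" c] basis_carrier
  by (simp add: keys_pscale_subset)

lemma coords_basis: "a \<in> gset A \<Longrightarrow> coords a = Poly_Mapping.single a 1"
  using coords_eqI[of "Poly_Mapping.single a 1"] lsum_single[of "gset A" "\<lambda>a. a" a 1] basis_carrier
  by (simp add: smult_one)

abbreviation emb :: "'a \<Rightarrow> (('a + 'b) list \<Rightarrow>\<^sub>0 'k)"
  where "emb \<equiv> emb_alg \<AA> A"

lemma emb_alg_add: "x \<in> carrier \<AA> \<Longrightarrow> y \<in> carrier \<AA> \<Longrightarrow> emb (x \<oplus> y) = emb x + emb y"
  by (simp add: emb_alg_def coords_add lin_ext_add)

lemma emb_alg_smult: "x \<in> carrier \<AA> \<Longrightarrow> emb (c \<odot> x) = c *p emb x"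
  by (simp add: emb_alg_def coords_smult lin_ext_pscale)

lemma emb_alg_zero: "emb \<zero> = 0"
  using emb_alg_smult[of \<zero> 0] by (simp add: smult_zero)

lemma emb_alg_basis: "a \<in> gset A \<Longrightarrow> emb a = gen (Inl a)"
  by (simp add: emb_alg_def coords_basis)

lemma emb_alg_keys:
  fixes x :: 'a
  assumes "x \<in> carrier \<AA>"
  shows "keys (emb x :: ('a + 'b) list \<Rightarrow>\<^sub>0 'k) \<subseteq> (\<lambda>a. [Inl a]) ` gset A"
  using keys_lin_ext[of "\<lambda>a. gen (Inl a) :: ('a + 'b) list \<Rightarrow>\<^sub>0 'k" "coords x"] coords(1)[OF assms]
  unfolding emb_alg_def by auto

end

section \<open>The ideal of the semidirect product attached to extension data\<close>

locale extension_setup = reduced_relations B r R + graded_basis \<AA> A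
  for B :: "bit \<Rightarrow> 'b set" and r :: "'b rel" and R :: "('b list \<Rightarrow>\<^sub>0 'k::field) set"
    and \<AA> :: "('k, 'a) superalgebra" (structure) and A :: "bit \<Rightarrow> 'a set" +
  fixes lact :: "('b list \<Rightarrow>\<^sub>0 'k) \<Rightarrow> 'a \<Rightarrow> 'a" and ract :: "'a \<Rightarrow> ('b list \<Rightarrow>\<^sub>0 'k) \<Rightarrow> 'a"
    and fl :: "('b list \<Rightarrow>\<^sub>0 'k) \<Rightarrow> 'a"
  assumes B_disjoint: "B 0 \<inter> B 1 = {}"
    and data: "extension_data \<AA> A B r R lact ract fl"
begin

sublocale act: compatible_action \<AA> "Lbs B" lact ract
  using data leibniz_superalgebra_axioms leibniz_superalgebra_Lbs[of B]
  by (simp add: compatible_action_def compatible_action_axioms_def extension_data_def)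

text \<open>The value occurring in condition (ii): the normal polynomial \<open>np s c\<close> with
  \<open>s\<close> replaced by its floor and the letters of \<open>c\<close> acting from the
  right.\<close>

abbreviation ch :: "('b list \<Rightarrow>\<^sub>0 'k) \<Rightarrow> 'b list \<Rightarrow> 'a"
  where "ch s c \<equiv> foldl (\<lambda>y b. ract y (gen b)) (fl s) c"

lemma fl_part: "s \<in> R \<Longrightarrow> s \<in> part (Lbs B) i \<Longrightarrow> fl s \<in> part \<AA> i"
  using data unfolding extension_data_def by blast

lemma gen_part: "b \<in> gset B \<Longrightarrow> gen b \<in> part (Lbs B) (letter_parity B b)"
  using nfmon_part[of "[b]" B] unfolding parity_single by (auto simp only: NF_def) auto

lemma gen_carrier: "b \<in> gset B \<Longrightarrow> gen b \<in> carrier (Lbs B)"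
  by (simp add: NF_def)

lemma ch_part:
  assumes "s \<in> R" "s \<in> part (Lbs B) i" "c \<in> lists (gset B)"
  shows "ch s c \<in> part \<AA> (i + parity B c)"
  using assms(3)
proof (induction c rule: rev_induct)
  case Nil
  show ?case using fl_part[OF assms(1,2)]
    by (simp only: foldl.simps parity_def list.map sum_list.Nil add_0_right)
next
  case (snoc b c)
  then have "ch s c \<in> part \<AA> (i + parity B c)" "gen b \<in> part (Lbs B) (letter_parity B b)"
    using gen_part by (auto simp del: Lbs_simps)
  from act.action_part(1)[OF this] show ?case
    unfolding parity_append parity_single foldl_append foldl.simps by (simp only: add.assoc)
qed

text \<open>The same parity serves for the normal polynomial and its value. The signs in the
  identities for both then coincide, which the comparisons below rely on.\<close>

lemma np_ch_part:
  assumes "(s, c) \<in> D"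
  obtains p where "np s c \<in> part (Lbs B) p" "ch s c \<in> part \<AA> p"
proof -
  from assms have sc: "s \<in> R" "c \<in> lists (gset B)" by (simp_all only: D_iff)
  then obtain i where "s \<in> part (Lbs B) i" using R_part by blast
  from np_part[OF this sc(2)] ch_part[OF sc(1) this sc(2)] that show thesis by blast
qed

lemma ch_closed: "(s, c) \<in> D \<Longrightarrow> ch s c \<in> carrier \<AA>"
  using np_ch_part part_in_carrier by metis

lemma ch_snoc: "ch s (c @ [b]) = ract (ch s c) (gen b)"
  by simp

subsection \<open>The linear extension of the floor map\<close>

text \<open>The preimage under \<open>hsum\<close> is unique on functions supported in
  \<open>D\<close>, so this is a well-defined linear map on \<open>IR\<close>; elsewhere its value
  is arbitrary.\<close>

definition Floor :: "('b list \<Rightarrow>\<^sub>0 'k) \<Rightarrow> 'a"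
  where "Floor h = lsum (\<lambda>(s, c). ch s c) (inv_into {\<phi>. keys \<phi> \<subseteq> D} hsum h)"

lemma Floor_hsum: "keys \<phi> \<subseteq> D \<Longrightarrow> Floor (hsum \<phi>) = lsum (\<lambda>(s, c). ch s c) \<phi>"
proof -
  assume \<phi>: "keys \<phi> \<subseteq> D"
  have "inj_on hsum {\<phi>. keys \<phi> \<subseteq> D}" using hsum_inj by (auto intro: inj_onI)
  with \<phi> show ?thesis by (simp add: Floor_def)
qed

lemma ch_fun_closed: "p \<in> D \<Longrightarrow> (case p of (s, c) \<Rightarrow> ch s c) \<in> carrier \<AA>"
  using ch_closed by (cases p) simp

lemma Floor_closed: "h \<in> IR \<Longrightarrow> Floor h \<in> carrier \<AA>"
  unfolding IR_hsum using lsum_closed[of D, OF ch_fun_closed] by (auto simp: Floor_hsum)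

lemma Floor_add: "g \<in> IR \<Longrightarrow> h \<in> IR \<Longrightarrow> Floor (g + h) = Floor g \<oplus> Floor h"
proof -
  assume "g \<in> IR" "h \<in> IR"
  then obtain \<phi> \<psi> where *: "g = hsum \<phi>" "keys \<phi> \<subseteq> D" "h = hsum \<psi>" "keys \<psi> \<subseteq> D"
    by (auto simp: IR_hsum)
  have "hsum \<phi> + hsum \<psi> = hsum (\<phi> + \<psi>)" by (simp add: hsum_def lin_ext_add)
  then show ?thesis
    using * lsum_add[of D, OF ch_fun_closed *(2,4)] by (simp add: Floor_hsum keys_add_subset)
qed

lemma Floor_pscale: "h \<in> IR \<Longrightarrow> Floor (\<alpha> *p h) = \<alpha> \<odot> Floor h"
proof -
  assume "h \<in> IR"
  then obtain \<phi> where *: "h = hsum \<phi>" "keys \<phi> \<subseteq> D" by (auto simp: IR_hsum)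
  have "\<alpha> *p hsum \<phi> = hsum (\<alpha> *p \<phi>)" by (simp add: hsum_def lin_ext_pscale)
  then show ?thesis
    using * lsum_pscale[of D, OF ch_fun_closed *(2)] by (simp add: Floor_hsum keys_pscale_subset)
qed

lemma Floor_zero: "Floor 0 = \<zero>"
  using Floor_pscale[of 0 0] by (simp add: IR_subspace zero_smult Floor_closed)

lemma Floor_diff: "g \<in> IR \<Longrightarrow> h \<in> IR \<Longrightarrow> Floor (g - h) = Floor g \<ominus> Floor h"
  using Floor_add[of g "(-1) *p h"] Floor_pscale[of h "-1"] IR_subspace(3)[of h "-1"]
  by (simp add: minus_eq_smult Floor_closed)

lemma Floor_np: "(s, c) \<in> D \<Longrightarrow> Floor (np s c) = ch s c"
proof -
  assume sc: "(s, c) \<in> D"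
  have "np s c = hsum (1 *p Poly_Mapping.single (s, c) 1)" by (simp add: hsum_def)
  then show ?thesis
    using sc lsum_single[of D "\<lambda>(s, c). ch s c" "(s, c)" 1, OF ch_fun_closed sc] ch_closed by (simp add: Floor_hsum smult_one)
qed

text \<open>Built into the construction: appending \<open>b\<close> multiplies \<open>np s c\<close>
  by \<open>b\<close> and lets \<open>b\<close> act on \<open>ch s c\<close>.\<close>

lemma Floor_mult_gen: "h \<in> IR \<Longrightarrow> b \<in> gset B \<Longrightarrow> Floor (lb_mult B h (gen b)) = ract (Floor h) (gen b)"
proof (induction h rule: IR_induct)
  case zero
  then show ?case using act.action_zero(3)[of "gen b"] gen_carrier[of b] by (simp add: Floor_zero)
next
  case (step \<alpha> s c h)
  then have "(s, c @ [b]) \<in> D" by (auto simp: D_iff)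
  with step have *: "(s, c @ [b]) \<in> D" "np s (c @ [b]) \<in> IR" "np s c \<in> IR" "gen b \<in> carrier (Lbs B)"
    by (blast intro: IR_np gen_carrier)+
  have "Floor (lb_mult B (\<alpha> *p np s c + h) (gen b)) =
      Floor (\<alpha> *p np s (c @ [b]) + lb_mult B h (gen b))"
    unfolding np_snoc lb_mult_linear ..
  also have "\<dots> = \<alpha> \<odot> ract (ch s c) (gen b) \<oplus> ract (Floor h) (gen b)"
    using step * by (simp only: Floor_add Floor_pscale IR_subspace IR_mult_gen Floor_np ch_snoc)
  also have "\<dots> = ract (Floor (\<alpha> *p np s c + h)) (gen b)"
    using step *
    by (simp only: Floor_add Floor_pscale IR_subspace Floor_np act.action_smult(3)[OF *(4) ch_closed[OF step(1)]]
        act.action_add(3)[OF *(4) smult_closed[OF ch_closed[OF step(1)]] Floor_closed[OF step(2)]])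
  finally show ?case .
qed

lemma floor_expr_Floor:
  "\<forall>(\<alpha>, s, c)\<in>set ts. (s, c) \<in> D \<Longrightarrow> floor_expr \<AA> ract fl ts = Floor (expr_sum ts)"
proof (induction ts)
  case Nil
  show ?case by (simp add: floor_expr_def Floor_zero)
next
  case (Cons t ts)
  obtain \<alpha> s c where t: "t = (\<alpha>, s, c)" by (cases t)
  then have sc: "(s, c) \<in> D" "expr_sum ts \<in> IR" using Cons.prems expr_sum_IR[of ts] by auto
  then have "Floor (\<alpha> *p np s c + expr_sum ts) = \<alpha> \<odot> ch s c \<oplus> Floor (expr_sum ts)"
    by (simp only: Floor_add Floor_pscale IR_subspace IR_np Floor_np)
  with Cons show ?case by (simp add: t floor_expr_def)
qed

lemma floor_expr_valid: "valid_terms ts \<Longrightarrow> floor_expr \<AA> ract fl ts = Floor (expr_sum ts)"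
  by (rule floor_expr_Floor) (auto simp: valid_terms_def)

text \<open>Condition (ii), freed from normal expressions: its right-hand side is
  \<open>Floor\<close> of the product being expressed.\<close>

lemma lact_fl: "u \<in> NF B \<Longrightarrow> s \<in> R \<Longrightarrow> lact (nfmon u) (fl s) = Floor (lb_mult B (nfmon u) s)"
proof -
  assume *: "u \<in> NF B" "s \<in> R"
  then have "lb_mult B (nfmon u) s \<in> IR" using R_subset_IR by (intro IR_mult_left) auto
  from floor_expr_valid[OF normal_expr(1)[OF this]] normal_expr(2)[OF this] data * show ?thesis
    by (simp add: extension_data_def)
qed

subsection \<open>Compatibility of the floor map with the actions\<close>

text \<open>Condition (i), extended linearly, is the base. For the step, the supermodule identity
  for a.(xb) and the compatibility identity for a(y.b), with x = \<open>np s c\<close> and y =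
  \<open>ch s c\<close>, have the same shape and the same sign; their last terms involve a.b, so
  \<open>a\<close> stays arbitrary.\<close>

lemma ract_np:
  assumes "s \<in> R" "c \<in> lists (gset B)" "a \<in> part \<AA> i"
  shows "ract a (np s c) = a \<otimes> ch s c"
  using assms(2,3)
proof (induction c arbitrary: a i rule: rev_induct)
  case Nil
  have s: "s \<in> carrier (Lbs B)" "fl s \<in> carrier \<AA>"
    using R_carrier assms(1) ch_closed[of s "[]"] by (auto simp: D_iff)
  from Nil(2) have "a \<in> carrier \<AA>" by (rule part_in_carrier)
  then have "ract a s = a \<otimes> fl s"
  proof (induction a rule: basis_induct)
    case (basis a)
    then show ?case using data assms(1) by (simp add: extension_data_def)
  next
    case (add x y)
    then show ?case using s by (simp add: act.action_add(3) mult_add_left del: Lbs_simps)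
  next
    case (smult c x)
    then show ?case using s by (simp add: act.action_smult(3) mult_smult_left del: Lbs_simps)
  qed (use s in \<open>simp add: act.action_zero(3) mult_zero_left del: Lbs_simps\<close>)
  then show ?case by (simp add: left_normed_def)
next
  case (snoc b c)
  then have b: "b \<in> gset B" "c \<in> lists (gset B)" "(s, c) \<in> D" using assms(1) by (auto simp: D_iff)
  obtain p where p: "np s c \<in> part (Lbs B) p" "ch s c \<in> part \<AA> p" using np_ch_part[OF b(3)] .
  note g = gen_part[OF b(1)]
  have "ract a (lb_mult B (np s c) (gen b)) = ract (ract a (np s c)) (gen b) \<ominus>
      ksign (p * letter_parity B b) \<odot> ract (ract a (gen b)) (np s c)"
    using act.action_leibniz(1)[OF snoc.prems(2) p(1) g] by (simp only: Lbs_simps)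
  also have "\<dots> = ract (a \<otimes> ch s c) (gen b) \<ominus>
      ksign (letter_parity B b * p) \<odot> (ract a (gen b) \<otimes> ch s c)"
    by (simp only: snoc.IH[OF b(2) snoc.prems(2)] snoc.IH[OF b(2) act.action_part(1)[OF snoc.prems(2) g]] mult.commute)
  also have "\<dots> = a \<otimes> ract (ch s c) (gen b)"
    by (rule act.action_compat(2)[OF snoc.prems(2) p(2) g, symmetric])
  finally show ?case by (simp only: np_snoc ch_snoc)
qed

text \<open>The wanted term occurs with a sign in the identity for x.(a.b), where x =
  \<open>np s c\<close>. Expanding the same element by the compatibility identity for y(a.b), with y
  = \<open>ch s c\<close>, gives two expressions that differ only in the signed term;
  \<open>minus_ksign_cancel\<close> compares them.\<close>

lemma lact_np:
  assumes "s \<in> R" "c \<in> lists (gset B)" "a \<in> part \<AA> i"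
  shows "lact (np s c) a = ch s c \<otimes> a"
  using assms(2,3)
proof (induction c arbitrary: a i rule: rev_induct)
  case Nil
  have s: "s \<in> carrier (Lbs B)" "fl s \<in> carrier \<AA>"
    using R_carrier assms(1) ch_closed[of s "[]"] by (auto simp: D_iff)
  from Nil(2) have "a \<in> carrier \<AA>" by (rule part_in_carrier)
  then have "lact s a = fl s \<otimes> a"
  proof (induction a rule: basis_induct)
    case (basis a)
    then show ?case using data assms(1) by (simp add: extension_data_def)
  next
    case (add x y)
    then show ?case using s by (simp add: act.action_add(1) mult_add_right del: Lbs_simps)
  next
    case (smult c x)
    then show ?case using s by (simp add: act.action_smult(1) mult_smult_right del: Lbs_simps)
  qed (use s in \<open>simp add: act.action_zero(1) mult_zero_right del: Lbs_simps\<close>)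
  then show ?case by (simp add: left_normed_def)
next
  case (snoc b c)
  then have b: "b \<in> gset B" "c \<in> lists (gset B)" "(s, c) \<in> D" using assms(1) by (auto simp: D_iff)
  obtain p where p: "np s c \<in> part (Lbs B) p" "ch s c \<in> part \<AA> p" using np_ch_part[OF b(3)] .
  note g = gen_part[OF b(1)]
  let ?e = "letter_parity B b * i"
  have "ract (ch s c \<otimes> a) (gen b) \<ominus> ksign ?e \<odot> lact (lb_mult B (np s c) (gen b)) a =
      lact (np s c) (ract a (gen b))"
    using act.action_leibniz(3)[OF snoc.prems(2) p(1) g]
    by (simp only: Lbs_simps snoc.IH[OF b(2) snoc.prems(2)] mult.commute)
  also have "\<dots> = ch s c \<otimes> ract a (gen b)"
    by (rule snoc.IH[OF b(2) act.action_part(1)[OF snoc.prems(2) g]])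
  also have "\<dots> = ract (ch s c \<otimes> a) (gen b) \<ominus> ksign ?e \<odot> (ract (ch s c) (gen b) \<otimes> a)"
    by (rule act.action_compat(2)[OF p(2) snoc.prems(2) g])
  finally have "lact (lb_mult B (np s c) (gen b)) a = ract (ch s c) (gen b) \<otimes> a"
    by (rule minus_ksign_cancel[rotated 3])
      (intro act.action_closed mult_closed lb_mult_closed ch_closed[OF b(3)] gen_carrier[OF b(1)]
        np_carrier[OF b(3)] part_in_carrier[OF snoc.prems(2)])+
  then show ?case by (simp only: np_snoc ch_snoc)
qed

text \<open>Both sides obey the recursion coming from u(xb) = (ux)b -+ (ub)x: the left one in the
  free algebra, the right one by the third supermodule identity. Condition (ii) is the initial case,
  required for every word because \<open>u\<close> grows.\<close>

lemma Floor_nfmon_np: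
  assumes "u \<in> NF B" "s \<in> R" "c \<in> lists (gset B)"
  shows "Floor (lb_mult B (nfmon u) (np s c)) = lact (nfmon u) (ch s c)"
  using assms(1,3)
proof (induction c arbitrary: u rule: rev_induct)
  case Nil
  then show ?case using lact_fl[of u s] assms(2) by (simp add: left_normed_def)
next
  case (snoc b c)
  then have b: "b \<in> gset B" "c \<in> lists (gset B)" "(s, c) \<in> D" "u @ [b] \<in> NF B"
    using assms(2) by (auto simp: D_iff NF_def)
  obtain p where p: "np s c \<in> part (Lbs B) p" "ch s c \<in> part \<AA> p" using np_ch_part[OF b(3)] .
  note g = gen_part[OF b(1)]
  let ?e = "letter_parity B b * p"
  have IR: "lb_mult B (nfmon u) (np s c) \<in> IR" "lb_mult B (nfmon (u @ [b])) (np s c) \<in> IR"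
    using nfmon_mult_np[OF snoc.prems(1) assms(2) b(2)] nfmon_mult_np[OF b(4) assms(2) b(2)] by auto
  have "Floor (lb_mult B (nfmon u) (np s (c @ [b]))) =
      ract (Floor (lb_mult B (nfmon u) (np s c))) (gen b) \<ominus>
      ksign ?e \<odot> Floor (lb_mult B (nfmon (u @ [b])) (np s c))"
    unfolding np_snoc lb_leibniz_Lbs[OF p(1) g] lb_mult_nfmon_gen
    using IR b(1) by (simp only: Floor_diff Floor_pscale Floor_mult_gen IR_mult_gen IR_subspace)
  also have "\<dots> = ract (lact (nfmon u) (ch s c)) (gen b) \<ominus>
      ksign ?e \<odot> lact (nfmon (u @ [b])) (ch s c)"
    using snoc.IH[of u] snoc.IH[of "u @ [b]"] b snoc.prems by simp
  also have "\<dots> = lact (nfmon u) (ract (ch s c) (gen b))"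
    using act.action_leibniz(3)[OF p(2) nfmon_part[OF snoc.prems(1)] g]
    by (simp only: Lbs_simps lb_mult_nfmon_gen mult.commute)
  finally show ?case by (simp only: ch_snoc)
qed

text \<open>Here the recursion is on the right factor and the first supermodule identity matches it.
  The letter split off from \<open>v\<close> is absorbed into \<open>c\<close>, hence the
  generalisation over \<open>c\<close>.\<close>

lemma Floor_np_nfmon:
  assumes "v \<noteq> []" "v \<in> NF B" "(s, c) \<in> D"
  shows "Floor (lb_mult B (np s c) (nfmon v)) = ract (ch s c) (nfmon v)"
  using assms
proof (induction v arbitrary: c rule: rev_nonempty_induct)
  case (single b)
  then show ?case using Floor_mult_gen[OF IR_np, of s c b] Floor_np by (simp add: NF_def)
next
  case (snoc b v)
  then have v: "v \<in> NF B" "b \<in> gset B" "(s, c @ [b]) \<in> D" by (auto simp: NF_def D_iff)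
  obtain p where p: "np s c \<in> part (Lbs B) p" "ch s c \<in> part \<AA> p" using np_ch_part[OF snoc.prems(2)] .
  note g = gen_part[OF v(2)]
  let ?e = "letter_parity B b * parity B v"
  have IR: "lb_mult B (np s c) (nfmon v) \<in> IR" "lb_mult B (np s (c @ [b])) (nfmon v) \<in> IR"
    using IR_mult_nfmon[OF snoc.hyps v(1) IR_np[OF snoc.prems(2)]]
      IR_mult_nfmon[OF snoc.hyps v(1) IR_np[OF v(3)]] by auto
  have "Floor (lb_mult B (np s c) (nfmon (v @ [b]))) =
      ract (Floor (lb_mult B (np s c) (nfmon v))) (gen b) \<ominus>
      ksign ?e \<odot> Floor (lb_mult B (np s (c @ [b])) (nfmon v))"
    unfolding nfmon_snoc[of v b B] lb_leibniz_Lbs[OF nfmon_part[OF v(1)] g] np_snoc[symmetric]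
    using IR v(2) by (simp only: Floor_diff Floor_pscale Floor_mult_gen IR_mult_gen IR_subspace)
  also have "\<dots> = ract (ract (ch s c) (nfmon v)) (gen b) \<ominus>
      ksign ?e \<odot> ract (ract (ch s c) (gen b)) (nfmon v)"
    by (simp only: snoc.IH[OF v(1) snoc.prems(2)] snoc.IH[OF v(1,3)] ch_snoc)
  also have "\<dots> = ract (ch s c) (nfmon (v @ [b]))"
    using act.action_leibniz(1)[OF p(2) nfmon_part[OF v(1)] g]
    by (simp only: Lbs_simps lb_mult_nfmon_gen mult.commute)
  finally show ?case .
qed

lemmas act_simps = act.action_add[simplified] act.action_smult[simplified] act.action_zero[simplified]
  act.action_closed[simplified] act.action_a_inv[simplified]

lemma IR_keys: "h \<in> IR \<Longrightarrow> keys h \<subseteq> NF B"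
  using IR_carrier by simp

lemma Floor_left_np:
  assumes "keys x \<subseteq> NF B" "(s, c) \<in> D"
  shows "Floor (lb_mult B x (np s c)) = lact x (ch s c)"
  using assms(1)
proof (induction x rule: nfmon_induct)
  case zero
  then show ?case using assms(2) by (simp add: Floor_zero act_simps ch_closed)
next
  case (nfmon w \<alpha>)
  have "lb_mult B (nfmon w) (np s c) \<in> IR" using nfmon assms(2) by (intro nfmon_mult_np) (simp_all add: D_iff)
  then show ?case
    using nfmon assms(2) Floor_nfmon_np[of w s c]
    by (simp add: lb_mult_linear Floor_pscale act_simps ch_closed D_def)
next
  case (add f g)
  then have "lb_mult B f (np s c) \<in> IR" "lb_mult B g (np s c) \<in> IR"
    using IR_mult_left[OF IR_np[OF assms(2)]] by auto
  with add show ?case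
    using assms(2) by (simp add: lb_mult_linear Floor_add act_simps ch_closed)
qed

lemma Floor_right_np:
  assumes "keys x \<subseteq> NF B" "(s, c) \<in> D"
  shows "Floor (lb_mult B (np s c) x) = ract (ch s c) x"
  using assms(1)
proof (induction x rule: nfmon_induct)
  case zero
  then show ?case using assms(2) by (simp add: Floor_zero act_simps ch_closed)
next
  case (nfmon w \<alpha>)
  then have w: "w \<noteq> []" by (simp add: NF_def)
  have "lb_mult B (np s c) (nfmon w) \<in> IR" using nfmon assms(2) w by (intro IR_mult_nfmon IR_np)
  then show ?case
    using nfmon assms(2) w Floor_np_nfmon[of w s c]
    by (simp add: lb_mult_linear Floor_pscale act_simps ch_closed)
next
  case (add f g)
  then have "lb_mult B (np s c) f \<in> IR" "lb_mult B (np s c) g \<in> IR"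
    using IR_mult_right[OF IR_np[OF assms(2)]] by auto
  with add show ?case
    using assms(2) by (simp add: lb_mult_linear Floor_add act_simps ch_closed)
qed

lemma Floor_left:
  assumes "h \<in> IR" "keys x \<subseteq> NF B"
  shows "Floor (lb_mult B x h) = lact x (Floor h)"
  using assms(1)
proof (induction h rule: IR_induct)
  case zero
  then show ?case using assms(2) by (simp add: Floor_zero act_simps)
next
  case (step \<alpha> s c h)
  have "lb_mult B x (np s c) \<in> IR" "lb_mult B x h \<in> IR" "np s c \<in> IR"
    using step assms(2) IR_np[of s c] IR_mult_left[of _ x] by simp_all
  with step show ?case
    using assms(2) Floor_left_np[of x s c]
    by (simp add: lb_mult_linear Floor_add Floor_pscale Floor_np act_simps ch_closed smult_closed Floor_closed IR_subspace)
qed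

lemma Floor_right:
  assumes "h \<in> IR" "keys x \<subseteq> NF B"
  shows "Floor (lb_mult B h x) = ract (Floor h) x"
  using assms(1)
proof (induction h rule: IR_induct)
  case zero
  then show ?case using assms(2) by (simp add: Floor_zero act_simps)
next
  case (step \<alpha> s c h)
  have "lb_mult B (np s c) x \<in> IR" "lb_mult B h x \<in> IR" "np s c \<in> IR"
    using step assms(2) IR_np[of s c] IR_mult_right[of _ x] by simp_all
  with step show ?case
    using assms(2) Floor_right_np[of x s c]
    by (simp add: lb_mult_linear Floor_add Floor_pscale Floor_np act_simps ch_closed smult_closed Floor_closed IR_subspace)
qed

lemma ract_np_carrier:
  assumes "(s, c) \<in> D" "a \<in> carrier \<AA>"
  shows "ract a (np s c) = a \<otimes> ch s c"
  using assms(2)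
proof (induction a rule: part_induct)
  case (part i a)
  then show ?case using assms(1) ract_np by (simp only: D_iff)
next
  case (add x y)
  then show ?case using np_keys[OF assms(1)] ch_closed[OF assms(1)] by (simp add: act_simps mult_add_left)
qed

lemma lact_np_carrier:
  assumes "(s, c) \<in> D" "a \<in> carrier \<AA>"
  shows "lact (np s c) a = ch s c \<otimes> a"
  using assms(2)
proof (induction a rule: part_induct)
  case (part i a)
  then show ?case using assms(1) lact_np by (simp only: D_iff)
next
  case (add x y)
  then show ?case using np_keys[OF assms(1)] ch_closed[OF assms(1)] by (simp add: act_simps mult_add_right)
qed

lemma ract_IR:
  assumes "h \<in> IR" "a \<in> carrier \<AA>"
  shows "ract a h = a \<otimes> Floor h"
  using assms(1)
proof (induction h rule: IR_induct)
  case zero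
  then show ?case using assms(2) by (simp add: Floor_zero act_simps mult_zero_right)
next
  case (step \<alpha> s c h)
  then show ?case
    using assms(2) ract_np_carrier[of s c a] IR_np[of s c]
    by (simp add: Floor_add Floor_pscale Floor_np act_simps IR_keys np_keys keys_pscale_subset ch_closed smult_closed
        Floor_closed IR_subspace mult_add_right mult_smult_right)
qed

lemma lact_IR:
  assumes "h \<in> IR" "a \<in> carrier \<AA>"
  shows "lact h a = Floor h \<otimes> a"
  using assms(1)
proof (induction h rule: IR_induct)
  case zero
  then show ?case using assms(2) by (simp add: Floor_zero act_simps mult_zero_left)
next
  case (step \<alpha> s c h)
  then show ?case
    using assms(2) lact_np_carrier[of s c a] IR_np[of s c]
    by (simp add: Floor_add Floor_pscale Floor_np act_simps IR_keys np_keys keys_pscale_subset ch_closed smult_closed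
        Floor_closed IR_subspace mult_add_left mult_smult_left)
qed

section \<open>The graph ideal of the semidirect product\<close>

abbreviation P :: "('k, 'a \<times> ('b list \<Rightarrow>\<^sub>0 'k)) superalgebra"
  where "P \<equiv> semidirect (Lbs B) \<AA> lact ract"

text \<open>A graph over \<open>IR\<close>: no (a, 0) with nonzero a belongs to it, and every
  element of \<open>IR\<close> occurs as a second component. The first fact will embed \<AA>, the
  second will identify the kernel of the projection.\<close>

definition J :: "('a \<times> ('b list \<Rightarrow>\<^sub>0 'k)) set"
  where "J = (\<lambda>h. (\<ominus> Floor h, h)) ` IR"

lemma J_iff: "(a, h) \<in> J \<longleftrightarrow> h \<in> IR \<and> a = \<ominus> Floor h"
  by (auto simp: J_def)

sublocale P: leibniz_superalgebra P
  by (rule act.leibniz_superalgebra_semidirect)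

text \<open>By \<open>lact_IR\<close> and \<open>ract_IR\<close> an element h of \<open>IR\<close>
  acts on \<AA> as multiplication by its floor. In the first component these terms cancel, and what
  is left is minus the floor of the product in the second component.\<close>

lemma J_mult:
  assumes h: "h \<in> IR" and a: "a \<in> carrier \<AA>" and g: "keys g \<subseteq> NF B"
  shows "(\<ominus> Floor h, h) \<otimes>\<^bsub>P\<^esub> (a, g) \<in> J" "(a, g) \<otimes>\<^bsub>P\<^esub> (\<ominus> Floor h, h) \<in> J"
proof -
  have IR: "lb_mult B h g \<in> IR" "lb_mult B g h \<in> IR"
    using IR_mult_right[OF h] IR_mult_left[OF h] g by simp_all
  have c: "Floor h \<in> carrier \<AA>" "Floor (lb_mult B h g) \<in> carrier \<AA>" "Floor (lb_mult B g h) \<in> carrier \<AA>"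
    using h IR by (simp_all add: Floor_closed)
  have "(\<ominus> Floor h) \<otimes> a \<oplus> ract (\<ominus> Floor h) g \<oplus> lact h a =
      \<ominus> (Floor h \<otimes> a) \<oplus> \<ominus> Floor (lb_mult B h g) \<oplus> Floor h \<otimes> a"
    using c a g h by (simp add: mult_a_inv_left act_simps lact_IR Floor_right)
  also have "\<dots> = \<ominus> Floor (lb_mult B h g)"
    using c a by (simp add: mult_closed a_ac r_neg2 r_neg1)
  finally show "(\<ominus> Floor h, h) \<otimes>\<^bsub>P\<^esub> (a, g) \<in> J"
    using IR by (simp add: J_iff)
  have "a \<otimes> (\<ominus> Floor h) \<oplus> ract a h \<oplus> lact g (\<ominus> Floor h) =
      \<ominus> (a \<otimes> Floor h) \<oplus> a \<otimes> Floor h \<oplus> \<ominus> Floor (lb_mult B g h)"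
    using c a g h by (simp add: mult_a_inv_right act_simps ract_IR Floor_left)
  also have "\<dots> = \<ominus> Floor (lb_mult B g h)"
    using c a by (simp add: mult_closed l_neg)
  finally show "(a, g) \<otimes>\<^bsub>P\<^esub> (\<ominus> Floor h, h) \<in> J"
    using IR by (simp add: J_iff)
qed

lemma J_add: "x \<in> J \<Longrightarrow> y \<in> J \<Longrightarrow> x \<oplus>\<^bsub>P\<^esub> y \<in> J"
  by (cases x; cases y) (simp add: J_iff IR_subspace Floor_add Floor_closed minus_add)

text \<open>A normal polynomial and its floor value have equal parity, so the corresponding point of
  the graph is homogeneous.\<close>

lemma J_graded: "h \<in> IR \<Longrightarrow> P.graded_sum J (\<ominus> Floor h, h)"
proof (induction h rule: IR_induct)
  case zero
  show ?case using P.graded_sum_zero[of J] by (simp add: J_iff IR_subspace Floor_zero a_inv_zero)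
next
  case (step \<alpha> s c h)
  let ?h = "\<alpha> *p np s c"
  have np: "np s c \<in> IR" "?h \<in> IR" using step(1) by (simp_all add: IR_np IR_subspace)
  obtain j where j: "np s c \<in> part (Lbs B) j" "ch s c \<in> part \<AA> j" using np_ch_part[OF step(1)] .
  have "?h \<in> part (Lbs B) j" "Floor ?h \<in> part \<AA> j"
    using L.part_smult[OF j(1), of \<alpha>] part_smult[OF j(2), of \<alpha>] step(1) np
    by (simp_all add: Floor_pscale Floor_np)
  then have "(\<ominus> Floor ?h, ?h) \<in> part P j" unfolding semidirect_simps by (intro SigmaI a_inv_part)
  then have "P.graded_sum J ((\<ominus> Floor ?h, ?h) \<oplus>\<^bsub>P\<^esub> (\<ominus> Floor h, h))"
    using np by (intro P.graded_sum_add[OF J_add _ _ step(3)]) (simp_all only: J_iff simp_thms)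
  then show ?case
    using np step(2) by (simp add: Floor_add minus_add Floor_closed)
qed

lemma super_ideal_J: "super_ideal P J"
  unfolding super_ideal_def
proof (intro conjI ballI allI impI)
  show "J \<subseteq> carrier P"
    using IR_keys Floor_closed by (auto simp: J_def)
  show "\<zero>\<^bsub>P\<^esub> \<in> J"
    by (simp add: J_iff IR_subspace Floor_zero a_inv_zero)
  fix x y assume "x \<in> J" "y \<in> J"
  then show "x \<oplus>\<^bsub>P\<^esub> y \<in> J" by (rule J_add)
next
  fix c x assume "x \<in> J"
  then show "c \<odot>\<^bsub>P\<^esub> x \<in> J"
    by (cases x) (simp add: J_iff IR_subspace Floor_pscale Floor_closed smult_a_inv)
next
  fix x y assume "x \<in> J" "y \<in> carrier P"
  then show "x \<otimes>\<^bsub>P\<^esub> y \<in> J" "y \<otimes>\<^bsub>P\<^esub> x \<in> J"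
    using J_mult[of "snd x" "fst y" "snd y"]
    by (cases x; cases y; simp add: J_iff[of "fst x" "snd x"] del: semidirect_simps(2); simp add: J_iff)+
next
  fix x y assume "x \<in> part P 0" "y \<in> part P 1" "x \<oplus>\<^bsub>P\<^esub> y \<in> J"
  moreover from this(3) obtain h where "h \<in> IR" "x \<oplus>\<^bsub>P\<^esub> y = (\<ominus> Floor h, h)" by (auto simp only: J_def)
  ultimately show "x \<in> J" "y \<in> J"
    using P.graded_sum_components[of x y J] J_graded[of h] by metis+
qed

end

section \<open>The algebra presented by extension data\<close>

lemma letter_parity_eq: "X 0 \<inter> X 1 = {} \<Longrightarrow> b \<in> X i \<Longrightarrow> letter_parity X b = i"
  by (cases i) (auto simp: letter_parity_def)

lemma emb_free_add: "emb_free (f + g) = emb_free f + emb_free g"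
  by (simp add: emb_free_def lin_ext_add)

lemma emb_free_pscale: "emb_free (c *p f) = c *p emb_free f"
  by (simp add: emb_free_def lin_ext_pscale)

lemma emb_free_zero: "emb_free 0 = 0"
  by (simp add: emb_free_def)

lemma emb_free_nfmon: "emb_free (nfmon w) = nfmon (map Inr w)"
  by (simp add: emb_free_def)

lemma emb_free_mult_gen: "emb_free (lb_mult B g (gen b)) = lb_mult X (emb_free g) (gen (Inr b))"
  by (simp add: emb_free_def lb_mult_gen lin_ext_lin_ext)

lemma gset_gplus: "gset (gplus A B) = Inl ` gset A \<union> Inr ` gset B"
  by (auto simp: gset_def gplus_def)

lemma emb_free_keys:
  fixes A :: "bit \<Rightarrow> 'a set" and B :: "bit \<Rightarrow> 'b set" and g :: "'b list \<Rightarrow>\<^sub>0 'k::field"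
  assumes g: "keys g \<subseteq> NF B"
  shows "keys (emb_free g :: ('a + 'b) list \<Rightarrow>\<^sub>0 'k) \<subseteq> NF (gplus A B)"
proof -
  have "keys (emb_free g :: ('a + 'b) list \<Rightarrow>\<^sub>0 'k) = map Inr ` keys g"
    unfolding emb_free_def by (rule keys_lin_ext_inj) (simp add: inj_on_def)
  moreover have "map Inr ` keys g \<subseteq> NF (gplus A B)"
  proof (rule image_subsetI)
    fix w assume "w \<in> keys g"
    then have "w \<in> NF B" using g by blast
    then show "map Inr w \<in> NF (gplus A B)" by (auto simp: NF_def gset_gplus)
  qed
  ultimately show ?thesis by simp
qed

context reduced_relations
begin

sublocale cl: leibniz_hom "Lbs B" "Lbs_rel B R" "Lbs_class B R"
  by (rule leibniz_homI[OF L.leibniz_superalgebra_axioms leibniz_superalgebra_Lbs_rel[OF R_carrier]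
        Lbs_class_hom[OF R_carrier]])

text \<open>Injectivity is \<open>Irr_IR_zero\<close> applied to a difference, surjectivity is
  \<open>reduce\<close>.\<close>

lemma linear_iso_Irr:
  "linear_iso ((Lbs B)\<lparr>carrier := lb.span (nfmon ` Irr B r R)\<rparr>) (Lbs_rel B R) (Lbs_class B R)"
proof -
  have sub: "lb.span (nfmon ` Irr B r R) \<subseteq> carrier (Lbs B :: ('k, _) superalgebra)"
    unfolding span_nfmon using Irr_NF by auto
  have eq: "Lbs_class B R f = Lbs_class B R g \<longleftrightarrow> f - g \<in> IR"
    if "f \<in> carrier (Lbs B)" "g \<in> carrier (Lbs B)" for f g
  proof -
    have "f - g \<in> carrier (Lbs B)"
      using that keys_minus_subset[of f g] by auto
    then show ?thesis
      using cl.eq_iff[OF that] Lbs_class_zero_iff[OF R_carrier, of "f - g"] that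
      by (simp add: a_minus_Lbs super_Id_R)
  qed
  have lin: "linear_map ((Lbs B)\<lparr>carrier := lb.span (nfmon ` Irr B r R)\<rparr>) (Lbs_rel B R) (Lbs_class B R)"
    using sub cl.closed cl.add cl.smult unfolding linear_map_def by (auto simp: subset_iff)
  have inj: "inj_on (Lbs_class B R) (lb.span (nfmon ` Irr B r R))"
  proof (rule inj_onI)
    fix f g assume fg: "f \<in> lb.span (nfmon ` Irr B r R)" "g \<in> lb.span (nfmon ` Irr B r R)"
      "Lbs_class B R f = Lbs_class B R g"
    then have "f - g \<in> IR" using eq sub by blast
    moreover have "keys (f - g) \<subseteq> Irr B r R"
      using lb.span_diff[OF fg(1,2)] by (simp add: span_nfmon)
    ultimately show "f = g" using Irr_IR_zero[of "f - g"] by simp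
  qed
  have "Lbs_class B R ` lb.span (nfmon ` Irr B r R) = carrier (Lbs_rel B R)"
  proof
    show "Lbs_class B R ` lb.span (nfmon ` Irr B r R) \<subseteq> carrier (Lbs_rel B R)"
      using sub cl.closed by auto
    show "carrier (Lbs_rel B R) \<subseteq> Lbs_class B R ` lb.span (nfmon ` Irr B r R)"
    proof
      fix z assume "z \<in> carrier (Lbs_rel B R)"
      then obtain f where f: "f \<in> carrier (Lbs B)" "z = Lbs_class B R f"
        unfolding Lbs_class_surj[OF R_carrier, symmetric] by blast
      obtain d where d: "keys d \<subseteq> Irr B r R" "f - d \<in> IR" using reduce[OF f(1)] .
      then have "d \<in> lb.span (nfmon ` Irr B r R)" by (simp add: span_nfmon)
      with eq[of f d] f d(2) sub show "z \<in> Lbs_class B R ` lb.span (nfmon ` Irr B r R)" by blast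
    qed
  qed
  with lin inj show ?thesis by (simp add: linear_iso_def bij_betw_def)
qed

end

context extension_setup
begin

abbreviation X :: "bit \<Rightarrow> ('a + 'b) set"
  where "X \<equiv> gplus A B"

abbreviation rels :: "(('a + 'b) list \<Rightarrow>\<^sub>0 'k) set"
  where "rels \<equiv> ext_relations \<AA> A B R lact ract fl"

abbreviation K :: "(('a + 'b) list \<Rightarrow>\<^sub>0 'k) set"
  where "K \<equiv> super_Id (Lbs X) rels"

section \<open>The canonical homomorphism to the semidirect product\<close>

definition \<phi> :: "'a + 'b \<Rightarrow> 'a \<times> ('b list \<Rightarrow>\<^sub>0 'k)"
  where "\<phi> = case_sum (\<lambda>a. (a, 0)) (\<lambda>b. (\<zero>, gen b))"

abbreviation \<Phi> :: "(('a + 'b) list \<Rightarrow>\<^sub>0 'k) \<Rightarrow> 'a \<times> ('b list \<Rightarrow>\<^sub>0 'k)"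
  where "\<Phi> \<equiv> P.free_ext \<phi>"

lemma X_disjoint: "X 0 \<inter> X 1 = {}"
  using basis_disjoint B_disjoint by (auto simp: gplus_def)

lemma \<phi>_part: "x \<in> X i \<Longrightarrow> \<phi> x \<in> part P i"
proof -
  assume "x \<in> X i"
  then consider a where "x = Inl a" "a \<in> A i" | b where "x = Inr b" "b \<in> B i"
    by (auto simp: gplus_def)
  then show ?thesis
  proof cases
    case 1
    then show ?thesis using basis_part by (simp add: \<phi>_def)
  next
    case 2
    then have "b \<in> gset B" by (cases i) (auto simp: gset_def)
    then have "gen b \<in> part (Lbs B) i"
      using gen_part[of b] letter_parity_eq[OF B_disjoint 2(2)] by metis
    then show ?thesis unfolding semidirect_simps 2(1) \<phi>_def sum.case by (intro SigmaI part_zero)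
  qed
qed

sublocale \<Phi>: leibniz_hom "Lbs X" P \<Phi>
  by (rule leibniz_homI[OF leibniz_superalgebra_Lbs P.leibniz_superalgebra_axioms
        P.free_ext_hom[OF X_disjoint \<phi>_part]])

lemma \<Phi>_add: "keys f \<subseteq> NF X \<Longrightarrow> keys g \<subseteq> NF X \<Longrightarrow> \<Phi> (f + g) = \<Phi> f \<oplus>\<^bsub>P\<^esub> \<Phi> g"
  using \<Phi>.add[of f g] by simp

lemma \<Phi>_pscale: "keys f \<subseteq> NF X \<Longrightarrow> \<Phi> (c *p f) = c \<odot>\<^bsub>P\<^esub> \<Phi> f"
  using \<Phi>.smult[of f c] by simp

lemma \<Phi>_mult: "keys f \<subseteq> NF X \<Longrightarrow> keys g \<subseteq> NF X \<Longrightarrow> \<Phi> (lb_mult X f g) = \<Phi> f \<otimes>\<^bsub>P\<^esub> \<Phi> g"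
  using \<Phi>.mult[of f g] by simp

lemma \<Phi>_diff: "keys f \<subseteq> NF X \<Longrightarrow> keys g \<subseteq> NF X \<Longrightarrow> \<Phi> (f - g) = \<Phi> f \<ominus>\<^bsub>P\<^esub> \<Phi> g"
  using \<Phi>.minus[of f g] by (simp add: a_minus_Lbs)

lemma X_keys:
  "a \<in> gset A \<Longrightarrow> keys (gen (Inl a) :: _ \<Rightarrow>\<^sub>0 'k) \<subseteq> NF X"
  "b \<in> gset B \<Longrightarrow> keys (gen (Inr b) :: _ \<Rightarrow>\<^sub>0 'k) \<subseteq> NF X"
  "x \<in> carrier \<AA> \<Longrightarrow> keys (emb x :: _ \<Rightarrow>\<^sub>0 'k) \<subseteq> NF X"
  "keys g \<subseteq> NF B \<Longrightarrow> keys (emb_free g :: _ \<Rightarrow>\<^sub>0 'k) \<subseteq> NF X"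
  "keys f \<subseteq> NF X \<Longrightarrow> keys f' \<subseteq> NF X \<Longrightarrow> keys (lb_mult X f f' :: _ \<Rightarrow>\<^sub>0 'k) \<subseteq> NF X"
  "keys f \<subseteq> NF X \<Longrightarrow> keys f' \<subseteq> NF X \<Longrightarrow> keys (f + f' :: _ \<Rightarrow>\<^sub>0 'k) \<subseteq> NF X"
  "keys f \<subseteq> NF X \<Longrightarrow> keys f' \<subseteq> NF X \<Longrightarrow> keys (f - f' :: _ \<Rightarrow>\<^sub>0 'k) \<subseteq> NF X"
  "keys f \<subseteq> NF X \<Longrightarrow> keys (c *p f :: _ \<Rightarrow>\<^sub>0 'k) \<subseteq> NF X"
proof -
  show "a \<in> gset A \<Longrightarrow> keys (gen (Inl a) :: _ \<Rightarrow>\<^sub>0 'k) \<subseteq> NF X" by (simp add: NF_def gset_gplus)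
  show "b \<in> gset B \<Longrightarrow> keys (gen (Inr b) :: _ \<Rightarrow>\<^sub>0 'k) \<subseteq> NF X" by (simp add: NF_def gset_gplus)
  have "(\<lambda>a. [Inl a]) ` gset A \<subseteq> NF X" by (auto simp: NF_def gset_gplus)
  then show "x \<in> carrier \<AA> \<Longrightarrow> keys (emb x :: _ \<Rightarrow>\<^sub>0 'k) \<subseteq> NF X"
    using emb_alg_keys[of x] by (rule subset_trans[rotated])
  show "keys f \<subseteq> NF X \<Longrightarrow> keys f' \<subseteq> NF X \<Longrightarrow> keys (lb_mult X f f' :: _ \<Rightarrow>\<^sub>0 'k) \<subseteq> NF X"
    using lb_mult_closed[of f X f'] by simp
  show "keys f \<subseteq> NF X \<Longrightarrow> keys f' \<subseteq> NF X \<Longrightarrow> keys (f - f' :: _ \<Rightarrow>\<^sub>0 'k) \<subseteq> NF X"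
    using keys_minus_subset[of f f'] by (rule subset_trans[OF _ Un_least])
qed (simp_all add: emb_free_keys keys_add_subset keys_pscale_subset)

lemma \<Phi>_Inl: "a \<in> gset A \<Longrightarrow> \<Phi> (gen (Inl a)) = (a, 0)"
  using P.free_ext_gen[where x = "Inl a", OF X_disjoint \<phi>_part] by (simp add: gset_gplus \<phi>_def)

lemma \<Phi>_Inr: "b \<in> gset B \<Longrightarrow> \<Phi> (gen (Inr b)) = (\<zero>, gen b)"
  using P.free_ext_gen[where x = "Inr b", OF X_disjoint \<phi>_part] by (simp add: gset_gplus \<phi>_def)

lemma \<Phi>_zero: "\<Phi> 0 = (\<zero>, 0)"
  using \<Phi>.zero by simp

lemma \<Phi>_emb_alg: "x \<in> carrier \<AA> \<Longrightarrow> \<Phi> (emb x) = (x, 0)"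
proof (induction x rule: basis_induct)
  case (basis a)
  then show ?case by (simp add: emb_alg_basis \<Phi>_Inl)
next
  case (add x y)
  then show ?case by (simp add: emb_alg_add \<Phi>_add X_keys)
next
  case (smult c x)
  then show ?case by (simp add: emb_alg_smult \<Phi>_pscale X_keys)
qed (simp add: emb_alg_zero \<Phi>_zero)

lemma \<Phi>_emb_free_nfmon: "w \<noteq> [] \<Longrightarrow> w \<in> NF B \<Longrightarrow> \<Phi> (emb_free (nfmon w)) = (\<zero>, nfmon w)"
proof (induction w rule: rev_nonempty_induct)
  case (single b)
  then show ?case by (simp add: emb_free_nfmon \<Phi>_Inr NF_def)
next
  case (snoc b w)
  then have w: "w \<in> NF B" "b \<in> gset B" by (auto simp: NF_def)
  have "\<Phi> (emb_free (nfmon (w @ [b]))) = \<Phi> (emb_free (nfmon w)) \<otimes>\<^bsub>P\<^esub> \<Phi> (gen (Inr b))"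
    unfolding nfmon_snoc[of w b B] emb_free_mult_gen[where X = X]
    using w by (intro \<Phi>_mult X_keys) auto
  also have "\<dots> = (\<zero>, nfmon (w @ [b]))"
    using snoc w by (simp add: \<Phi>_Inr act_simps mult_zero_left lb_mult_nfmon_gen NF_def)
  finally show ?case .
qed

lemma \<Phi>_emb_free: "keys g \<subseteq> NF B \<Longrightarrow> \<Phi> (emb_free g) = (\<zero>, g)"
proof (induction g rule: nfmon_induct)
  case zero
  show ?case by (simp add: emb_free_zero \<Phi>_zero)
next
  case (nfmon w c)
  moreover from nfmon have "w \<noteq> []" by (simp add: NF_def)
  ultimately show ?case
    by (simp add: emb_free_pscale \<Phi>_pscale X_keys \<Phi>_emb_free_nfmon smult_zero)
next
  case (add f g)
  then show ?case by (simp add: emb_free_add \<Phi>_add X_keys)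
qed

lemma \<Phi>_emb: "x \<in> carrier \<AA> \<Longrightarrow> keys g \<subseteq> NF B \<Longrightarrow> \<Phi> (emb x + emb_free g) = (x, g)"
  by (simp add: \<Phi>_add X_keys \<Phi>_emb_alg \<Phi>_emb_free)

lemma fl_closed: "f \<in> R \<Longrightarrow> fl f \<in> carrier \<AA>"
  using ch_closed[of f "[]"] by (simp add: D_iff)

lemma basis_actions:
  "a \<in> gset A \<Longrightarrow> a' \<in> gset A \<Longrightarrow> a \<otimes> a' \<in> carrier \<AA>"
  "a \<in> gset A \<Longrightarrow> b \<in> gset B \<Longrightarrow> ract a (gen b) \<in> carrier \<AA>"
  "a \<in> gset A \<Longrightarrow> \<nu> \<in> NF B \<Longrightarrow> lact (nfmon \<nu>) a \<in> carrier \<AA>"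
  using basis_carrier by (auto intro!: mult_closed act.action_closed simp: NF_def)

lemma rels_carrier: "rels \<subseteq> carrier (Lbs X)"
proof
  have 1: "keys (lb_mult X (gen (Inl a)) (gen (Inl a')) - emb (a \<otimes> a') :: _ \<Rightarrow>\<^sub>0 'k) \<subseteq> NF X"
    if "a \<in> gset A" "a' \<in> gset A" for a a'
    by (intro X_keys basis_actions that)
  have 2: "keys (lb_mult X (gen (Inl a)) (gen (Inr b)) - emb (ract a (gen b))) \<subseteq> NF X"
    if "a \<in> gset A" "b \<in> gset B" for a b
    by (intro X_keys basis_actions that)
  have 3: "keys (lb_mult X (emb_free (nfmon \<nu>)) (gen (Inl a)) - emb (lact (nfmon \<nu>) a)) \<subseteq> NF X"
    if "a \<in> gset A" "\<nu> \<in> NF B" for a \<nu>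
    using that by (intro X_keys basis_actions) simp_all
  have 4: "keys (emb_free f - emb (fl f)) \<subseteq> NF X" if "f \<in> R" for f
    by (intro X_keys R_keys fl_closed that)
  fix x assume "x \<in> rels"
  then have "keys x \<subseteq> NF X"
    unfolding ext_relations_def using 1 2 3 4 by blast
  then show "x \<in> carrier (Lbs X)" by simp
qed

lemma zero_P_J: "(\<zero>, 0) \<in> J"
  using super_idealD(2)[OF super_ideal_J] by simp

text \<open>The first three families express the multiplication rules of the semidirect product and
  map to zero; a relation obtained from \<open>f\<close> in R maps to the point of the graph over
  \<open>f\<close>.\<close>

lemma \<Phi>_rels: "x \<in> rels \<Longrightarrow> \<Phi> x \<in> J"
proof -
  have z: "(x, 0) \<ominus>\<^bsub>P\<^esub> (x, 0) \<in> J" if "x \<in> carrier \<AA>" for x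
    using P.minus_eq_zero_iff[of "(x, 0)" "(x, 0)"] that zero_P_J by simp
  have 1: "\<Phi> (lb_mult X (gen (Inl a)) (gen (Inl a')) - emb (a \<otimes> a')) \<in> J"
    if "a \<in> gset A" "a' \<in> gset A" for a a'
    using that basis_actions z
    by (simp add: \<Phi>_diff \<Phi>_mult X_keys \<Phi>_Inl \<Phi>_emb_alg act_simps basis_carrier del: keys_single)
  have 2: "\<Phi> (lb_mult X (gen (Inl a)) (gen (Inr b)) - emb (ract a (gen b))) \<in> J"
    if "a \<in> gset A" "b \<in> gset B" for a b
    using that basis_actions z
    by (simp add: \<Phi>_diff \<Phi>_mult X_keys \<Phi>_Inl \<Phi>_Inr \<Phi>_emb_alg act_simps basis_carrier mult_zero_right
        del: keys_single)
  have 3: "\<Phi> (lb_mult X (emb_free (nfmon \<nu>)) (gen (Inl a)) - emb (lact (nfmon \<nu>) a)) \<in> J"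
    if "a \<in> gset A" "\<nu> \<in> NF B" for a \<nu>
  proof -
    have k: "keys (nfmon \<nu> :: _ \<Rightarrow>\<^sub>0 'k) \<subseteq> NF B" using that by simp
    then show ?thesis
      using that basis_actions z
      by (simp add: \<Phi>_diff \<Phi>_mult X_keys \<Phi>_Inl \<Phi>_emb_alg \<Phi>_emb_free act_simps basis_carrier mult_zero_left
        del: keys_single)
  qed
  have 4: "\<Phi> (emb_free f - emb (fl f)) \<in> J" if "f \<in> R" for f
  proof -
    have "Floor f = fl f" using Floor_np[of f "[]"] that by (simp add: left_normed_def D_iff)
    moreover have "(\<zero>, f) \<ominus>\<^bsub>P\<^esub> (fl f, 0) = (\<ominus> fl f, f)"
      using act.semidirect_minus[of "\<zero>" "fl f" f 0] fl_closed[OF that] R_keys[OF that]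
      by (simp add: a_minus_Lbs a_minus_def[of \<AA>])
    ultimately show ?thesis
      using that R_keys[OF that] fl_closed[OF that] R_subset_IR
      by (auto simp: \<Phi>_diff X_keys \<Phi>_emb_alg \<Phi>_emb_free J_iff)
  qed
  assume "x \<in> rels"
  then show ?thesis
    unfolding ext_relations_def using 1 2 3 4 by blast
qed

lemma K_ideal: "super_ideal (Lbs X) K"
  by (rule super_ideal_Lbs_Id[OF rels_carrier])

lemma K_subspace:
  "0 \<in> K" "x \<in> K \<Longrightarrow> y \<in> K \<Longrightarrow> x + y \<in> K" "x \<in> K \<Longrightarrow> c *p x \<in> K"
  "x \<in> K \<Longrightarrow> keys z \<subseteq> NF X \<Longrightarrow> lb_mult X x z \<in> K"
  "x \<in> K \<Longrightarrow> keys x \<subseteq> NF X"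
  using super_idealD[OF K_ideal] by auto

lemma K_\<Phi>: "x \<in> K \<Longrightarrow> \<Phi> x \<in> J"
proof -
  have "K \<subseteq> {x \<in> carrier (Lbs X). \<Phi> x \<in> J}"
    using \<Phi>.vimage_ideal[OF super_ideal_J] \<Phi>_rels rels_carrier by (intro super_Id_least) auto
  then show "x \<in> K \<Longrightarrow> \<Phi> x \<in> J" by auto
qed

section \<open>Rewriting modulo the defining relations\<close>

definition cong :: "(('a + 'b) list \<Rightarrow>\<^sub>0 'k) \<Rightarrow> (('a + 'b) list \<Rightarrow>\<^sub>0 'k) \<Rightarrow> bool"  (infix \<open>\<approx>\<close> 50)
  where "x \<approx> y \<longleftrightarrow> x - y \<in> K"

lemma cong_refl: "x \<approx> x"
  by (simp add: cong_def K_subspace)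

lemma cong_trans [trans]: "x \<approx> y \<Longrightarrow> y \<approx> z \<Longrightarrow> x \<approx> z"
  using K_subspace(2)[of "x - y" "y - z"] by (simp add: cong_def)

lemma cong_add: "x \<approx> y \<Longrightarrow> x' \<approx> y' \<Longrightarrow> x + x' \<approx> y + y'"
  using K_subspace(2)[of "x - y" "x' - y'"] by (simp add: cong_def algebra_simps)

lemma cong_pscale: "x \<approx> y \<Longrightarrow> c *p x \<approx> c *p y"
  using K_subspace(3)[of "x - y" c] by (simp add: cong_def lb.scale_right_diff_distrib)

lemma cong_mult: "x \<approx> y \<Longrightarrow> keys z \<subseteq> NF X \<Longrightarrow> lb_mult X x z \<approx> lb_mult X y z"
  using K_subspace(4)[of "x - y" z] by (simp add: cong_def lb_mult_linear)

lemma rels_cong: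
  "a \<in> gset A \<Longrightarrow> a' \<in> gset A \<Longrightarrow> lb_mult X (gen (Inl a)) (gen (Inl a')) \<approx> emb (a \<otimes> a')"
  "a \<in> gset A \<Longrightarrow> b \<in> gset B \<Longrightarrow> lb_mult X (gen (Inl a)) (gen (Inr b)) \<approx> emb (ract a (gen b))"
  "a \<in> gset A \<Longrightarrow> \<nu> \<in> NF B \<Longrightarrow> lb_mult X (emb_free (nfmon \<nu>)) (gen (Inl a)) \<approx> emb (lact (nfmon \<nu>) a)"
  "f \<in> R \<Longrightarrow> emb_free f \<approx> emb (fl f)"
  unfolding cong_def by (rule super_Id_superset[THEN subsetD], subst ext_relations_def, blast)+

lemma emb_alg_mult_Inl:
  assumes "a \<in> gset A" "x \<in> carrier \<AA>"
  shows "lb_mult X (emb x) (gen (Inl a)) \<approx> emb (x \<otimes> a)"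
  using assms(2)
proof (induction x rule: basis_induct)
  case (basis a')
  then show ?case using rels_cong(1) assms(1) by (simp add: emb_alg_basis)
next
  case (add x y)
  then show ?case
    using assms(1) basis_carrier by (simp add: emb_alg_add lb_mult_linear mult_add_left mult_closed cong_add)
next
  case (smult c x)
  then show ?case
    using assms(1) basis_carrier by (simp add: emb_alg_smult lb_mult_linear mult_smult_left mult_closed cong_pscale)
qed (use assms(1) basis_carrier in \<open>simp add: emb_alg_zero mult_zero_left cong_refl\<close>)

lemma emb_alg_mult_Inr:
  assumes "b \<in> gset B" "x \<in> carrier \<AA>"
  shows "lb_mult X (emb x) (gen (Inr b)) \<approx> emb (ract x (gen b))"
proof -
  have b: "[b] \<in> NF B" using assms(1) by (simp add: NF_def)
  show ?thesis
    using assms(2)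
  proof (induction x rule: basis_induct)
    case (basis a')
    then show ?case using rels_cong(2) assms(1) by (simp add: emb_alg_basis)
  next
    case (add x y)
    then show ?case
      using b by (simp add: emb_alg_add lb_mult_linear act_simps cong_add)
  next
    case (smult c x)
    then show ?case
      using b by (simp add: emb_alg_smult lb_mult_linear act_simps cong_pscale)
  qed (use b in \<open>simp add: emb_alg_zero act_simps cong_refl\<close>)
qed

text \<open>A word of B followed by a letter of A is replaced in one step by the relation belonging
  to that whole word, which is why the presentation contains one for each word.\<close>

lemma emb_free_mult_Inl:
  assumes "a \<in> gset A" "keys g \<subseteq> NF B"
  shows "lb_mult X (emb_free g) (gen (Inl a)) \<approx> emb (lact g a)"
  using assms(2)
proof (induction g rule: nfmon_induct)
  case zero
  then show ?case using basis_carrier[OF assms(1)] by (simp add: emb_free_zero act_simps emb_alg_zero cong_refl)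
next
  case (nfmon w c)
  then show ?case
    using basis_carrier[OF assms(1)] rels_cong(3)[OF assms(1) nfmon]
    by (simp add: emb_free_pscale lb_mult_linear act_simps emb_alg_smult cong_pscale)
next
  case (add f g)
  then show ?case
    using basis_carrier[OF assms(1)] by (simp add: emb_free_add lb_mult_linear act_simps emb_alg_add cong_add)
qed

text \<open>The relation for \<open>s\<close> starts the chain; each appended letter is then
  absorbed into \<AA> by a relation for the product of an element of A with a letter of B.\<close>

lemma emb_free_np: "s \<in> R \<Longrightarrow> c \<in> lists (gset B) \<Longrightarrow> emb_free (np s c) \<approx> emb (ch s c)"
proof (induction c rule: rev_induct)
  case Nil
  then show ?case using rels_cong(4) by (simp add: left_normed_def)
next
  case (snoc b c)
  then have *: "b \<in> gset B" "ch s c \<in> carrier \<AA>" "emb_free (np s c) \<approx> emb (ch s c)"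
    using ch_closed[of s c] by (auto simp: D_iff)
  have "lb_mult X (emb_free (np s c)) (gen (Inr b)) \<approx> lb_mult X (emb (ch s c)) (gen (Inr b))"
    using * by (intro cong_mult X_keys)
  also note emb_alg_mult_Inr[OF *(1,2)]
  finally show ?case
    by (simp only: np_snoc ch_snoc emb_free_mult_gen[where X = X])
qed

lemma emb_free_IR: "h \<in> IR \<Longrightarrow> emb_free h \<approx> emb (Floor h)"
proof (induction h rule: IR_induct)
  case zero
  show ?case by (simp add: emb_free_zero Floor_zero emb_alg_zero cong_refl)
next
  case (step \<alpha> s c h)
  then have "emb_free (np s c) \<approx> emb (ch s c)" by (intro emb_free_np) (simp_all add: D_def)
  with step show ?case
    using IR_np[of s c] ch_closed[of s c]
    by (simp add: emb_free_add emb_free_pscale Floor_add Floor_pscale IR_subspace Floor_np emb_alg_add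
        emb_alg_smult smult_closed Floor_closed cong_add cong_pscale)
qed

lemma emb_zero: "emb \<zero> + emb_free 0 = 0"
  by (simp add: emb_alg_zero emb_free_zero)

text \<open>The shape \<open>emb x + emb_free g\<close> survives appending a letter: a letter of A
  sends both summands into \<AA>, while a letter of B acts on \<open>x\<close> and is concatenated
  to the words of \<open>g\<close>.\<close>

lemma nfmon_cong: "w \<noteq> [] \<Longrightarrow> w \<in> NF X \<Longrightarrow>
    \<exists>x g. x \<in> carrier \<AA> \<and> keys g \<subseteq> NF B \<and> nfmon w \<approx> emb x + emb_free g"
proof (induction w rule: rev_nonempty_induct)
  case (single y)
  then consider a where "a \<in> gset A" "y = Inl a" | b where "b \<in> gset B" "y = Inr b"
    by (auto simp: NF_def gset_gplus)
  then show ?case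
  proof cases
    case 1
    then show ?thesis
      using basis_carrier by (intro exI[of _ a] exI[of _ 0]) (simp add: emb_alg_basis emb_free_zero cong_refl)
  next
    case 2
    then show ?thesis
      by (intro exI[of _ "\<zero>"] exI[of _ "gen b"]) (simp add: emb_alg_zero emb_free_nfmon cong_refl NF_def)
  qed
next
  case (snoc y w)
  then have w: "w \<in> NF X" "y \<in> gset X" by (auto simp: NF_def)
  with snoc obtain x g where xg: "x \<in> carrier \<AA>" "keys g \<subseteq> NF B" "nfmon w \<approx> emb x + emb_free g"
    by blast
  have "keys (gen y :: _ \<Rightarrow>\<^sub>0 'k) \<subseteq> NF X" using w by (simp add: NF_def)
  from cong_mult[OF xg(3) this]
  have *: "nfmon (w @ [y]) \<approx> lb_mult X (emb x) (gen y) + lb_mult X (emb_free g) (gen y)"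
    by (simp add: lb_mult_nfmon_gen lb_mult_linear)
  from w(2) consider a where "a \<in> gset A" "y = Inl a" | b where "b \<in> gset B" "y = Inr b"
    by (auto simp: gset_gplus)
  then show ?case
  proof cases
    case 1
    note * also have "lb_mult X (emb x) (gen y) + lb_mult X (emb_free g) (gen y) \<approx>
        emb (x \<otimes> a) + emb (lact g a)"
      unfolding 1(2) by (intro cong_add emb_alg_mult_Inl emb_free_mult_Inl 1 xg)
    finally have "nfmon (w @ [y]) \<approx> emb (x \<otimes> a \<oplus> lact g a) + emb_free 0"
      using xg basis_carrier[OF 1(1)] by (simp add: emb_alg_add mult_closed act_simps emb_free_zero)
    then show ?thesis
      using xg basis_carrier[OF 1(1)]
      by (intro exI[of _ "x \<otimes> a \<oplus> lact g a"] exI[of _ 0]) (simp add: mult_closed act_simps)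
  next
    case 2
    then have b: "[b] \<in> NF B" by (simp add: NF_def)
    note * also have "lb_mult X (emb x) (gen y) + lb_mult X (emb_free g) (gen y) \<approx>
        emb (ract x (gen b)) + emb_free (lb_mult B g (gen b))"
      unfolding 2(2) emb_free_mult_gen[where X = X] by (intro cong_add cong_refl emb_alg_mult_Inr 2 xg)
    finally show ?thesis
      using xg b lb_mult_closed[of g B "gen b"]
      by (intro exI[of _ "ract x (gen b)"] exI[of _ "lb_mult B g (gen b)"]) (simp add: act_simps)
  qed
qed

lemma emb_cong:
  assumes "keys w \<subseteq> NF X"
  shows "\<exists>x g. x \<in> carrier \<AA> \<and> keys g \<subseteq> NF B \<and> w \<approx> emb x + emb_free g"
  using assms
proof (induction w rule: nfmon_induct)
  case zero
  show ?case by (intro exI[of _ "\<zero>"] exI[of _ 0]) (simp add: emb_zero cong_refl)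
next
  case (nfmon w c)
  then have "w \<noteq> []" by (simp add: NF_def)
  with nfmon obtain x g where xg: "x \<in> carrier \<AA>" "keys g \<subseteq> NF B" "nfmon w \<approx> emb x + emb_free g"
    using nfmon_cong by blast
  from cong_pscale[OF xg(3), of c] xg show ?case
    by (intro exI[of _ "c \<odot> x"] exI[of _ "c *p g"])
      (simp add: smult_closed keys_pscale_subset emb_alg_smult emb_free_pscale lb.scale_right_distrib)
next
  case (add f f')
  then obtain x g x' g' where xg: "x \<in> carrier \<AA>" "keys g \<subseteq> NF B" "f \<approx> emb x + emb_free g"
    "x' \<in> carrier \<AA>" "keys g' \<subseteq> NF B" "f' \<approx> emb x' + emb_free g'" by blast
  from cong_add[OF xg(3,6)] xg show ?case
    by (intro exI[of _ "x \<oplus> x'"] exI[of _ "g + g'"])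
      (simp add: keys_add_subset emb_alg_add emb_free_add ac_simps)
qed

text \<open>Beyond \<open>emb_cong\<close>, the part of \<open>g\<close> lying in the ideal is
  traded for its floor, which joins the component in \<AA>.\<close>

lemma Irr_cong:
  assumes "keys w \<subseteq> NF X"
  obtains x g where "x \<in> carrier \<AA>" "keys g \<subseteq> Irr B r R" "w \<approx> emb x + emb_free g"
proof -
  obtain x g where xg: "x \<in> carrier \<AA>" "keys g \<subseteq> NF B" "w \<approx> emb x + emb_free g"
    using emb_cong[OF assms] by blast
  then have "g \<in> carrier (Lbs B)" by simp
  then obtain d where d: "keys d \<subseteq> Irr B r R" "g - d \<in> IR" by (rule reduce)
  have "(emb_free g :: ('a + 'b) list \<Rightarrow>\<^sub>0 'k) = emb_free (g - d) + emb_free d" by (simp flip: emb_free_add)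
  with xg(3) have "w \<approx> emb x + (emb_free (g - d) + emb_free d)" by simp
  also have "emb x + (emb_free (g - d) + emb_free d) \<approx>
      emb x + (emb (Floor (g - d)) + emb_free d)"
    by (intro cong_add cong_refl emb_free_IR d)
  also have "emb x + (emb (Floor (g - d)) + emb_free d) =
      emb (x \<oplus> Floor (g - d)) + emb_free d"
    using xg d by (simp add: emb_alg_add Floor_closed add.assoc)
  finally show thesis
    using that[of "x \<oplus> Floor (g - d)" d] xg d by (simp add: Floor_closed)
qed

lemma K_iff:
  assumes w: "keys w \<subseteq> NF X"
  shows "w \<in> K \<longleftrightarrow> \<Phi> w \<in> J"
proof
  assume J: "\<Phi> w \<in> J"
  obtain x g where xg: "x \<in> carrier \<AA>" "keys g \<subseteq> Irr B r R" "w \<approx> emb x + emb_free g"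
    using Irr_cong[OF w] .
  then have g: "keys g \<subseteq> NF B" using Irr_NF by blast
  let ?v = "emb x + emb_free g"
  have v: "keys ?v \<subseteq> NF X" using xg(1) g by (simp add: X_keys)
  have "\<Phi> (w - ?v) \<in> J" using xg(3) K_\<Phi> by (simp add: cong_def)
  then have "\<Phi> w \<ominus>\<^bsub>P\<^esub> \<Phi> (w - ?v) \<in> J" using J by (intro P.ideal_minus[OF super_ideal_J])
  moreover have "\<Phi> w \<ominus>\<^bsub>P\<^esub> \<Phi> (w - ?v) = \<Phi> ?v"
    using \<Phi>_diff[OF w X_keys(7)[OF w v]] by (simp only: diff_diff_eq2 add_diff_cancel_left')
  ultimately have "(x, g) \<in> J" using \<Phi>_emb[OF xg(1) g] by simp
  then have "g \<in> IR" "x = \<ominus> Floor g" by (simp_all add: J_iff)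
  \<comment> \<open>A point of the graph is determined by its second component, and an irreducible
    combination in the ideal vanishes; so the normal form of \<open>w\<close> is zero.\<close>
  then have "g = 0" "x = \<zero>" using Irr_IR_zero[OF xg(2)] by (simp_all add: Floor_zero a_inv_zero)
  with xg(3) show "w \<in> K" by (simp add: cong_def emb_zero)
qed (rule K_\<Phi>)

section \<open>The presented algebra as a quotient of the semidirect product\<close>

abbreviation Ext :: "('k, (('a + 'b) list \<Rightarrow>\<^sub>0 'k) set) superalgebra"
  where "Ext \<equiv> ext_algebra \<AA> A B R lact ract fl"

abbreviation cls :: "(('a + 'b) list \<Rightarrow>\<^sub>0 'k) \<Rightarrow> (('a + 'b) list \<Rightarrow>\<^sub>0 'k) set"
  where "cls \<equiv> ext_class \<AA> A B R lact ract fl"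

lemma leibniz_superalgebra_Ext: "leibniz_superalgebra Ext"
  unfolding ext_algebra_def by (rule leibniz_superalgebra_Lbs_rel[OF rels_carrier])

sublocale q: leibniz_hom "Lbs X" Ext cls
  unfolding ext_algebra_def ext_class_def
  by (rule leibniz_homI[OF leibniz_superalgebra_Lbs leibniz_superalgebra_Lbs_rel[OF rels_carrier]
        Lbs_class_hom[OF rels_carrier]])

lemma cls_surj: "cls ` carrier (Lbs X) = carrier Ext"
  unfolding ext_algebra_def ext_class_def by (rule Lbs_class_surj[OF rels_carrier])

lemma cls_zero_iff: "keys f \<subseteq> NF X \<Longrightarrow> cls f = \<zero>\<^bsub>Ext\<^esub> \<longleftrightarrow> \<Phi> f \<in> J"
  using Lbs_class_zero_iff[OF rels_carrier, of f] K_iff[of f]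
  by (simp add: ext_algebra_def ext_class_def)

text \<open>Equality of classes becomes a computation with pairs, in which the generated ideal no
  longer appears.\<close>

lemma cls_eq_iff:
  assumes "keys f \<subseteq> NF X" "keys g \<subseteq> NF X"
  shows "cls f = cls g \<longleftrightarrow> \<Phi> f \<ominus>\<^bsub>P\<^esub> \<Phi> g \<in> J"
  using q.eq_iff[of f g] cls_zero_iff[of "f - g"] assms by (simp add: a_minus_Lbs X_keys \<Phi>_diff)

lemma cls_eqI: "keys f \<subseteq> NF X \<Longrightarrow> keys g \<subseteq> NF X \<Longrightarrow> \<Phi> f = \<Phi> g \<Longrightarrow> cls f = cls g"
  using cls_eq_iff[of f g] P.minus_eq_zero_iff[of "\<Phi> f" "\<Phi> g"] \<Phi>.closed[of f] zero_P_J
  by (simp del: semidirect_simps(1))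

lemma minus_J_iff:
  assumes "x \<in> carrier \<AA>" "y \<in> carrier \<AA>" "keys g \<subseteq> NF B" "keys h \<subseteq> NF B"
  shows "(x, g) \<ominus>\<^bsub>P\<^esub> (y, h) \<in> J \<longleftrightarrow> g - h \<in> IR \<and> x \<ominus> y = \<ominus> Floor (g - h)"
  using assms by (simp add: act.semidirect_minus a_minus_Lbs J_iff)

lemma cls_add: "keys f \<subseteq> NF X \<Longrightarrow> keys g \<subseteq> NF X \<Longrightarrow> cls (f + g) = cls f \<oplus>\<^bsub>Ext\<^esub> cls g"
  using q.add[of f g] by simp

lemma cls_pscale: "keys f \<subseteq> NF X \<Longrightarrow> cls (c *p f) = c \<odot>\<^bsub>Ext\<^esub> cls f"
  using q.smult[of f c] by simp

lemma cls_mult: "keys f \<subseteq> NF X \<Longrightarrow> keys g \<subseteq> NF X \<Longrightarrow> cls (lb_mult X f g) = cls f \<otimes>\<^bsub>Ext\<^esub> cls g"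
  using q.mult[of f g] by simp

lemma cls_closed: "keys f \<subseteq> NF X \<Longrightarrow> cls f \<in> carrier Ext"
  using q.closed[of f] by simp

subsection \<open>The underlying vector space and the multiplication\<close>

lemma linear_iso_Ext:
  "linear_iso (direct_sum \<AA> ((Lbs B)\<lparr>carrier := lb.span (nfmon ` Irr B r R)\<rparr>)) Ext
    (\<lambda>(x, g). cls (emb x + emb_free g))"
proof -
  let ?S = "{g :: 'b list \<Rightarrow>\<^sub>0 'k. keys g \<subseteq> Irr B r R}"
  let ?M = "direct_sum \<AA> ((Lbs B)\<lparr>carrier := lb.span (nfmon ` Irr B r R)\<rparr>)"
  let ?h = "\<lambda>(x, g). cls (emb x + emb_free g)"
  have NF: "keys g \<subseteq> NF B" if "keys g \<subseteq> Irr B r R" for g :: "'b list \<Rightarrow>\<^sub>0 'k"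
    using that Irr_NF by (rule subset_trans)
  have hcl: "cls (emb x + emb_free g) \<in> carrier Ext" if "x \<in> carrier \<AA>" "keys g \<subseteq> Irr B r R" for x g
    using that by (intro cls_closed X_keys NF)
  have M: "carrier ?M = carrier \<AA> \<times> ?S" "(x, g) \<oplus>\<^bsub>?M\<^esub> (x', g') = (x \<oplus> x', g + g')"
    "c \<odot>\<^bsub>?M\<^esub> (x, g) = (c \<odot> x, c *p g)" for x g x' g' c
    by (simp_all add: direct_sum_def span_nfmon)
  have "linear_map ?M Ext ?h"
    unfolding linear_map_def
  proof (intro conjI ballI allI)
    show "?h \<in> carrier ?M \<rightarrow> carrier Ext"
      unfolding M by (auto simp: hcl)
    fix p q c assume "p \<in> carrier ?M"
    then obtain x g where p: "p = (x, g)" "x \<in> carrier \<AA>" "keys g \<subseteq> Irr B r R" unfolding M by auto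
    note p' = X_keys(3)[OF p(2)] X_keys(4)[OF NF[OF p(3)]]
    have "emb (c \<odot> x) + emb_free (c *p g) = c *p (emb x + emb_free g :: ('a + 'b) list \<Rightarrow>\<^sub>0 'k)"
      using p by (simp add: emb_alg_smult emb_free_pscale lb.scale_right_distrib)
    then show "?h (c \<odot>\<^bsub>?M\<^esub> p) = c \<odot>\<^bsub>Ext\<^esub> ?h p"
      unfolding p M using cls_pscale[OF X_keys(6)[OF p']] by simp
    assume "q \<in> carrier ?M"
    then obtain y h where q: "q = (y, h)" "y \<in> carrier \<AA>" "keys h \<subseteq> Irr B r R" unfolding M by auto
    note q' = X_keys(3)[OF q(2)] X_keys(4)[OF NF[OF q(3)]]
    have "emb (x \<oplus> y) + emb_free (g + h) =
        (emb x + emb_free g) + (emb y + emb_free h :: ('a + 'b) list \<Rightarrow>\<^sub>0 'k)"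
      using p q by (simp add: emb_alg_add emb_free_add ac_simps)
    then show "?h (p \<oplus>\<^bsub>?M\<^esub> q) = ?h p \<oplus>\<^bsub>Ext\<^esub> ?h q"
      unfolding p q M using cls_add[OF X_keys(6)[OF p'] X_keys(6)[OF q']] by simp
  qed
  moreover have "inj_on ?h (carrier ?M)"
  proof (rule inj_onI)
    fix p q assume pq: "p \<in> carrier ?M" "q \<in> carrier ?M" "?h p = ?h q"
    then obtain x g y h where p: "p = (x, g)" "x \<in> carrier \<AA>" "keys g \<subseteq> Irr B r R"
      and q: "q = (y, h)" "y \<in> carrier \<AA>" "keys h \<subseteq> Irr B r R" unfolding M by auto
    have "\<Phi> (emb x + emb_free g) \<ominus>\<^bsub>P\<^esub> \<Phi> (emb y + emb_free h) \<in> J"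
      using pq(3) p q NF by (simp add: X_keys cls_eq_iff)
    then have *: "g - h \<in> IR" "x \<ominus> y = \<ominus> Floor (g - h)"
      using p q NF by (simp_all add: \<Phi>_emb minus_J_iff)
    have "keys (g - h) \<subseteq> Irr B r R" using keys_minus_subset[of g h] p q by blast
    with *(1) have "g - h = 0" by (intro Irr_IR_zero)
    with * show "p = q" using p q by (simp add: Floor_zero a_inv_zero minus_eq_zero_iff)
  qed
  moreover have "?h ` carrier ?M = carrier Ext"
  proof
    show "?h ` carrier ?M \<subseteq> carrier Ext"
      unfolding M by (auto simp: hcl)
    show "carrier Ext \<subseteq> ?h ` carrier ?M"
    proof
      fix z assume "z \<in> carrier Ext"
      then obtain w where w: "keys w \<subseteq> NF X" "z = cls w" unfolding cls_surj[symmetric] by auto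
      obtain x g where xg: "x \<in> carrier \<AA>" "keys g \<subseteq> Irr B r R" "w \<approx> emb x + emb_free g"
        using Irr_cong[OF w(1)] .
      have "z = cls (emb x + emb_free g)"
        unfolding w(2) using xg w(1) NF K_\<Phi> by (simp add: cls_eq_iff X_keys cong_def flip: \<Phi>_diff)
      then show "z \<in> ?h ` carrier ?M"
        unfolding M using xg by (intro image_eqI[of _ _ "(x, g)"]) auto
    qed
  qed
  ultimately show ?thesis by (simp add: linear_iso_def bij_betw_def)
qed

text \<open>\<open>d\<close> is the irreducible remainder of the product of the two words and
  \<open>ts\<close> the normal expression of the rest. Two remainders differ by an irreducible
  combination lying in the ideal, which gives uniqueness of \<open>d\<close> and then of
  \<open>ts\<close>.\<close>

lemma Ext_mult:
  assumes a: "a \<in> gset A" "a' \<in> gset A" and \<nu>: "\<nu> \<in> Irr B r R" "\<nu>' \<in> Irr B r R"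
  shows "\<exists>d ts.
    (d \<in> lb.span (nfmon ` Irr B r R) \<and>
     is_normal_expr B r R (lb_mult B (nfmon \<nu>) (nfmon \<nu>') - d) ts) \<and>
    (\<forall>d' ts'. d' \<in> lb.span (nfmon ` Irr B r R) \<and>
       is_normal_expr B r R (lb_mult B (nfmon \<nu>) (nfmon \<nu>') - d') ts' \<longrightarrow> d' = d \<and> ts' = ts) \<and>
    cls (gen (Inl a) + emb_free (nfmon \<nu>)) \<otimes>\<^bsub>Ext\<^esub> cls (gen (Inl a') + emb_free (nfmon \<nu>')) =
    cls (emb (a \<otimes> a') + emb (ract a (nfmon \<nu>')) +
       emb (lact (nfmon \<nu>) a') + emb (floor_expr \<AA> ract fl ts) + emb_free d)"
proof -
  let ?m = "lb_mult B (nfmon \<nu>) (nfmon \<nu>') :: 'b list \<Rightarrow>\<^sub>0 'k"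
  have k: "keys (nfmon \<nu> :: _ \<Rightarrow>\<^sub>0 'k) \<subseteq> NF B" "keys (nfmon \<nu>' :: _ \<Rightarrow>\<^sub>0 'k) \<subseteq> NF B"
    using \<nu> Irr_NF by auto
  then have m: "?m \<in> carrier (Lbs B)" using lb_mult_closed[of "nfmon \<nu>" B "nfmon \<nu>'"] by simp
  obtain d where d: "keys d \<subseteq> Irr B r R" "?m - d \<in> IR" using reduce[OF m] .
  then have dNF: "keys d \<subseteq> NF B" using Irr_NF by blast
  define ts where "ts = normal_expr B r R (?m - d)"
  have ts: "valid_terms ts" "expr_sum ts = ?m - d"
    unfolding ts_def using normal_expr[OF d(2)] by auto
  have uniq: "d' = d \<and> ts' = ts" if "keys d' \<subseteq> Irr B r R" "valid_terms ts'" "?m - d' = expr_sum ts'" for d' ts'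
  proof -
    have "?m - d' \<in> IR" unfolding that(3) using that(2) by (intro expr_sum_IR) (auto simp: valid_terms_def)
    from IR_subspace(4)[OF d(2) this] have "d' - d \<in> IR" by simp
    moreover have "keys (d' - d) \<subseteq> Irr B r R" using keys_minus_subset[of d' d] that d by blast
    ultimately have "d' = d" using Irr_IR_zero[of "d' - d"] by simp
    moreover from this have "expr_sum ts' = expr_sum ts" using that(3) ts(2) by metis
    ultimately show ?thesis using valid_terms_unique[OF that(2) ts(1)] by blast
  qed
  define F where "F = floor_expr \<AA> ract fl ts"
  have F: "F = Floor (?m - d)" "F \<in> carrier \<AA>"
    unfolding F_def floor_expr_valid[OF ts(1)] ts(2) using Floor_closed[OF d(2)] by auto
  have ac: "a \<in> carrier \<AA>" "a' \<in> carrier \<AA>" using a basis_carrier by auto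
  define S where "S = a \<otimes> a' \<oplus> ract a (nfmon \<nu>') \<oplus> lact (nfmon \<nu>) a'"
  have Sc: "a \<otimes> a' \<in> carrier \<AA>" "ract a (nfmon \<nu>') \<in> carrier \<AA>" "lact (nfmon \<nu>) a' \<in> carrier \<AA>" "S \<in> carrier \<AA>"
    unfolding S_def using ac k by (simp_all add: mult_closed act_simps del: keys_single)
  let ?u = "gen (Inl a) + emb_free (nfmon \<nu>) :: ('a + 'b) list \<Rightarrow>\<^sub>0 'k"
  let ?u' = "gen (Inl a') + emb_free (nfmon \<nu>') :: ('a + 'b) list \<Rightarrow>\<^sub>0 'k"
  let ?v = "emb (a \<otimes> a') + emb (ract a (nfmon \<nu>')) +
       emb (lact (nfmon \<nu>) a') + emb F + emb_free d :: ('a + 'b) list \<Rightarrow>\<^sub>0 'k"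
  have u: "keys ?u \<subseteq> NF X" "keys ?u' \<subseteq> NF X" by (intro X_keys a k)+
  have v: "?v = emb (S \<oplus> F) + emb_free d"
    using Sc F unfolding S_def by (simp add: emb_alg_add)
  have "\<Phi> ?u = (a, nfmon \<nu>)" "\<Phi> ?u' = (a', nfmon \<nu>')"
    using \<Phi>_emb[OF ac(1) k(1)] \<Phi>_emb[OF ac(2) k(2)] a by (simp_all add: emb_alg_basis)
  then have "\<Phi> (lb_mult X ?u ?u') = (S, ?m)"
    using \<Phi>_mult[OF u] by (simp add: S_def)
  moreover have "\<Phi> ?v = (S \<oplus> F, d)"
    unfolding v using Sc F dNF by (intro \<Phi>_emb) auto
  \<comment> \<open>The two sides differ in the semidirect product by the pair of -F and the product
    minus \<open>d\<close>. As F is the floor of that second component, the pair lies on the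
    graph.\<close>
  moreover have "S \<ominus> (S \<oplus> F) = \<ominus> F"
    using Sc F(2) by (simp add: a_minus_def minus_add r_neg2 r_neg1)
  ultimately have "\<Phi> (lb_mult X ?u ?u') \<ominus>\<^bsub>P\<^esub> \<Phi> ?v \<in> J"
    using Sc(4) F d(2) m dNF by (simp add: minus_J_iff)
  moreover have "keys ?v \<subseteq> NF X" using Sc F(2) dNF by (intro X_keys)
  ultimately have "cls (lb_mult X ?u ?u') = cls ?v"
    using X_keys(5)[OF u] by (simp add: cls_eq_iff)
  then have "cls ?u \<otimes>\<^bsub>Ext\<^esub> cls ?u' = cls ?v" using cls_mult[OF u] by simp
  note eq = this[unfolded F_def]
  show ?thesis
    unfolding span_nfmon is_normal_expr_iff mem_Collect_eq
  proof (intro exI[of _ d] exI[of _ ts] conjI allI impI)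
    show "?m - d = expr_sum ts" using ts(2) by simp
    fix d' ts' assume "keys d' \<subseteq> Irr B r R \<and> valid_terms ts' \<and> ?m - d' = expr_sum ts'"
    with uniq show "d' = d" "ts' = ts" by blast+
  qed (rule d ts eq)+
qed

subsection \<open>The extension\<close>

text \<open>By uniqueness, coordinates over the whole basis agree with those over
  \<open>A i\<close>, so only letters of parity i occur.\<close>

lemma emb_alg_part: "x \<in> part \<AA> i \<Longrightarrow> emb x \<in> part (Lbs X) i"
proof -
  assume "x \<in> part \<AA> i"
  then obtain c where c: "keys c \<subseteq> A i" "x = lsum (\<lambda>a. a) c"
    using basis[of i] unfolding linear_basis_def lin_comb_lsum by blast
  have Ai: "A i \<subseteq> gset A" by (cases i) (auto simp: gset_def)
  then have "coords x = c" using c coords_eqI[of c] by auto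
  moreover have "[Inl a] \<in> NF X \<and> parity X [Inl a] = i" if "a \<in> A i" for a
  proof -
    have "Inl a \<in> X i" using that by (simp add: gplus_def)
    then show ?thesis
      using letter_parity_eq[OF X_disjoint, of "Inl a" i] that Ai
      unfolding parity_single NF_def gset_gplus by auto
  qed
  ultimately show ?thesis
    unfolding Lbs_simps emb_alg_def mem_Collect_eq
    using keys_lin_ext[of "\<lambda>a. gen (Inl a) :: ('a + 'b) list \<Rightarrow>\<^sub>0 'k" c] c(1)
    by (intro subset_trans[OF keys_lin_ext]) auto
qed

lemma emb_alg_hom: "superalgebra_hom \<AA> Ext (\<lambda>x. cls (emb x))"
  unfolding superalgebra_hom_def linear_map_def
proof (intro conjI ballI allI image_subsetI)
  show "(\<lambda>x. cls (emb x)) \<in> carrier \<AA> \<rightarrow> carrier Ext"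
    by (auto intro!: cls_closed X_keys)
  show "cls (emb x) \<in> part Ext i" if "x \<in> part \<AA> i" for x i
    by (rule q.part[OF emb_alg_part[OF that]])
  fix x y c assume x: "x \<in> carrier \<AA>"
  then show "cls (emb (c \<odot> x)) = c \<odot>\<^bsub>Ext\<^esub> cls (emb x)"
    by (simp add: emb_alg_smult cls_pscale X_keys)
  assume y: "y \<in> carrier \<AA>"
  with x show "cls (emb (x \<oplus> y)) = cls (emb x) \<oplus>\<^bsub>Ext\<^esub> cls (emb y)"
    by (simp add: emb_alg_add cls_add X_keys)
  have "cls (emb (x \<otimes> y)) = cls (lb_mult X (emb x) (emb y))"
    using x y by (intro cls_eqI X_keys) (simp_all add: mult_closed \<Phi>_emb_alg \<Phi>_mult X_keys act_simps)
  then show "cls (emb (x \<otimes> y)) = cls (emb x) \<otimes>\<^bsub>Ext\<^esub> cls (emb y)"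
    using x y by (simp add: cls_mult X_keys)
qed

lemma snd_hom: "superalgebra_hom P (Lbs B) snd"
  by (auto simp: superalgebra_hom_def linear_map_def simp del: Lbs_simps(5))

text \<open>Forgetting the component in \<AA> and passing to classes kills \<open>J\<close>, whose
  second components lie in \<open>IR\<close>; hence the composite factors through the presented
  algebra.\<close>

lemma Ext_projection:
  obtains \<pi> where "superalgebra_hom Ext (Lbs_rel B R) \<pi>"
    "\<And>w. keys w \<subseteq> NF X \<Longrightarrow> \<pi> (cls w) = Lbs_class B R (snd (\<Phi> w))"
proof -
  have "superalgebra_hom (Lbs X) (Lbs_rel B R) (\<lambda>w. Lbs_class B R (snd (\<Phi> w)))"
    by (rule superalgebra_hom_comp[OF superalgebra_hom_comp[OF \<Phi>.hom snd_hom] Lbs_class_hom[OF R_carrier]])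
  moreover have "Lbs_class B R (snd (\<Phi> w)) = \<zero>\<^bsub>Lbs_rel B R\<^esub>"
    if w: "w \<in> carrier (Lbs X)" "cls w = \<zero>\<^bsub>Ext\<^esub>" for w
  proof -
    have "\<Phi> w \<in> J" using w cls_zero_iff by simp
    then have "snd (\<Phi> w) \<in> IR" by (auto simp: J_def)
    then show ?thesis using Lbs_class_zero_iff[OF R_carrier] IR_carrier super_Id_R by blast
  qed
  ultimately obtain \<pi> where \<pi>: "superalgebra_hom Ext (Lbs_rel B R) \<pi>"
    "\<And>w. w \<in> carrier (Lbs X) \<Longrightarrow> \<pi> (cls w) = Lbs_class B R (snd (\<Phi> w))"
    using superalgebra_hom_factor[OF leibniz_superalgebra_Lbs leibniz_superalgebra_Ext
        leibniz_superalgebra_Lbs_rel[OF R_carrier] q.hom cls_surj] by blast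
  show thesis by (rule that[of \<pi>]) (use \<pi> in simp_all)
qed

text \<open>For h in \<open>IR\<close> the pairs (x, h) and (x + \<open>Floor h\<close>, 0) differ
  by a point of the graph, so a class in the kernel is represented by an element of \<AA>.\<close>

lemma Ext_kernel:
  assumes z: "z \<in> carrier Ext" and \<pi>: "\<And>w. keys w \<subseteq> NF X \<Longrightarrow> \<pi> (cls w) = Lbs_class B R (snd (\<Phi> w))"
    and 0: "\<pi> z = \<zero>\<^bsub>Lbs_rel B R\<^esub>"
  shows "\<exists>x\<in>carrier \<AA>. z = cls (emb x)"
proof -
  obtain w where w: "keys w \<subseteq> NF X" "z = cls w" using z unfolding cls_surj[symmetric] by auto
  obtain x h where \<Phi>w: "\<Phi> w = (x, h)" by (cases "\<Phi> w")
  have xh: "x \<in> carrier \<AA>" "keys h \<subseteq> NF B" using \<Phi>.closed[of w] w \<Phi>w by auto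
  have "Lbs_class B R h = \<zero>\<^bsub>Lbs_rel B R\<^esub>" using 0 \<pi>[OF w(1)] w(2) \<Phi>w by simp
  then have h: "h \<in> IR" using Lbs_class_zero_iff[OF R_carrier, of h] xh(2) super_Id_R by simp
  then have F: "Floor h \<in> carrier \<AA>" by (rule Floor_closed)
  have "x \<ominus> (x \<oplus> Floor h) = \<ominus> Floor h"
    using xh(1) F by (simp add: a_minus_def minus_add r_neg2 r_neg1)
  then have "\<Phi> w \<ominus>\<^bsub>P\<^esub> \<Phi> (emb (x \<oplus> Floor h)) \<in> J"
    using xh h F \<Phi>w by (simp add: \<Phi>_emb_alg minus_J_iff)
  then have "z = cls (emb (x \<oplus> Floor h))"
    using w xh F by (simp add: cls_eq_iff X_keys)
  with xh F show ?thesis by blast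
qed

lemma is_extension_Ext:
  fixes \<EE> :: "('k, 'e) superalgebra"
  assumes E: "leibniz_superalgebra \<EE>" and iso: "superalgebra_isomorphic \<EE> Ext"
  shows "is_extension \<EE> (Lbs_rel B R) \<AA>"
proof -
  obtain \<theta> where \<theta>: "superalgebra_hom \<EE> Ext \<theta>" "bij_betw \<theta> (carrier \<EE>) (carrier Ext)"
    using iso by (auto simp: superalgebra_isomorphic_def)
  interpret \<theta>: leibniz_hom \<EE> Ext \<theta>
    by (rule leibniz_homI[OF E leibniz_superalgebra_Ext \<theta>(1)])
  obtain \<pi> where \<pi>: "superalgebra_hom Ext (Lbs_rel B R) \<pi>"
    "\<And>w. keys w \<subseteq> NF X \<Longrightarrow> \<pi> (cls w) = Lbs_class B R (snd (\<Phi> w))"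
    using Ext_projection by blast
  let ?\<tau> = "inv_into (carrier \<EE>) \<theta>"
  let ?em = "\<lambda>x. cls (emb x) :: (('a + 'b) list \<Rightarrow>\<^sub>0 'k) set"
  let ?\<iota> = "\<lambda>x. ?\<tau> (?em x)"
  let ?\<pi> = "\<lambda>e. \<pi> (\<theta> e)"
  have \<tau>: "\<theta> (?\<tau> z) = z" "?\<tau> z \<in> carrier \<EE>" if "z \<in> carrier Ext" for z
    using that \<theta>(2) by (auto simp: bij_betw_def inv_into_into f_inv_into_f)
  have em: "?em x \<in> carrier Ext" if "x \<in> carrier \<AA>" for x
    using that by (intro cls_closed X_keys)
  have zero: "\<pi> (?em x) = \<zero>\<^bsub>Lbs_rel B R\<^esub>" if "x \<in> carrier \<AA>" for x
    using that \<pi>(2)[of "emb x"] Lbs_class_zero_iff[OF R_carrier, of 0] super_Id_R IR_subspace(1)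
    by (simp add: X_keys \<Phi>_emb_alg)
  have "inj_on ?\<iota> (carrier \<AA>)"
  proof (rule inj_onI)
    fix x y assume xy: "x \<in> carrier \<AA>" "y \<in> carrier \<AA>" "?\<iota> x = ?\<iota> y"
    then have "?em x = ?em y" using \<tau>(1) em by metis
    then have "(x, 0) \<ominus>\<^bsub>P\<^esub> (y, 0) \<in> J" using xy by (simp add: cls_eq_iff X_keys \<Phi>_emb_alg)
    then show "x = y" using xy by (simp add: minus_J_iff Floor_zero a_inv_zero minus_eq_zero_iff)
  qed
  moreover have "?\<pi> ` carrier \<EE> = carrier (Lbs_rel B R)"
  proof
    show "?\<pi> ` carrier \<EE> \<subseteq> carrier (Lbs_rel B R)"
      using \<pi>(1) \<theta>.closed by (auto simp: superalgebra_hom_def linear_map_def)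
    show "carrier (Lbs_rel B R) \<subseteq> ?\<pi> ` carrier \<EE>"
    proof
      fix z assume "z \<in> carrier (Lbs_rel B R)"
      then obtain g where g: "keys g \<subseteq> NF B" "z = Lbs_class B R g"
        unfolding Lbs_class_surj[OF R_carrier, symmetric] by auto
      then have "z = \<pi> (cls (emb_free g))" "cls (emb_free g) \<in> carrier Ext"
        using \<pi>(2)[of "emb_free g"] by (simp_all add: X_keys \<Phi>_emb_free cls_closed)
      then show "z \<in> ?\<pi> ` carrier \<EE>" using \<tau> by (metis image_eqI)
    qed
  qed
  moreover have "?\<iota> ` carrier \<AA> = {e \<in> carrier \<EE>. ?\<pi> e = \<zero>\<^bsub>Lbs_rel B R\<^esub>}"
  proof
    show "?\<iota> ` carrier \<AA> \<subseteq> {e \<in> carrier \<EE>. ?\<pi> e = \<zero>\<^bsub>Lbs_rel B R\<^esub>}"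
      using \<tau> em zero by auto
  next
    show "{e \<in> carrier \<EE>. ?\<pi> e = \<zero>\<^bsub>Lbs_rel B R\<^esub>} \<subseteq> ?\<iota> ` carrier \<AA>"
    proof
      fix e assume "e \<in> {e \<in> carrier \<EE>. ?\<pi> e = \<zero>\<^bsub>Lbs_rel B R\<^esub>}"
      then have e: "e \<in> carrier \<EE>" "?\<pi> e = \<zero>\<^bsub>Lbs_rel B R\<^esub>" by auto
      then obtain x where x: "x \<in> carrier \<AA>" "\<theta> e = ?em x"
        using Ext_kernel[of "\<theta> e" \<pi>] \<pi>(2) \<theta>.closed by blast
      moreover have "e = ?\<tau> (\<theta> e)" using e(1) \<theta>(2) by (simp add: bij_betw_def)
      ultimately show "e \<in> ?\<iota> ` carrier \<AA>" by (metis image_eqI)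
    qed
  qed
  moreover have "superalgebra_hom \<AA> \<EE> ?\<iota>"
    by (rule superalgebra_hom_comp[OF emb_alg_hom \<theta>.inverse[OF \<theta>(2)]])
  moreover have "superalgebra_hom \<EE> (Lbs_rel B R) ?\<pi>"
    by (rule superalgebra_hom_comp[OF \<theta>(1) \<pi>(1)])
  ultimately show ?thesis
    unfolding is_extension_def
    using E leibniz_superalgebra_axioms leibniz_superalgebra_Lbs_rel[OF R_carrier] by blast
qed

end

section \<open>Extension data of a given extension\<close>

locale given_extension = reduced_relations B r R + graded_basis \<AA> A +
    E: leibniz_superalgebra \<EE>
  for B :: "bit \<Rightarrow> 'b set" and r :: "'b rel" and R :: "('b list \<Rightarrow>\<^sub>0 'k::field) set"
    and \<AA> :: "('k, 'a) superalgebra" (structure) and A :: "bit \<Rightarrow> 'a set" and \<EE> :: "('k, 'e) superalgebra" +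
  fixes \<iota> :: "'a \<Rightarrow> 'e" and \<pi> :: "'e \<Rightarrow> ('b list \<Rightarrow>\<^sub>0 'k) set"
  assumes disj: "B 0 \<inter> B 1 = {}"
    and \<iota>_hom: "superalgebra_hom \<AA> \<EE> \<iota>" and \<pi>_hom: "superalgebra_hom \<EE> (Lbs_rel B R) \<pi>"
    and \<iota>_inj: "inj_on \<iota> (carrier \<AA>)" and \<pi>_surj: "\<pi> ` carrier \<EE> = carrier (Lbs_rel B R)"
    and exact: "\<iota> ` carrier \<AA> = {x \<in> carrier \<EE>. \<pi> x = \<zero>\<^bsub>Lbs_rel B R\<^esub>}"
begin

sublocale \<iota>: leibniz_hom \<AA> \<EE> \<iota>
  by unfold_locales (rule \<iota>_hom)

sublocale \<pi>: leibniz_hom \<EE> "Lbs_rel B R" \<pi>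
  by unfold_locales (rule \<pi>_hom)

text \<open>A lift of the generators that keeps parity, as the universal property of
  \<open>Lbs B\<close> requires; it exists by \<open>part_preimage\<close>.\<close>

definition \<psi> :: "'b \<Rightarrow> 'e"
  where "\<psi> b = (SOME e. e \<in> part \<EE> (letter_parity B b) \<and> \<pi> e = Lbs_class B R (gen b))"

lemma gen_in_part: "b \<in> gset B \<Longrightarrow> gen b \<in> part (Lbs B) (letter_parity B b)"
  by (simp add: NF_def)

lemma \<psi>_props:
  assumes "b \<in> gset B"
  shows "\<psi> b \<in> part \<EE> (letter_parity B b)" "\<pi> (\<psi> b) = Lbs_class B R (gen b)"
proof -
  have *: "Lbs_class B R (gen b) \<in> part (Lbs_rel B R) (letter_parity B b)"
    by (rule cl.part[OF gen_in_part[OF assms]])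
  then have "Lbs_class B R (gen b) \<in> \<pi> ` carrier \<EE>"
    unfolding \<pi>_surj by (rule cl.M.part_in_carrier)
  then obtain e where "e \<in> carrier \<EE>" "\<pi> e = Lbs_class B R (gen b)" by auto
  with * have "\<exists>e. e \<in> part \<EE> (letter_parity B b) \<and> \<pi> e = Lbs_class B R (gen b)"
    using \<pi>.part_preimage by metis
  from someI_ex[OF this] show "\<psi> b \<in> part \<EE> (letter_parity B b)" "\<pi> (\<psi> b) = Lbs_class B R (gen b)"
    unfolding \<psi>_def by auto
qed

lemma gsetI: "b \<in> B i \<Longrightarrow> b \<in> gset B"
  by (cases i) (auto simp: gset_def)

lemma \<psi>_part: "b \<in> B i \<Longrightarrow> \<psi> b \<in> part \<EE> i"
  using \<psi>_props(1)[OF gsetI] letter_parity_eq[OF disj] by metis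

abbreviation \<rho> :: "('b list \<Rightarrow>\<^sub>0 'k) \<Rightarrow> 'e"
  where "\<rho> \<equiv> E.free_ext \<psi>"

sublocale \<rho>: leibniz_hom "Lbs B" \<EE> \<rho>
  by (rule leibniz_homI[OF L.leibniz_superalgebra_axioms E.leibniz_superalgebra_axioms
        E.free_ext_hom[OF disj \<psi>_part]])

text \<open>Both sides are homomorphisms out of the free superalgebra with the same values on
  generators, so each is the free extension of those values.\<close>

lemma \<pi>_\<rho>: "keys f \<subseteq> NF B \<Longrightarrow> \<pi> (\<rho> f) = Lbs_class B R f"
proof -
  assume f: "keys f \<subseteq> NF B"
  have cp: "Lbs_class B R (gen b) \<in> part (Lbs_rel B R) i" if "b \<in> B i" for b i
    using cl.part[OF gen_in_part[OF gsetI[OF that]]] letter_parity_eq[OF disj that] by metis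
  have "\<pi> (\<rho> f) = cl.M.free_ext (\<lambda>b. Lbs_class B R (gen b)) f"
    using E.free_ext_gen[where X = B and \<phi> = \<psi>, OF disj \<psi>_part] \<psi>_props(2)
    by (intro cl.M.free_ext_unique[OF disj cp superalgebra_hom_comp[OF \<rho>.hom \<pi>.hom] _ f]) auto
  moreover have "Lbs_class B R f = cl.M.free_ext (\<lambda>b. Lbs_class B R (gen b)) f"
    by (intro cl.M.free_ext_unique[OF disj cp cl.hom _ f]) auto
  ultimately show ?thesis by simp
qed

definition \<kappa> :: "'e \<Rightarrow> 'a"
  where "\<kappa> = inv_into (carrier \<AA>) \<iota>"

lemma \<kappa>:
  assumes "e \<in> carrier \<EE>" "\<pi> e = \<zero>\<^bsub>Lbs_rel B R\<^esub>"
  shows "\<iota> (\<kappa> e) = e" "\<kappa> e \<in> carrier \<AA>"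
proof -
  have "e \<in> \<iota> ` carrier \<AA>" using assms exact by simp
  then show "\<iota> (\<kappa> e) = e" "\<kappa> e \<in> carrier \<AA>"
    unfolding \<kappa>_def by (auto intro: f_inv_into_f inv_into_into)
qed

lemma \<pi>_\<iota>: "x \<in> carrier \<AA> \<Longrightarrow> \<pi> (\<iota> x) = \<zero>\<^bsub>Lbs_rel B R\<^esub>"
  using exact by blast

lemma \<iota>_eqI: "x \<in> carrier \<AA> \<Longrightarrow> y \<in> carrier \<AA> \<Longrightarrow> \<iota> x = \<iota> y \<Longrightarrow> x = y"
  using \<iota>_inj by (auto dest: inj_onD)

lemma \<iota>_part: "x \<in> carrier \<AA> \<Longrightarrow> \<iota> x \<in> part \<EE> i \<Longrightarrow> x \<in> part \<AA> i"
  using \<iota>.part_preimage[of x i] \<iota>_eqI part_in_carrier by metis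

section \<open>Actions and floor map read off inside the extension\<close>

definition lact :: "('b list \<Rightarrow>\<^sub>0 'k) \<Rightarrow> 'a \<Rightarrow> 'a"
  where "lact g x = \<kappa> (\<rho> g \<otimes>\<^bsub>\<EE>\<^esub> \<iota> x)"

definition ract :: "'a \<Rightarrow> ('b list \<Rightarrow>\<^sub>0 'k) \<Rightarrow> 'a"
  where "ract x g = \<kappa> (\<iota> x \<otimes>\<^bsub>\<EE>\<^esub> \<rho> g)"

text \<open>\<open>\<rho> f\<close> measures how far the lifted generators fail to satisfy the
  relation \<open>f\<close>. It lies in the kernel of \<pi>, since \<open>f\<close> vanishes in the
  quotient.\<close>

definition fl :: "('b list \<Rightarrow>\<^sub>0 'k) \<Rightarrow> 'a"
  where "fl f = \<kappa> (\<rho> f)"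

text \<open>A product with a factor from the image of \<iota> is sent to zero by \<pi>, so exactness
  allows it to be pulled back along \<iota>.\<close>

lemma lact:
  assumes "g \<in> carrier (Lbs B)" "x \<in> carrier \<AA>"
  shows "\<iota> (lact g x) = \<rho> g \<otimes>\<^bsub>\<EE>\<^esub> \<iota> x" "lact g x \<in> carrier \<AA>"
  unfolding lact_def using \<rho>.closed[OF assms(1)] \<iota>.closed[OF assms(2)] \<pi>_\<iota>[OF assms(2)]
  by (intro \<kappa>; simp add: E.mult_closed \<pi>.mult \<pi>.closed cl.M.mult_zero_right)+

lemma ract:
  assumes "g \<in> carrier (Lbs B)" "x \<in> carrier \<AA>"
  shows "\<iota> (ract x g) = \<iota> x \<otimes>\<^bsub>\<EE>\<^esub> \<rho> g" "ract x g \<in> carrier \<AA>"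
  unfolding ract_def using \<rho>.closed[OF assms(1)] \<iota>.closed[OF assms(2)] \<pi>_\<iota>[OF assms(2)]
  by (intro \<kappa>; simp add: E.mult_closed \<pi>.mult \<pi>.closed cl.M.mult_zero_left)+

lemma fl:
  assumes "f \<in> R"
  shows "\<iota> (fl f) = \<rho> f" "fl f \<in> carrier \<AA>"
proof -
  have f: "f \<in> carrier (Lbs B)" using assms R_carrier by blast
  then have "\<pi> (\<rho> f) = \<zero>\<^bsub>Lbs_rel B R\<^esub>"
    using \<pi>_\<rho>[of f] Lbs_class_zero_iff[OF R_carrier f] super_Id_superset[of R "Lbs B"] assms by auto
  from \<kappa>[OF \<rho>.closed[OF f] this] show "\<iota> (fl f) = \<rho> f" "fl f \<in> carrier \<AA>"
    unfolding fl_def by auto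
qed

text \<open>The sign with its parities in the other order, to agree literally with those supermodule
  axioms that write them so.\<close>

lemma E_leibniz:
  assumes "x \<in> part \<EE> i" "y \<in> part \<EE> j" "z \<in> part \<EE> l"
  shows "x \<otimes>\<^bsub>\<EE>\<^esub> (y \<otimes>\<^bsub>\<EE>\<^esub> z) = x \<otimes>\<^bsub>\<EE>\<^esub> y \<otimes>\<^bsub>\<EE>\<^esub> z \<ominus>\<^bsub>\<EE>\<^esub> ksign (j * l) \<odot>\<^bsub>\<EE>\<^esub> (x \<otimes>\<^bsub>\<EE>\<^esub> z \<otimes>\<^bsub>\<EE>\<^esub> y)"
  using E.leibniz[OF assms] by (simp only: mult.commute)

lemmas \<iota>_simps = lact ract \<iota>.add \<iota>.smult \<iota>.mult \<iota>.minus \<rho>.add \<rho>.smult \<rho>.mult \<iota>.closed \<rho>.closed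
  E.mult_add_left E.mult_add_right E.mult_smult_left E.mult_smult_right E.mult_closed E.smult_closed
  smult_closed mult_closed add.m_closed minus_closed

text \<open>After applying the injective map \<iota>, each identity is the Leibniz identity of \<EE>
  with every argument an image under \<iota> or \<rho>; closedness and linearity are inherited in
  the same way.\<close>

lemma compatible_supermodule_lact_ract: "compatible_supermodule (Lbs B) \<AA> lact ract"
proof -
  note C = L.mult_closed L.add.m_closed L.smult_closed
  have "supermodule (Lbs B) \<AA> lact ract"
    unfolding supermodule_def
  proof (intro conjI ballI allI)
    fix x :: "'b list \<Rightarrow>\<^sub>0 'k" assume x: "x \<in> carrier (Lbs B)"
    show "linear_map \<AA> \<AA> (lact x)" "linear_map \<AA> \<AA> (\<lambda>f. ract f x)"
      unfolding linear_map_def using x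
      by (auto intro!: \<iota>_eqI simp: \<iota>_simps simp del: Lbs_simps)
  next
    fix f assume f: "f \<in> carrier \<AA>"
    show "linear_map (Lbs B) \<AA> (\<lambda>x. lact x f)" "linear_map (Lbs B) \<AA> (ract f)"
      unfolding linear_map_def using f
      by (auto intro!: \<iota>_eqI simp: \<iota>_simps C simp del: Lbs_simps)
  next
    fix i j f and x :: "'b list \<Rightarrow>\<^sub>0 'k" assume fx: "f \<in> part \<AA> i" "x \<in> part (Lbs B) j"
    note c = part_in_carrier[OF fx(1)] L.part_in_carrier[OF fx(2)]
    show "ract f x \<in> part \<AA> (i + j)"
      using E.part_mult[OF \<iota>.part[OF fx(1)] \<rho>.part[OF fx(2)]] c by (intro \<iota>_part) (simp_all only: ract)
    show "lact x f \<in> part \<AA> (j + i)"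
      using E.part_mult[OF \<rho>.part[OF fx(2)] \<iota>.part[OF fx(1)]] c by (intro \<iota>_part) (simp_all only: lact)
  next
    fix l i j f and x y :: "'b list \<Rightarrow>\<^sub>0 'k" assume fxy: "f \<in> part \<AA> l" "x \<in> part (Lbs B) i" "y \<in> part (Lbs B) j"
    note c = part_in_carrier[OF fxy(1)] L.part_in_carrier[OF fxy(2)] L.part_in_carrier[OF fxy(3)]
    note e = \<iota>.part[OF fxy(1)] \<rho>.part[OF fxy(2)] \<rho>.part[OF fxy(3)]
    show "ract f (x \<otimes>\<^bsub>Lbs B\<^esub> y) = ract (ract f x) y \<ominus> ksign (i * j) \<odot> ract (ract f y) x"
      by (rule \<iota>_eqI) (simp_all only: \<iota>_simps C c E_leibniz[OF e(1,2,3)])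
    show "lact x (lact y f) = lact (x \<otimes>\<^bsub>Lbs B\<^esub> y) f \<ominus> ksign (l * j) \<odot> ract (lact x f) y"
      by (rule \<iota>_eqI) (simp_all only: \<iota>_simps C c E.leibniz[OF e(2,3,1)])
    show "lact x (ract f y) = ract (lact x f) y \<ominus> ksign (l * j) \<odot> lact (x \<otimes>\<^bsub>Lbs B\<^esub> y) f"
      by (rule \<iota>_eqI) (simp_all only: \<iota>_simps C c E_leibniz[OF e(2,1,3)])
  qed
  moreover have "lact x (f \<otimes> f') = lact x f \<otimes> f' \<ominus> ksign (l * m) \<odot> (lact x f' \<otimes> f)"
    "f \<otimes> ract f' x = ract (f \<otimes> f') x \<ominus> ksign (i * m) \<odot> (ract f x \<otimes> f')"
    "f \<otimes> lact x f' = ract f x \<otimes> f' \<ominus> ksign (i * m) \<odot> ract (f \<otimes> f') x"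
    if fx: "f \<in> part \<AA> l" "f' \<in> part \<AA> m" "x \<in> part (Lbs B) i" for l m i f f' x
  proof -
    note c = part_in_carrier[OF fx(1)] part_in_carrier[OF fx(2)] L.part_in_carrier[OF fx(3)]
    note e = \<iota>.part[OF fx(1)] \<iota>.part[OF fx(2)] \<rho>.part[OF fx(3)]
    show "lact x (f \<otimes> f') = lact x f \<otimes> f' \<ominus> ksign (l * m) \<odot> (lact x f' \<otimes> f)"
      by (rule \<iota>_eqI) (simp_all only: \<iota>_simps C c E_leibniz[OF e(3,1,2)])
    show "f \<otimes> ract f' x = ract (f \<otimes> f') x \<ominus> ksign (i * m) \<odot> (ract f x \<otimes> f')"
      by (rule \<iota>_eqI) (simp_all only: \<iota>_simps C c E.leibniz[OF e(1,2,3)])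
    show "f \<otimes> lact x f' = ract f x \<otimes> f' \<ominus> ksign (i * m) \<odot> ract (f \<otimes> f') x"
      by (rule \<iota>_eqI) (simp_all only: \<iota>_simps C c E_leibniz[OF e(1,3,2)])
  qed
  ultimately show ?thesis unfolding compatible_supermodule_def by blast
qed

lemma \<iota>_chain:
  assumes "s \<in> R" "c \<in> lists (gset B)"
  shows "foldl (\<lambda>y b. ract y (gen b)) (fl s) c \<in> carrier \<AA> \<and>
    \<iota> (foldl (\<lambda>y b. ract y (gen b)) (fl s) c) = \<rho> (np s c)"
  using assms(2)
proof (induction c rule: rev_induct)
  case Nil
  show ?case using fl[OF assms(1)] by (simp add: left_normed_def)
next
  case (snoc b c)
  then have g: "gen b \<in> carrier (Lbs B)" "np s c \<in> carrier (Lbs B)"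
    using np_carrier[of s c] assms(1) by (auto simp: NF_def D_iff)
  then have "\<rho> (np s (c @ [b])) = \<rho> (np s c) \<otimes>\<^bsub>\<EE>\<^esub> \<rho> (gen b)"
    unfolding np_snoc using \<rho>.mult[OF g(2,1)] by simp
  with snoc show ?case using ract[OF g(1)] by simp
qed

text \<open>Inside \<EE>, replacing \<open>s\<close> by its floor changes nothing, since \<iota>
  takes the floor to \<open>\<rho> s\<close>. Condition (ii) thereby becomes multiplicativity of
  \<rho>.\<close>

lemma \<iota>_floor_expr:
  assumes "\<forall>(\<alpha>, s, c)\<in>set ts. (s, c) \<in> D"
  shows "floor_expr \<AA> ract fl ts \<in> carrier \<AA> \<and> \<iota> (floor_expr \<AA> ract fl ts) = \<rho> (expr_sum ts)"
  using assms
proof (induction ts)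
  case Nil
  show ?case using \<iota>.zero \<rho>.zero by (simp add: floor_expr_def)
next
  case (Cons t ts)
  obtain \<alpha> s c where t: "t = (\<alpha>, s, c)" by (cases t)
  let ?ch = "foldl (\<lambda>y b. ract y (gen b)) (fl s) c"
  have sc: "(s, c) \<in> D" using Cons.prems t by auto
  then have ch: "?ch \<in> carrier \<AA>" "\<iota> ?ch = \<rho> (np s c)" using \<iota>_chain by (simp_all add: D_def)
  have IH: "floor_expr \<AA> ract fl ts \<in> carrier \<AA>" "\<iota> (floor_expr \<AA> ract fl ts) = \<rho> (expr_sum ts)"
    using Cons by auto
  have k: "np s c \<in> carrier (Lbs B)" "\<alpha> *p np s c \<in> carrier (Lbs B)" "expr_sum ts \<in> carrier (Lbs B)"
    using np_carrier[OF sc] IR_carrier[OF expr_sum_IR[of ts]] Cons.prems by (auto simp: keys_pscale_subset)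
  have "\<rho> (expr_sum (t # ts)) = \<alpha> \<odot>\<^bsub>\<EE>\<^esub> \<rho> (np s c) \<oplus>\<^bsub>\<EE>\<^esub> \<rho> (expr_sum ts)"
    using \<rho>.add[OF k(2,3)] \<rho>.smult[OF k(1), of \<alpha>] by (simp add: t)
  moreover have "floor_expr \<AA> ract fl (t # ts) = \<alpha> \<odot> ?ch \<oplus> floor_expr \<AA> ract fl ts"
    by (simp add: floor_expr_def t)
  ultimately show ?case
    using ch IH by (simp add: \<iota>.add \<iota>.smult smult_closed)
qed

lemma extension_data_lact_ract: "extension_data \<AA> A B r R lact ract fl"
  unfolding extension_data_def
proof (intro conjI allI ballI)
  show "compatible_supermodule (Lbs B) \<AA> lact ract" by (rule compatible_supermodule_lact_ract)
  show "fl f \<in> part \<AA> i" if "f \<in> R \<inter> part (Lbs B) i" for f i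
    using that fl[of f] \<rho>.part[of f i] by (intro \<iota>_part) (simp_all del: Lbs_simps)
next
  fix a f assume af: "a \<in> gset A" "f \<in> R"
  have c: "a \<in> carrier \<AA>" "f \<in> carrier (Lbs B)" using af basis_carrier R_carrier by blast+
  show "ract a f = a \<otimes> fl f" "lact f a = fl f \<otimes> a"
    by (rule \<iota>_eqI; simp only: \<iota>_simps c fl[OF af(2)])+
next
  fix \<mu> f assume \<mu>f: "\<mu> \<in> NF B" "f \<in> R"
  have c: "nfmon \<mu> \<in> carrier (Lbs B)" "f \<in> carrier (Lbs B)" using \<mu>f R_carrier by auto
  have IR: "lb_mult B (nfmon \<mu>) f \<in> IR" using \<mu>f R_subset_IR c by (intro IR_mult_left) auto
  let ?ts = "normal_expr B r R (lb_mult B (nfmon \<mu>) f)"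
  have "\<forall>(\<alpha>, s, c)\<in>set ?ts. (s, c) \<in> D" using normal_expr(1)[OF IR] by (auto simp: valid_terms_def)
  from \<iota>_floor_expr[OF this] have "floor_expr \<AA> ract fl ?ts \<in> carrier \<AA>"
    "\<iota> (floor_expr \<AA> ract fl ?ts) = \<rho> (nfmon \<mu>) \<otimes>\<^bsub>\<EE>\<^esub> \<rho> f"
    using normal_expr(2)[OF IR] \<rho>.mult[OF c] by auto
  then show "lact (nfmon \<mu>) (fl f) = floor_expr \<AA> ract fl ?ts"
    using lact[OF c(1) fl(2)[OF \<mu>f(2)]] fl(1)[OF \<mu>f(2)] by (intro \<iota>_eqI) simp_all
qed

sublocale S: extension_setup B r R \<AA> A lact ract fl
  by unfold_locales (rule disj extension_data_lact_ract)+

section \<open>Comparing the semidirect product with the extension\<close>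

definition \<theta> :: "'a \<times> ('b list \<Rightarrow>\<^sub>0 'k) \<Rightarrow> 'e"
  where "\<theta> p = \<iota> (fst p) \<oplus>\<^bsub>\<EE>\<^esub> \<rho> (snd p)"

lemma \<theta>_hom: "superalgebra_hom S.P \<EE> \<theta>"
  unfolding superalgebra_hom_def linear_map_def
proof (intro conjI ballI allI image_subsetI)
  show "\<theta> \<in> carrier S.P \<rightarrow> carrier \<EE>"
    by (auto simp: \<theta>_def \<iota>.closed \<rho>.closed simp del: Lbs_simps)
  show "\<theta> p \<in> part \<EE> i" if "p \<in> part S.P i" for p i
    using that \<iota>.part \<rho>.part unfolding \<theta>_def semidirect_simps by (intro E.part_add) auto
  fix p q c assume "p \<in> carrier S.P"
  then obtain x g where p: "p = (x, g)" and xg: "x \<in> carrier \<AA>" "g \<in> carrier (Lbs B)" by auto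
  show "\<theta> (c \<odot>\<^bsub>S.P\<^esub> p) = c \<odot>\<^bsub>\<EE>\<^esub> \<theta> p"
    unfolding p \<theta>_def semidirect_simps fst_conv snd_conv
    using xg by (simp only: \<iota>_simps E.smult_r_distr)
  assume "q \<in> carrier S.P"
  then obtain y h where q: "q = (y, h)" and yh: "y \<in> carrier \<AA>" "h \<in> carrier (Lbs B)" by auto
  have cl: "\<iota> x \<in> carrier \<EE>" "\<iota> y \<in> carrier \<EE>" "\<rho> g \<in> carrier \<EE>" "\<rho> h \<in> carrier \<EE>"
    using xg yh \<iota>.closed \<rho>.closed by blast+
  show "\<theta> (p \<oplus>\<^bsub>S.P\<^esub> q) = \<theta> p \<oplus>\<^bsub>\<EE>\<^esub> \<theta> q"
    unfolding p q \<theta>_def semidirect_simps fst_conv snd_conv \<iota>.add[OF xg(1) yh(1)] \<rho>.add[OF xg(2) yh(2)]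
    using cl by (simp add: E.a_ac)
  have "\<theta> (p \<otimes>\<^bsub>S.P\<^esub> q) =
      (\<iota> x \<otimes>\<^bsub>\<EE>\<^esub> \<iota> y \<oplus>\<^bsub>\<EE>\<^esub> \<iota> x \<otimes>\<^bsub>\<EE>\<^esub> \<rho> h \<oplus>\<^bsub>\<EE>\<^esub> \<rho> g \<otimes>\<^bsub>\<EE>\<^esub> \<iota> y) \<oplus>\<^bsub>\<EE>\<^esub> \<rho> g \<otimes>\<^bsub>\<EE>\<^esub> \<rho> h"
    unfolding p q \<theta>_def semidirect_simps(2) fst_conv snd_conv
    using xg yh by (simp only: \<iota>_simps)
  also have "\<dots> = \<theta> p \<otimes>\<^bsub>\<EE>\<^esub> \<theta> q"
    unfolding p q \<theta>_def fst_conv snd_conv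
    using cl by (simp add: E.mult_add_left E.mult_add_right E.mult_closed E.a_ac)
  finally show "\<theta> (p \<otimes>\<^bsub>S.P\<^esub> q) = \<theta> p \<otimes>\<^bsub>\<EE>\<^esub> \<theta> q" .
qed

lemma \<rho>_IR: "h \<in> IR \<Longrightarrow> \<rho> h = \<iota> (S.Floor h)"
proof -
  assume h: "h \<in> IR"
  have "\<forall>(\<alpha>, s, c)\<in>set (normal_expr B r R h). (s, c) \<in> D"
    using normal_expr(1)[OF h] by (auto simp: valid_terms_def)
  from \<iota>_floor_expr[OF this] show ?thesis
    using S.floor_expr_valid[OF normal_expr(1)[OF h]] normal_expr(2)[OF h] by simp
qed

text \<open>Applying \<pi> to a vanishing value shows that the second component g lies in
  \<open>IR\<close>. Then \<open>\<rho> g\<close> is the image of \<open>Floor g\<close> under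
  \<iota>, and injectivity forces the first component to be its negative.\<close>

lemma \<theta>_zero_iff:
  assumes "p \<in> carrier S.P"
  shows "\<theta> p = \<zero>\<^bsub>\<EE>\<^esub> \<longleftrightarrow> p \<in> S.J"
proof -
  obtain x g where p: "p = (x, g)" and xg: "x \<in> carrier \<AA>" "g \<in> carrier (Lbs B)"
    using assms by auto
  note cl = \<iota>.closed[OF xg(1)] \<rho>.closed[OF xg(2)]
  have iff: "\<theta> p = \<zero>\<^bsub>\<EE>\<^esub> \<longleftrightarrow> x = \<ominus> S.Floor g" if g: "g \<in> IR"
  proof -
    have F: "S.Floor g \<in> carrier \<AA>" by (rule S.Floor_closed[OF g])
    have "\<theta> p = \<iota> (x \<oplus> S.Floor g)"
      using \<iota>.add[OF xg(1) F] \<rho>_IR[OF g] by (simp add: \<theta>_def p)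
    moreover have "x \<oplus> S.Floor g \<in> carrier \<AA>" using xg(1) F by simp
    ultimately have "\<theta> p = \<zero>\<^bsub>\<EE>\<^esub> \<longleftrightarrow> x \<oplus> S.Floor g = \<zero>"
      using \<iota>_eqI[OF _ zero_closed] \<iota>.zero by metis
    then show ?thesis using minus_equality[OF _ F xg(1)] l_neg[OF F] by metis
  qed
  moreover have "g \<in> IR" if "\<theta> p = \<zero>\<^bsub>\<EE>\<^esub>"
  proof -
    have "\<pi> (\<theta> p) = \<pi> (\<iota> x) \<oplus>\<^bsub>Lbs_rel B R\<^esub> \<pi> (\<rho> g)"
      unfolding p \<theta>_def fst_conv snd_conv by (rule \<pi>.add[OF cl])
    then have "Lbs_class B R g = \<zero>\<^bsub>Lbs_rel B R\<^esub>"
      using that \<pi>.zero \<pi>_\<iota>[OF xg(1)] \<pi>_\<rho>[of g] xg(2) cl.closed[OF xg(2)] by simp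
    then show ?thesis using Lbs_class_zero_iff[OF R_carrier xg(2)] super_Id_R by simp
  qed
  ultimately show ?thesis unfolding p S.J_iff by blast
qed

text \<open>The composite of \<open>S.\<Phi>\<close> and \<theta> has the same kernel as the class
  map, namely the preimage of \<open>S.J\<close>; it therefore induces an injective map on the
  presented algebra, and only surjectivity remains.\<close>

lemma isomorphic_Ext: "superalgebra_isomorphic \<EE> S.Ext"
proof -
  have h: "superalgebra_hom (Lbs S.X) \<EE> (\<lambda>w. \<theta> (S.\<Phi> w))"
    by (rule superalgebra_hom_comp[OF S.\<Phi>.hom \<theta>_hom])
  have zero: "\<theta> (S.\<Phi> w) = \<zero>\<^bsub>\<EE>\<^esub> \<longleftrightarrow> S.cls w = \<zero>\<^bsub>S.Ext\<^esub>" if "w \<in> carrier (Lbs S.X)" for w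
    using \<theta>_zero_iff[OF S.\<Phi>.closed[OF that]] S.cls_zero_iff[of w] that by simp
  obtain k where k: "superalgebra_hom S.Ext \<EE> k" "\<And>w. w \<in> carrier (Lbs S.X) \<Longrightarrow> k (S.cls w) = \<theta> (S.\<Phi> w)"
    using superalgebra_hom_factor[OF leibniz_superalgebra_Lbs S.leibniz_superalgebra_Ext
        E.leibniz_superalgebra_axioms S.q.hom S.cls_surj h] zero by blast
  interpret k: leibniz_hom S.Ext \<EE> k
    by (rule leibniz_homI[OF S.leibniz_superalgebra_Ext E.leibniz_superalgebra_axioms k(1)])
  have "inj_on k (carrier S.Ext)"
  proof (rule k.inj_onI_kernel)
    fix z assume "z \<in> carrier S.Ext" "k z = \<zero>\<^bsub>\<EE>\<^esub>"
    then show "z = \<zero>\<^bsub>S.Ext\<^esub>" unfolding S.cls_surj[symmetric] using k(2) zero by auto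
  qed
  moreover have "k ` carrier S.Ext = carrier \<EE>"
  proof
    show "k ` carrier S.Ext \<subseteq> carrier \<EE>" using k.closed by auto
    show "carrier \<EE> \<subseteq> k ` carrier S.Ext"
    proof
      fix e assume e: "e \<in> carrier \<EE>"
      then have "\<pi> e \<in> carrier (Lbs_rel B R)" by (rule \<pi>.closed)
      then obtain g where g: "g \<in> carrier (Lbs B)" "\<pi> e = Lbs_class B R g"
        unfolding Lbs_class_surj[OF R_carrier, symmetric] by blast
      have \<rho>g: "\<rho> g \<in> carrier \<EE>" by (rule \<rho>.closed[OF g(1)])
      have "\<pi> (\<rho> g) = \<pi> e" using \<pi>_\<rho>[of g] g by simp
      then have "\<pi> (e \<ominus>\<^bsub>\<EE>\<^esub> \<rho> g) = \<zero>\<^bsub>Lbs_rel B R\<^esub>" using e \<rho>g \<pi>.eq_iff by metis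
      \<comment> \<open>The lift \<open>\<rho> g\<close> and \<open>e\<close> have the same image
        under \<pi>, so their difference comes from some x in \<AA>, and (x, g) is a preimage of
        \<open>e\<close> under \<theta>.\<close>
      from \<kappa>[OF _ this] obtain x where x: "x \<in> carrier \<AA>" "\<iota> x = e \<ominus>\<^bsub>\<EE>\<^esub> \<rho> g" using e \<rho>g by blast
      have "\<theta> (x, g) = e" using x e \<rho>g by (simp add: \<theta>_def a_minus_def E.a_assoc E.l_neg)
      moreover have w: "keys (emb x + emb_free g :: ('a + 'b) list \<Rightarrow>\<^sub>0 'k) \<subseteq> NF S.X"
        using x g by (intro S.X_keys) simp_all
      ultimately have "k (S.cls (emb x + emb_free g)) = e"
        using k(2)[of "emb x + emb_free g"] S.\<Phi>_emb[of x g] x g by simp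
      then show "e \<in> k ` carrier S.Ext" using S.cls_closed[OF w] by blast
    qed
  qed
  ultimately show ?thesis
    using superalgebra_isomorphicI[OF S.leibniz_superalgebra_Ext E.leibniz_superalgebra_axioms k(1)]
    by (simp add: bij_betw_def)
qed

end

theorem theorem6p9:
  fixes \<AA> :: "('k::field, 'a) superalgebra" and \<EE> :: "('k, 'e) superalgebra"
    and A :: "bit \<Rightarrow> 'a set" and rA :: "'a rel"
    and B :: "bit \<Rightarrow> 'b set" and rB :: "'b rel"
    and R :: "('b list \<Rightarrow>\<^sub>0 'k) set"
  assumes "leibniz_superalgebra \<AA>"
    and "\<And>i. linear_basis \<AA> (part \<AA> i) (A i)"
    and "well_order_on (gset A) rA"
    and "B 0 \<inter> B 1 = {}"
    and "well_order_on (gset B) rB"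
    and "R \<subseteq> carrier (Lbs B)"
    and "reduced_GS_basis B rB R"
    and "\<forall>f\<in>R. length (lead rB f) > 1"
    and "leibniz_superalgebra \<EE>"
  shows
    "(is_extension \<EE> (Lbs_rel B R) \<AA> \<longleftrightarrow>
      (\<exists>lact ract fl. extension_data \<AA> A B rB R lact ract fl \<and>
        superalgebra_isomorphic \<EE> (ext_algebra \<AA> A B R lact ract fl))) \<and>
     (\<forall>lact ract fl. extension_data \<AA> A B rB R lact ract fl \<and>
        superalgebra_isomorphic \<EE> (ext_algebra \<AA> A B R lact ract fl) \<longrightarrow>
        linear_iso ((Lbs B)\<lparr>carrier := lb.span (nfmon ` Irr B rB R)\<rparr>) (Lbs_rel B R) (Lbs_class B R) \<and>
        linear_iso (direct_sum \<AA> ((Lbs B)\<lparr>carrier := lb.span (nfmon ` Irr B rB R)\<rparr>))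
          (ext_algebra \<AA> A B R lact ract fl)
          (\<lambda>(x, g). ext_class \<AA> A B R lact ract fl (emb_alg \<AA> A x + emb_free g)) \<and>
        (\<forall>a\<in>gset A. \<forall>a'\<in>gset A. \<forall>\<nu>\<in>Irr B rB R. \<forall>\<nu>'\<in>Irr B rB R.
          \<exists>d ts.
            (d \<in> lb.span (nfmon ` Irr B rB R) \<and>
             is_normal_expr B rB R (lb_mult B (nfmon \<nu>) (nfmon \<nu>') - d) ts) \<and>
            (\<forall>d' ts'. d' \<in> lb.span (nfmon ` Irr B rB R) \<and>
               is_normal_expr B rB R (lb_mult B (nfmon \<nu>) (nfmon \<nu>') - d') ts' \<longrightarrow> d' = d \<and> ts' = ts) \<and>
            ext_class \<AA> A B R lact ract fl (gen (Inl a) + emb_free (nfmon \<nu>))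
              \<otimes>\<^bsub>ext_algebra \<AA> A B R lact ract fl\<^esub>
            ext_class \<AA> A B R lact ract fl (gen (Inl a') + emb_free (nfmon \<nu>')) =
            ext_class \<AA> A B R lact ract fl
              (emb_alg \<AA> A (a \<otimes>\<^bsub>\<AA>\<^esub> a') + emb_alg \<AA> A (ract a (nfmon \<nu>')) +
               emb_alg \<AA> A (lact (nfmon \<nu>) a') + emb_alg \<AA> A (floor_expr \<AA> ract fl ts) +
               emb_free d)))"
proof -
  have rel: "reduced_relations B rB R"
    using assms(5-8)
    by (simp add: reduced_relations_def monomial_order_def reduced_relations_axioms_def)
  have bas: "graded_basis \<AA> A"
    using assms(1,2) by (simp add: graded_basis_def graded_basis_axioms_def)
  have ext_setup: "extension_setup B rB R \<AA> A lact ract fl"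
    if "extension_data \<AA> A B rB R lact ract fl" for lact ract fl
    using rel bas assms(4) that by (simp add: extension_setup_def extension_setup_axioms_def)
  have "\<exists>lact ract fl. extension_data \<AA> A B rB R lact ract fl \<and>
      superalgebra_isomorphic \<EE> (ext_algebra \<AA> A B R lact ract fl)"
    if ext: "is_extension \<EE> (Lbs_rel B R) \<AA>"
  proof -
    obtain \<iota> \<pi> where *: "superalgebra_hom \<AA> \<EE> \<iota>" "superalgebra_hom \<EE> (Lbs_rel B R) \<pi>"
      "inj_on \<iota> (carrier \<AA>)" "\<pi> ` carrier \<EE> = carrier (Lbs_rel B R)"
      "\<iota> ` carrier \<AA> = {x \<in> carrier \<EE>. \<pi> x = \<zero>\<^bsub>Lbs_rel B R\<^esub>}"
      using ext unfolding is_extension_def by blast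
    interpret given_extension B rB R \<AA> A \<EE> \<iota> \<pi>
      using rel bas assms(4,9) * by (simp add: given_extension_def given_extension_axioms_def)
    show ?thesis using extension_data_lact_ract isomorphic_Ext by blast
  qed
  \<comment> \<open>Only the forward implication had to produce data. The converse and the
    description of the algebra hold for arbitrary admissible data and are taken from the
    locales.\<close>
  then show ?thesis
    using extension_setup.is_extension_Ext[OF ext_setup assms(9)] reduced_relations.linear_iso_Irr[OF rel]
      extension_setup.linear_iso_Ext[OF ext_setup] extension_setup.Ext_mult[OF ext_setup]
    by blast
qed

end
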